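(* Let $\alpha\in(0,\infty)$ and let $\mathcal{M}$ be a smooth, $n$-dimensional, closed, connected hypersurface in $\mathbb{R}^{n+1}$. Let $h$ be the metric on $\mathcal{M}$ induced by the Euclidean metric $\mathfrak{e}$ of the ambient space, and let the time-dependent embedding $\hat x_\alpha:\mathcal{M}\times[0,T)\to\mathbb{R}^{n+1}$ evolve according to $$\big(\alpha\hat\rho\,\mathbb{1}+(1-\alpha\hat\rho)(\nu\circ\hat x_\alpha)\otimes(\nu\circ\hat x_\alpha)\big)\frac{\partial}{\partial t}\hat x_\alpha=\Delta_{\hat g_\alpha(t)}\hat x_\alpha+\hat\rho\,(P\circ\hat x_\alpha)\,\Delta_h\hat x_\alpha,$$ where $\hat g_\alpha(t):=\hat x_\alpha(t)^*\mathfrak{e}$, $\hat\rho:=\sqrt{\det(h_{ij})}/\sqrt{\det(\hat g_{\alpha ij})}$, $\nu$ is a unit normal field on $\Gamma(t):=\hat x_\alpha(\mathcal{M},t)$ and $P:=\mathbb{1}-\nu\otimes\nu$. Let $\rho:=\hat\rho\circ\hat x_\alpha^{-1}$ and $$\hat H_\alpha(t):=(\nabla_{\Gamma(t)}\hat x_\alpha^{-1}(t))^T\nabla_{\Gamma(t)}\hat x_\alpha^{-1}(t)+\nu(t)\otimes\nu(t).$$ Then the identity map $u:=\mathrm{id}_{\Gamma(t)}$ on $\Gamma(t)$ satisfies \begin{align*} 0&=\int_{\Gamma(t)}(\alpha\rho)\,\partial^\bullet u\cdot\eta\,d\sigma+\int_{\Gamma(t)}(1-\alpha\rho)(\partial^\bullet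 u\cdot\nu)(\nu\cdot\eta)\,d\sigma\\ &\quad+\int_{\Gamma(t)}\nabla_{\Gamma(t)}u:\nabla_{\Gamma(t)}\eta\,d\sigma+\int_{\Gamma(t)}\hat H_\alpha^{-1}\nabla_{\Gamma(t)}u:\nabla_{\Gamma(t)}(P\eta)\,\rho\,d\sigma \end{align*} for all $\eta\in H^{1,2}(\Gamma(t),\mathbb{R}^{n+1})$ and all $t\in[0,T)$, where $\hat H_\alpha^{-1}\nabla_{\Gamma(t)}u:\nabla_{\Gamma(t)}(P\eta):=(\hat H_\alpha^{-1})^{\gamma\kappa}\,\underline{D}'_\gamma u_\beta\,\underline{D}'_\kappa(P\eta)_\beta$. Moreover, the weight function $\rho$ is given by $\rho=\sqrt{\det\hat H_\alpha}$.
   Context: Repeated indices are summed. For an embedding $x$ with local representation $X=x\circ\mathcal{C}^{-1}$ in a chart $\mathcal{C}$ of $\mathcal{M}$, $x^*\mathfrak{e}$ has components $\frac{\partial X}{\partial\theta^i}\cdot\frac{\partial X}{\partial\theta^j}$. For a metric $g$, $(g^{ij})=(g_{ij})^{-1}$, $\Gamma(g)^k_{ij}=\frac12g^{kl}(\partial_ig_{lj}+\partial_jg_{li}-\partial_lg_{ij})$, and the Laplacian of $f$ with $F=f\circ\mathcal{C}^{-1}$ is $\Delta_gf=g^{ij}(\frac{\partial^2F}{\partial\theta^i\partial\theta^j}-\Gamma(g)^k_{ij}\frac{\partial F}{\partial\theta^k})$, applied componentwise to $\mathbb{R}^{n+1}$-valued maps. $\hat\rho$ is evaluated in any local coordinates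 of $\mathcal{M}$ and is independent of their choice. $\hat x_\alpha$ is at least of class $C^2$ in space and $C^1$ in time. $\mathbb{1}$ is the identity matrix of $\mathbb{R}^{n+1}$ and $(a\otimes b)c=a(b\cdot c)$. Tangential gradient on $\Gamma(t)$: $\nabla_{\Gamma(t)}f=\nabla\bar f-(\nu\cdot\nabla\bar f)\nu$ for any differentiable extension $\bar f$ of $f$, with components $\underline{D}'_\beta f$, $\beta=1,\dots,n+1$. For vector-valued $f$, $\nabla_{\Gamma(t)}f$ is the matrix with entries $(\nabla_{\Gamma(t)}f)_{\kappa\beta}=\underline{D}'_\beta f_\kappa$. $A:B=\sum_{\alpha,\beta}A_{\alpha\beta}B_{\alpha\beta}$. $\hat x_\alpha^{-1}(t):\Gamma(t)\to\mathcal{M}\subset\mathbb{R}^{n+1}$ is the inverse of $\hat x_\alpha(t)$. The material derivative is defined by $(\partial^\bullet f)\circ\hat x_\alpha=\frac{\partial}{\partial t}(f\circ\hat x_\alpha)$, so $\partial^\bullet u=\frac{\partial\hat x_\alpha}{\partial t}\circ\hat x_\alpha^{-1}$. $d\sigma$ is the $n$-dimensional Hausdorff measure on $\Gamma(t)$. *)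

theory Defs
  imports "HOL-Analysis.Analysis"
begin

definition pd :: "'n \<Rightarrow> (real^'n \<Rightarrow> 'b::real_normed_vector) \<Rightarrow> real^'n \<Rightarrow> 'b" where
  "pd i f \<theta> = frechet_derivative f (at \<theta>) (axis i 1)"

(* Intended for open sets U only. *)
primrec Ck_on :: "nat \<Rightarrow> (real^'n) set \<Rightarrow> (real^'n \<Rightarrow> 'b::real_normed_vector) \<Rightarrow> bool" where
  "Ck_on 0 U f \<longleftrightarrow> continuous_on U f"
| "Ck_on (Suc k) U f \<longleftrightarrow> f differentiable_on U \<and> (\<forall>i. Ck_on k U (pd i f))"

definition smooth_on :: "(real^'n) set \<Rightarrow> (real^'n \<Rightarrow> 'b::real_normed_vector) \<Rightarrow> bool" where
  "smooth_on U f \<longleftrightarrow> (\<forall>k. Ck_on k U f)"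

definition gradient :: "(real^'m \<Rightarrow> real) \<Rightarrow> real^'m \<Rightarrow> real^'m" where
  "gradient f p = (\<chi> \<beta>. pd \<beta> f p)"

definition outer :: "real^'m \<Rightarrow> real^'m \<Rightarrow> real^'m^'m" (infix "\<otimes>\<^sub>v" 75) where
  "a \<otimes>\<^sub>v b = (\<chi> \<kappa> \<beta>. a $ \<kappa> * b $ \<beta>)"

(* (U, X) is the inverse of a smooth chart of M: X maps the open coordinate domain U onto a
   relatively open subset of M. *)
definition local_param ::
    "(real^'m) set \<Rightarrow> (real^'n) set \<Rightarrow> (real^'n \<Rightarrow> real^'m) \<Rightarrow> bool" where
  "local_param M U X \<longleftrightarrow>
     open U \<and> smooth_on U X \<and> openin (top_of_set M) (X ` U) \<and>
     (\<exists>C. homeomorphism U (X ` U) X C) \<and>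
     (\<forall>\<theta>\<in>U. inj (frechet_derivative X (at \<theta>)))"

(* The dimension CARD('n) of the hypersurface is passed as a type argument. *)
definition smooth_hypersurface :: "'n::finite itself \<Rightarrow> (real^'m) set \<Rightarrow> bool" where
  "smooth_hypersurface _ M \<longleftrightarrow>
     CARD('m) = CARD('n) + 1 \<and>
     (\<forall>p\<in>M. \<exists>U (X :: real^'n \<Rightarrow> real^'m). local_param M U X \<and> p \<in> X ` U)"

definition C2_embedding ::
    "'n::finite itself \<Rightarrow> (real^'m) set \<Rightarrow> (real^'m \<Rightarrow> real^'m) \<Rightarrow> bool" where
  "C2_embedding _ M x \<longleftrightarrow>
     (\<exists>y. homeomorphism M (x ` M) x y) \<and>
     (\<forall>U (X :: real^'n \<Rightarrow> real^'m). local_param M U X \<longrightarrow>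
        Ck_on 2 U (x \<circ> X) \<and> (\<forall>\<theta>\<in>U. inj (frechet_derivative (x \<circ> X) (at \<theta>))))"

definition C1_in_time ::
    "real set \<Rightarrow> (real^'m) set \<Rightarrow> (real \<Rightarrow> real^'m \<Rightarrow> real^'m) \<Rightarrow> bool" where
  "C1_in_time I M x \<longleftrightarrow>
     (\<forall>p\<in>M. \<exists>v. (\<forall>t\<in>I. ((\<lambda>s. x s p) has_vector_derivative v t) (at t within I)) \<and>
        continuous_on I v)"

definition unit_normal_field ::
    "'n::finite itself \<Rightarrow> (real^'m) set \<Rightarrow> (real^'m \<Rightarrow> real^'m) \<Rightarrow> (real^'m \<Rightarrow> real^'m) \<Rightarrow> bool" where
  "unit_normal_field _ M x \<nu> \<longleftrightarrow>
     continuous_on (x ` M) \<nu> \<and> (\<forall>y\<in>x ` M. norm (\<nu> y) = 1) \<and>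
     (\<forall>U (X :: real^'n \<Rightarrow> real^'m). local_param M U X \<longrightarrow>
        (\<forall>\<theta>\<in>U. \<forall>i. \<nu> (x (X \<theta>)) \<bullet> pd i (x \<circ> X) \<theta> = 0))"

(* The coordinate matrix of the metric induced by a local representation X. *)
definition induced_metric :: "(real^'n \<Rightarrow> real^'m) \<Rightarrow> real^'n \<Rightarrow> real^'n^'n" where
  "induced_metric X \<theta> = (\<chi> i j. pd i X \<theta> \<bullet> pd j X \<theta>)"

definition christoffel :: "(real^'n \<Rightarrow> real^'n^'n) \<Rightarrow> 'n \<Rightarrow> 'n \<Rightarrow> 'n \<Rightarrow> real^'n \<Rightarrow> real" where
  "christoffel g k i j \<theta> =
     (1/2) * (\<Sum>l\<in>UNIV. matrix_inv (g \<theta>) $ k $ l *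
        (pd i (\<lambda>\<xi>. g \<xi> $ l $ j) \<theta> + pd j (\<lambda>\<xi>. g \<xi> $ l $ i) \<theta> - pd l (\<lambda>\<xi>. g \<xi> $ i $ j) \<theta>))"

(* For vector-valued F this acts componentwise. *)
definition laplacian ::
    "(real^'n \<Rightarrow> real^'n^'n) \<Rightarrow> (real^'n \<Rightarrow> 'b::real_normed_vector) \<Rightarrow> real^'n \<Rightarrow> 'b" where
  "laplacian g F \<theta> =
     (\<Sum>i\<in>UNIV. \<Sum>j\<in>UNIV. matrix_inv (g \<theta>) $ i $ j *\<^sub>R
        (pd i (pd j F) \<theta> - (\<Sum>k\<in>UNIV. christoffel g k i j \<theta> *\<^sub>R pd k F \<theta>)))"

(* The value does not depend on the parametrization (U, X) of M around p. *)
definition area_ratio ::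
    "'n::finite itself \<Rightarrow> (real^'m) set \<Rightarrow> (real^'m \<Rightarrow> real^'m) \<Rightarrow> real^'m \<Rightarrow> real" where
  "area_ratio _ M x p =
     (THE r. \<exists>U (X :: real^'n \<Rightarrow> real^'m) \<theta>. local_param M U X \<and> \<theta> \<in> U \<and> X \<theta> = p \<and>
        r = sqrt (det (induced_metric X \<theta>)) / sqrt (det (induced_metric (x \<circ> X) \<theta>)))"

definition hausdorff_content :: "nat \<Rightarrow> real \<Rightarrow> 'a::metric_space set \<Rightarrow> ennreal" where
  "hausdorff_content d \<delta> A =
     (INF C\<in>{C :: nat \<Rightarrow> 'a set. A \<subseteq> (\<Union>i. C i) \<and> (\<forall>i. bounded (C i) \<and> diameter (C i) \<le> \<delta>)}.
        \<Sum>i. if C i = {} then 0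
             else ennreal (unit_ball_vol (real d) * (diameter (C i) / 2) ^ d))"

definition hausdorff_outer :: "nat \<Rightarrow> 'a::metric_space set \<Rightarrow> ennreal" where
  "hausdorff_outer d A = (SUP \<delta>\<in>{0<..}. hausdorff_content d \<delta> A)"

(* hausdorff_outer is a metric outer measure, hence a measure on the Borel sets by
   Caratheodory's criterion, so measure_of does not fall back to the zero measure. *)
definition hausdorff :: "nat \<Rightarrow> 'a::metric_space measure" where
  "hausdorff d = measure_of UNIV (sets borel) (hausdorff_outer d)"

(* Any extension F that is differentiable at p gives the same value. *)
definition tan_grad ::
    "(real^'m) set \<Rightarrow> (real^'m \<Rightarrow> real^'m) \<Rightarrow> (real^'m \<Rightarrow> real) \<Rightarrow> real^'m \<Rightarrow> real^'m" where
  "tan_grad S \<nu> f p =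
     (THE d. \<exists>F. (\<forall>y\<in>S. F y = f y) \<and> F differentiable (at p) \<and>
        d = gradient F p - (\<nu> p \<bullet> gradient F p) *\<^sub>R \<nu> p)"

(* Entry (kappa, beta) is the beta-th tangential derivative of the kappa-th component. *)
definition tan_grad_matrix ::
    "(real^'m) set \<Rightarrow> (real^'m \<Rightarrow> real^'m) \<Rightarrow> (real^'m \<Rightarrow> real^'m) \<Rightarrow> real^'m \<Rightarrow> real^'m^'m" where
  "tan_grad_matrix S \<nu> f p = (\<chi> \<kappa>. tan_grad S \<nu> (\<lambda>y. f y $ \<kappa>) p)"

definition C1_surface :: "(real^'m) set \<Rightarrow> (real^'m \<Rightarrow> real^'m) \<Rightarrow> (real^'m \<Rightarrow> real) \<Rightarrow> bool" where
  "C1_surface S \<nu> f \<longleftrightarrow>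
     (\<forall>p\<in>S. \<exists>F. (\<forall>y\<in>S. F y = f y) \<and> F differentiable (at p)) \<and>
     continuous_on S (tan_grad S \<nu> f)"

definition mean_curvature :: "(real^'m) set \<Rightarrow> (real^'m \<Rightarrow> real^'m) \<Rightarrow> real^'m \<Rightarrow> real" where
  "mean_curvature S \<nu> p = (\<Sum>\<beta>\<in>UNIV. tan_grad S \<nu> (\<lambda>y. \<nu> y $ \<beta>) p $ \<beta>)"

(* Weak tangential gradients on a compact hypersurface without boundary of dimension d.  The
   curvature term comes from the divergence theorem on S: for f of class C^1 the integral of the
   beta-th tangential derivative of f equals the integral of f H nu_beta.  The product H nu is
   independent of the orientation. *)
definition has_weak_tan_grad ::
    "nat \<Rightarrow> (real^'m) set \<Rightarrow> (real^'m \<Rightarrow> real^'m) \<Rightarrow> (real^'m \<Rightarrow> real^'m) \<Rightarrow>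
     (real^'m \<Rightarrow> real^'m^'m) \<Rightarrow> bool" where
  "has_weak_tan_grad d S \<nu> f G \<longleftrightarrow>
     set_integrable (hausdorff d) S f \<and> set_integrable (hausdorff d) S G \<and>
     (\<forall>\<phi> \<kappa> \<beta>. C1_surface S \<nu> \<phi> \<longrightarrow>
        (LINT y:S|hausdorff d. f y $ \<kappa> * tan_grad S \<nu> \<phi> y $ \<beta>) =
        - (LINT y:S|hausdorff d. \<phi> y * G y $ \<kappa> $ \<beta>)
        + (LINT y:S|hausdorff d. f y $ \<kappa> * \<phi> y * mean_curvature S \<nu> y * \<nu> y $ \<beta>))"

(* Unique up to null sets whenever it exists. *)
definition weak_tan_grad ::
    "nat \<Rightarrow> (real^'m) set \<Rightarrow> (real^'m \<Rightarrow> real^'m) \<Rightarrow> (real^'m \<Rightarrow> real^'m) \<Rightarrow>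
     real^'m \<Rightarrow> real^'m^'m" where
  "weak_tan_grad d S \<nu> f = (SOME G. has_weak_tan_grad d S \<nu> f G)"

(* The vector-valued Sobolev space H^{1,2} on S, consisting of representatives. *)
definition sobolev_H12 ::
    "nat \<Rightarrow> (real^'m) set \<Rightarrow> (real^'m \<Rightarrow> real^'m) \<Rightarrow> (real^'m \<Rightarrow> real^'m) set" where
  "sobolev_H12 d S \<nu> =
     {f. set_integrable (hausdorff d) S (\<lambda>y. (norm (f y))\<^sup>2) \<and>
         (\<exists>G. has_weak_tan_grad d S \<nu> f G \<and>
              set_integrable (hausdorff d) S (\<lambda>y. (norm (G y))\<^sup>2))}"

definition frob :: "real^'m^'m \<Rightarrow> real^'m^'m \<Rightarrow> real" where
  "frob A B = (\<Sum>\<kappa>\<in>UNIV. \<Sum>\<beta>\<in>UNIV. A $ \<kappa> $ \<beta> * B $ \<kappa> $ \<beta>)"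

(* With A the matrix of a vector field u and B that of w, the derivative index is the second
   one: this is the sum of L_{gamma kappa} D_gamma u_beta D_kappa w_beta. *)
definition weighted_frob :: "real^'m^'m \<Rightarrow> real^'m^'m \<Rightarrow> real^'m^'m \<Rightarrow> real" where
  "weighted_frob L A B =
     (\<Sum>\<gamma>\<in>UNIV. \<Sum>\<kappa>\<in>UNIV. \<Sum>\<beta>\<in>UNIV. L $ \<gamma> $ \<kappa> * A $ \<beta> $ \<gamma> * B $ \<beta> $ \<kappa>)"

definition projection :: "(real^'m \<Rightarrow> real^'m) \<Rightarrow> real^'m \<Rightarrow> real^'m^'m" where
  "projection \<nu> y = mat 1 - \<nu> y \<otimes>\<^sub>v \<nu> y"

definition H_hat ::
    "(real^'m) set \<Rightarrow> (real^'m \<Rightarrow> real^'m) \<Rightarrow> (real^'m \<Rightarrow> real^'m) \<Rightarrow> real^'m \<Rightarrow> real^'m^'m" where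
  "H_hat M x \<nu> y =
     (let D = tan_grad_matrix (x ` M) \<nu> (inv_into M x) y
      in transpose D ** D + \<nu> y \<otimes>\<^sub>v \<nu> y)"

definition material_derivative ::
    "real set \<Rightarrow> (real^'m) set \<Rightarrow> (real \<Rightarrow> real^'m \<Rightarrow> real^'m) \<Rightarrow>
     (real \<Rightarrow> real^'m \<Rightarrow> real^'m) \<Rightarrow> real \<Rightarrow> real^'m \<Rightarrow> real^'m" where
  "material_derivative I M x f t y =
     vector_derivative (\<lambda>s. f s (x s (inv_into M (x t) y))) (at t within I)"

end

theory Submission
  imports Defs
begin

text \<open>
  The weak gradient carries the divergence theorem with it: testing with \<open>\<Phi>\<^sub>\<kappa>\<^sub>\<beta>\<close> and summing gives
  \<open>\<integral> \<Phi> : \<nabla>f = - \<integral> f \<bullet> div \<Phi>\<close> for every matrix field \<open>\<Phi>\<close> of class $C^1$ with \<open>\<Phi> \<nu> = 0\<close>, because the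
  curvature terms add up to \<open>f \<bullet> \<Phi> \<nu>\<close> times the mean curvature.  In a chart, a metric \<open>g\<close> with inverse
  \<open>q\<close>, the tangent vectors \<open>F\<^sub>i\<close> and the weight \<open>w = \<surd>det g / \<surd>det \<gamma>\<close> (\<open>\<gamma>\<close> the metric induced by \<open>F\<close>),
  Jacobi's formula turns \<open>div (w q\<^sup>i\<^sup>j F\<^sub>i \<otimes> F\<^sub>j)\<close> into \<open>w \<Delta>\<^sub>g F\<close>.  For \<open>g = \<gamma>\<close> the matrix field is the
  projection \<open>P\<close>; for \<open>g = h\<close> it is \<open>\<rho> P H\<^sup>-\<^sup>1\<close>, since the derivative of the inverse embedding
  gives \<open>F\<^sub>i \<bullet> H F\<^sub>j = h\<^sub>i\<^sub>j\<close> and \<open>H \<nu> = \<nu>\<close>, which also yields \<open>det H det \<gamma> = det h\<close>.  Hence the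
  right-hand side of the evolution equation equals \<open>div P + P div (\<rho> P H\<^sup>-\<^sup>1)\<close>.
\<close>

section \<open>Matrices\<close>

text \<open>The weight w is dictated by the divergence formula: in a chart, the divergence of a
  tangential field with components V^j is the divergence of sqrt(det gamma) V^j divided by sqrt(det
  gamma), whereas the Laplacian of g asks for sqrt(det g) in both places; the quotient exchanges the
  two densities. Regularity shapes the rest. Embeddings are C^2 and \<nu> is assumed continuous, so
  \<nu>, and with it P, has to be shown to be C^1 before its entries can serve as test functions for
  weak gradients. The velocity comes with no regularity in space: the integrability of the two terms
  containing it is read off the evolution equation, whose normal component is free of \<alpha> and
  \<rho>. A Sobolev function is known only through the integral identity of its weak gradient, so P
  \<eta> is placed in the space by moving the factor P onto the test function.\<close>

lemma matrix_inv_right_left: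
  fixes A :: "real^'n^'n"
  assumes "det A \<noteq> 0"
  shows "A ** matrix_inv A = mat 1" "matrix_inv A ** A = mat 1"
proof -
  from assms obtain A' where "A ** A' = mat 1 \<and> A' ** A = mat 1"
    by (auto simp: invertible_det_nz[symmetric] invertible_def)
  then have "A ** matrix_inv A = mat 1 \<and> matrix_inv A ** A = mat 1"
    unfolding matrix_inv_def by (rule someI)
  then show "A ** matrix_inv A = mat 1" "matrix_inv A ** A = mat 1" by auto
qed

lemma matrix_inv_unique:
  fixes A B :: "real^'n^'n"
  assumes "B ** A = mat 1"
  shows "matrix_inv A = B"
proof -
  have "det B * det A = 1" using assms by (metis det_I det_mul)
  then have d: "det A \<noteq> 0" by auto
  have "matrix_inv A = (B ** A) ** matrix_inv A" using assms by simp
  then show "matrix_inv A = B" by (simp add: matrix_mul_assoc[symmetric] matrix_inv_right_left(1)[OF d])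
qed

lemma sum_matrix_inv:
  fixes A :: "real^'n^'n"
  assumes "det A \<noteq> 0"
  shows "(\<Sum>k\<in>UNIV. A $ i $ k * matrix_inv A $ k $ j) = (if i = j then 1 else 0)"
    and "(\<Sum>k\<in>UNIV. matrix_inv A $ i $ k * A $ k $ j) = (if i = j then 1 else 0)"
proof -
  show "(\<Sum>k\<in>UNIV. A $ i $ k * matrix_inv A $ k $ j) = (if i = j then 1 else 0)"
    using arg_cong[OF matrix_inv_right_left(1)[OF assms], of "\<lambda>B. B $ i $ j"]
    by (simp add: matrix_matrix_mult_def mat_def)
  show "(\<Sum>k\<in>UNIV. matrix_inv A $ i $ k * A $ k $ j) = (if i = j then 1 else 0)"
    using arg_cong[OF matrix_inv_right_left(2)[OF assms], of "\<lambda>B. B $ i $ j"]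
    by (simp add: matrix_matrix_mult_def mat_def)
qed

lemma matrix_inv_transpose:
  fixes A :: "real^'n^'n"
  assumes "det A \<noteq> 0"
  shows "matrix_inv (transpose A) = transpose (matrix_inv A)"
proof (rule matrix_inv_unique)
  show "transpose (matrix_inv A) ** transpose A = mat 1"
    by (metis assms matrix_inv_right_left(1) matrix_transpose_mul transpose_mat)
qed

lemma matrix_inv_symmetric:
  fixes A :: "real^'n^'n"
  assumes "det A \<noteq> 0" and "\<And>i j. A $ i $ j = A $ j $ i"
  shows "matrix_inv A $ i $ j = matrix_inv A $ j $ i"
proof -
  have "transpose A = A" using assms(2) by (simp add: transpose_def vec_eq_iff)
  then have "matrix_inv A $ i $ j = transpose (matrix_inv A) $ i $ j"
    using matrix_inv_transpose[OF assms(1)] by simp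
  then show ?thesis by (simp add: transpose_def)
qed

text \<open>Cramer's rule for a column of the inverse. Each entry becomes a quotient of determinants
  in the entries of \<open>A\<close>; differentiability and class C^1 of inverse metrics come from
  here.\<close>

lemma matrix_inv_entry:
  fixes A :: "real^'n^'n"
  assumes "det A \<noteq> 0"
  shows "matrix_inv A $ i $ j =
    det (\<chi> a b. if b = i then mat 1 $ a $ j else A $ a $ b) / det A"
proof -
  have "A *v column j (matrix_inv A) = column j (A ** matrix_inv A)"
    by (simp add: column_def matrix_matrix_mult_def matrix_vector_mult_def)
  also have "\<dots> = column j (mat 1)" using assms by (simp add: matrix_inv_right_left)
  finally have "column j (matrix_inv A) =
      (\<chi> k. det (\<chi> a b. if b = k then column j (mat 1) $ a else A $ a $ b) / det A)"
    using cramer[OF assms] by blast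
  from arg_cong[OF this, of "\<lambda>v. v $ i"] show ?thesis
    by (simp add: column_def cong: if_cong)
qed

text \<open>On the segment from the identity to \<open>A\<close> every matrix has a positive
  quadratic form, hence a trivial kernel, so the determinant cannot change the sign it has at the
  identity.\<close>

lemma pos_def_det_pos:
  fixes A :: "real^'n^'n"
  assumes pos: "\<And>v. v \<noteq> 0 \<Longrightarrow> 0 < v \<bullet> (A *v v)"
  shows "0 < det A"
proof (rule ccontr)
  assume neg: "\<not> 0 < det A"
  define B where "B s = (\<chi> i j. (1 - s) * mat 1 $ i $ j + s * A $ i $ j)" for s :: real
  have B: "B s *v v = (1 - s) *\<^sub>R v + s *\<^sub>R (A *v v)" for s v
  proof -
    have "B s = (1 - s) *\<^sub>R mat 1 + s *\<^sub>R A" by (simp add: vec_eq_iff B_def)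
    then show ?thesis
      by (simp add: matrix_vector_mult_add_rdistrib scaleR_matrix_vector_assoc[symmetric])
  qed
  have "continuous_on {0..1} (\<lambda>s. det (B s))"
    unfolding det_def B_def by (simp, intro continuous_intros)
  moreover have "det (B 0) = 1" "det (B 1) = det A"
    by (simp_all add: B_def vec_lambda_eta)
  ultimately obtain s where s: "0 \<le> s" "s \<le> 1" "det (B s) = 0"
    using IVT2'[of "\<lambda>s. det (B s)" 1 0 0] neg by force
  then have "\<not> (\<exists>B'. B' ** B s = mat 1)"
    by (metis det_I det_mul mult_zero_right zero_neq_one)
  then obtain v where v: "B s *v v = 0" "v \<noteq> 0"
    unfolding matrix_left_invertible_ker by blast
  have "0 = v \<bullet> (B s *v v)" using v by simp
  also have "\<dots> = (1 - s) * (v \<bullet> v) + s * (v \<bullet> (A *v v))" by (simp add: B inner_add_right)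
  also have "\<dots> > 0"
  proof (cases "s = 1")
    case False
    then have "0 < (1 - s) * (v \<bullet> v)" using s v by simp
    moreover have "0 \<le> s * (v \<bullet> (A *v v))" using s pos[OF v(2)] by simp
    ultimately show ?thesis by linarith
  qed (use pos[OF v(2)] in simp)
  finally show False by simp
qed

text \<open>In the Leibniz sum a permutation that moves \<open>k\<close> meets a zero of row
  \<open>k\<close>. The others are the conjugates under \<open>f\<close> of the permutations of the
  smaller index type, with equal signs. The map \<open>f\<close> mediates between the tangential and
  the ambient index type, which are unrelated as types.\<close>

lemma det_unit_block:
  fixes A :: "real^'m^'m" and f :: "'n::finite \<Rightarrow> 'm"
  assumes f: "inj f" "range f = UNIV - {k}"
    and row: "\<And>j. A $ k $ j = (if j = k then 1 else 0)"
    and col: "\<And>i. A $ i $ k = (if i = k then 1 else 0)"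
  shows "det A = det (\<chi> i j. A $ f i $ f j)"
proof -
  have bij: "bij_betw f UNIV (UNIV - {k})" using f by (simp add: bij_betw_def)
  have UN: "UNIV = insert k (range f)" using f by auto
  have kn: "k \<notin> range f" using f by auto
  have zero: "(\<Prod>i\<in>UNIV. A $ i $ p i) = 0" if "p permutes UNIV" "\<not> p permutes (UNIV - {k})" for p
  proof -
    have "p k \<noteq> k"
      using that permutes_superset[of p UNIV "UNIV - {k}"] by auto
    then show ?thesis using row by (intro prod_zero bexI[of _ k]) auto
  qed
  have "det A = (\<Sum>p | p permutes UNIV. of_int (sign p) * (\<Prod>i\<in>UNIV. A $ i $ p i))"
    by (simp add: det_def)
  also have "\<dots> = (\<Sum>p | p permutes (UNIV - {k}). of_int (sign p) * (\<Prod>i\<in>UNIV. A $ i $ p i))"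
    by (rule sum.mono_neutral_right) (auto simp: zero finite_permutations intro: permutes_subset)
  also have "\<dots> = (\<Sum>q | q permutes (UNIV::'n set). of_int (sign q) * (\<Prod>i\<in>UNIV. A $ f i $ f (q i)))"
  proof (rule sum.reindex_bij_witness[where
        i = "map_permutation UNIV f" and j = "map_permutation (UNIV - {k}) (inv f)"])
    have iv: "bij_betw (inv f) (UNIV - {k}) UNIV" using bij_betw_inv_into[OF bij] .
    fix p assume "p \<in> {p. p permutes (UNIV - {k})}"
    then have p: "p permutes (UNIV - {k})" by simp
    show "map_permutation (UNIV - {k}) (inv f) p \<in> {q. q permutes UNIV}"
      using map_permutation_permutes[OF iv p] by simp
    show bck: "map_permutation UNIV f (map_permutation (UNIV - {k}) (inv f) p) = p"
      using map_permutation_compose_inv[OF iv p, of f] f by (simp add: f_inv_into_f)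
    let ?q = "map_permutation (UNIV - {k}) (inv f) p"
    have "?q permutes UNIV" using map_permutation_permutes[OF iv p] .
    have s: "sign ?q = sign p"
      using iv p by (intro sign_map_permutation) (auto simp: bij_betw_def)
    have q: "f (?q i) = p (f i)" for i
      by (metis bck f(1) map_permutation_apply UNIV_I)
    have "(\<Prod>i\<in>UNIV. A $ i $ p i) = (\<Prod>i\<in>range f. A $ i $ p i)"
      unfolding UN using kn p row by (subst prod.insert) (auto simp: permutes_not_in)
    also have "\<dots> = (\<Prod>i\<in>UNIV. A $ f i $ f (?q i))"
      using f by (subst prod.reindex) (auto simp: q)
    finally show "of_int (sign ?q) * (\<Prod>i\<in>UNIV. A $ f i $ f (?q i)) =
        of_int (sign p) * (\<Prod>i\<in>UNIV. A $ i $ p i)" by (simp add: s)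
  next
    fix q assume "q \<in> {q. q permutes (UNIV::'n set)}"
    then have q: "q permutes (UNIV::'n set)" by simp
    show "map_permutation UNIV f q \<in> {p. p permutes (UNIV - {k})}"
      using map_permutation_permutes[OF bij q] by simp
    show "map_permutation (UNIV - {k}) (inv f) (map_permutation UNIV f q) = q"
      using map_permutation_compose_inv[OF bij q, of "inv f"] f by simp
  qed
  finally show ?thesis by (simp add: det_def)
qed

section \<open>Derivatives of determinants and inverse matrices\<close>

lemma has_derivative_det_I:
  fixes A :: "'a::real_normed_vector \<Rightarrow> real^'n^'n"
  assumes A: "\<And>i j. ((\<lambda>\<xi>. A \<xi> $ i $ j) has_derivative D i j) (at \<theta>)"
    and I: "A \<theta> = mat 1"
  shows "((\<lambda>\<xi>. det (A \<xi>)) has_derivative (\<lambda>v. \<Sum>i\<in>UNIV. D i i v)) (at \<theta>)"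
proof -
  \<comment> \<open>Only \<open>id\<close> survives at the identity matrix: any other permutation
    moves at least two indices, so an off-diagonal zero remains after one factor has been
    differentiated. What is left is the trace.\<close>
  have *: "of_int (sign p) * (\<Sum>i\<in>UNIV. D i (p i) v * (\<Prod>j\<in>UNIV - {i}. A \<theta> $ j $ p j)) =
      (if p = id then \<Sum>i\<in>UNIV. D i i v else 0)" if "p permutes UNIV" for p v
  proof (cases "p = id")
    case False
    have *: "(\<Prod>j\<in>UNIV - {i}. A \<theta> $ j $ p j) = 0" for i
    proof (rule ccontr)
      assume "(\<Prod>j\<in>UNIV - {i}. A \<theta> $ j $ p j) \<noteq> 0"
      then have "\<forall>j\<in>UNIV - {i}. p j = j" by (auto simp: I mat_def split: if_splits)
      moreover from this have "p i = i"
        using permutes_inj[OF that] by (metis DiffI UNIV_I injD singletonD)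
      ultimately show False using False by (auto simp: fun_eq_iff)
    qed
    show ?thesis unfolding * using False by simp
  qed (simp add: I mat_def)
  have "((\<lambda>\<xi>. \<Sum>p | p permutes UNIV. of_int (sign p) * (\<Prod>i\<in>UNIV. A \<xi> $ i $ p i)) has_derivative
      (\<lambda>v. \<Sum>p | p permutes UNIV. of_int (sign p) *
        (\<Sum>i\<in>UNIV. D i (p i) v * (\<Prod>j\<in>UNIV - {i}. A \<theta> $ j $ p j)))) (at \<theta>)"
    by (intro has_derivative_sum has_derivative_mult_right has_derivative_prod A)
  also have "(\<lambda>v. \<Sum>p | p permutes UNIV. of_int (sign p) *
        (\<Sum>i\<in>UNIV. D i (p i) v * (\<Prod>j\<in>UNIV - {i}. A \<theta> $ j $ p j))) =
      (\<lambda>v. \<Sum>p | p permutes (UNIV::'n set). if p = id then \<Sum>i\<in>UNIV. D i i v else 0)"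
    by (intro ext sum.cong refl *) auto
  finally show ?thesis by (simp add: det_def permutes_id finite_permutations)
qed

text \<open>Jacobi's formula. Factoring out the matrix at \<theta> leaves a family passing through
  the identity, where the derivative of the determinant is the trace.\<close>

lemma has_derivative_det:
  fixes A :: "'a::real_normed_vector \<Rightarrow> real^'n^'n"
  assumes A: "\<And>i j. ((\<lambda>\<xi>. A \<xi> $ i $ j) has_derivative D i j) (at \<theta>)"
    and nz: "det (A \<theta>) \<noteq> 0"
  shows "((\<lambda>\<xi>. det (A \<xi>)) has_derivative
    (\<lambda>v. det (A \<theta>) * (\<Sum>i\<in>UNIV. \<Sum>j\<in>UNIV. matrix_inv (A \<theta>) $ i $ j * D j i v))) (at \<theta>)"
proof -
  let ?B = "matrix_inv (A \<theta>)"
  have "det ?B * det (A \<theta>) = 1" using matrix_inv_right_left(2)[OF nz] by (metis det_I det_mul)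
  then have eq: "det (A \<xi>) = det (A \<theta>) * det (?B ** A \<xi>)" for \<xi>
    by (simp add: det_mul mult.assoc[symmetric]) (simp add: mult.commute)
  have "((\<lambda>\<xi>. det (?B ** A \<xi>)) has_derivative
      (\<lambda>v. \<Sum>i\<in>UNIV. \<Sum>j\<in>UNIV. ?B $ i $ j * D j i v)) (at \<theta>)"
  proof (rule has_derivative_det_I[where D = "\<lambda>i k v. \<Sum>j\<in>UNIV. ?B $ i $ j * D j k v"])
    show "((\<lambda>\<xi>. (?B ** A \<xi>) $ i $ k) has_derivative (\<lambda>v. \<Sum>j\<in>UNIV. ?B $ i $ j * D j k v)) (at \<theta>)" for i k
      unfolding matrix_matrix_mult_def
      by (simp, intro has_derivative_sum has_derivative_mult_right A)
  qed (simp add: matrix_inv_right_left nz)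
  from has_derivative_mult_right[OF this, of "det (A \<theta>)"] show ?thesis
    by (simp only: eq[symmetric])
qed

text \<open>\<open>matrix_inv\<close> obeys the inverse identities only where the determinant does
  not vanish; formulas for its entries are therefore transferred along the filter at
  \<theta>.\<close>

lemma eventually_det_nz:
  fixes A :: "'a::real_normed_vector \<Rightarrow> real^'n^'n"
  assumes A: "\<And>i j. ((\<lambda>\<xi>. A \<xi> $ i $ j) has_derivative D i j) (at \<theta>)"
    and nz: "det (A \<theta>) \<noteq> 0"
  shows "\<forall>\<^sub>F \<xi> in at \<theta>. det (A \<xi>) \<noteq> 0"
  using has_derivative_continuous[OF has_derivative_det[OF assms]] nz
  by (auto simp: continuous_within intro: tendsto_imp_eventually_ne)

lemma differentiable_det:
  fixes A :: "'a::real_normed_vector \<Rightarrow> real^'n^'n"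
  assumes "\<And>i j. (\<lambda>\<xi>. A \<xi> $ i $ j) differentiable (at \<theta>)"
  shows "(\<lambda>\<xi>. det (A \<xi>)) differentiable (at \<theta>)"
proof -
  obtain D where D: "((\<lambda>\<xi>. A \<xi> $ i $ j) has_derivative D i j) (at \<theta>)" for i j
    using assms unfolding differentiable_def by metis
  have "((\<lambda>\<xi>. \<Sum>p | p permutes UNIV. of_int (sign p) * (\<Prod>i\<in>UNIV. A \<xi> $ i $ p i)) has_derivative
      (\<lambda>v. \<Sum>p | p permutes UNIV. of_int (sign p) *
        (\<Sum>i\<in>UNIV. D i (p i) v * (\<Prod>j\<in>UNIV - {i}. A \<theta> $ j $ p j)))) (at \<theta>)"
    by (intro has_derivative_sum has_derivative_mult_right has_derivative_prod D)
  then show ?thesis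
    unfolding det_def differentiable_def by blast
qed

text \<open>Cramer's quotient yields differentiability; the formula then follows by differentiating
  the constant product of \<open>A\<close> with its inverse and multiplying by the inverse from the
  left.\<close>

lemma has_derivative_matrix_inv:
  fixes A :: "'a::real_normed_vector \<Rightarrow> real^'n^'n"
  assumes A: "\<And>i j. ((\<lambda>\<xi>. A \<xi> $ i $ j) has_derivative D i j) (at \<theta>)"
    and nz: "det (A \<theta>) \<noteq> 0"
  shows "((\<lambda>\<xi>. matrix_inv (A \<xi>) $ i $ j) has_derivative
    (\<lambda>v. - (\<Sum>a\<in>UNIV. \<Sum>b\<in>UNIV. matrix_inv (A \<theta>) $ i $ a * D a b v * matrix_inv (A \<theta>) $ b $ j))) (at \<theta>)"
proof -
  let ?B = "\<lambda>\<xi>. matrix_inv (A \<xi>)"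
  have Adiff: "(\<lambda>\<xi>. A \<xi> $ i $ j) differentiable (at \<theta>)" for i j
    using A differentiable_def by blast
  have diff: "(\<lambda>\<xi>. ?B \<xi> $ i $ j) differentiable (at \<theta>)" for i j
  proof -
    let ?N = "\<lambda>\<xi>. det (\<chi> a b. if b = i then mat 1 $ a $ j else A \<xi> $ a $ b)"
    have "(\<lambda>\<xi>. if b then c else A \<xi> $ k $ l) differentiable (at \<theta>)" for b c k l
      using Adiff by (cases b) auto
    then have "?N differentiable (at \<theta>)"
      by (intro differentiable_det) simp
    moreover have "(\<lambda>\<xi>. det (A \<xi>)) differentiable (at \<theta>)"
      using has_derivative_det[OF assms] differentiable_def by blast
    ultimately obtain E where "((\<lambda>\<xi>. ?N \<xi> / det (A \<xi>)) has_derivative E) (at \<theta>)"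
      using nz differentiable_divide differentiable_def by blast
    then have "((\<lambda>\<xi>. ?B \<xi> $ i $ j) has_derivative E) (at \<theta>)"
      by (rule has_derivative_transform_eventually)
        (use eventually_det_nz[OF assms] nz in \<open>auto elim!: eventually_mono simp: matrix_inv_entry\<close>)
    then show ?thesis unfolding differentiable_def by blast
  qed
  then obtain E where E: "((\<lambda>\<xi>. ?B \<xi> $ i $ j) has_derivative E i j) (at \<theta>)" for i j
    unfolding differentiable_def by metis
  have *: "(\<Sum>b\<in>UNIV. A \<theta> $ a $ b * E b j v) = - (\<Sum>b\<in>UNIV. D a b v * ?B \<theta> $ b $ j)" for a v
  proof -
    have "((\<lambda>\<xi>. \<Sum>b\<in>UNIV. A \<xi> $ a $ b * ?B \<xi> $ b $ j) has_derivative
      (\<lambda>v. \<Sum>b\<in>UNIV. A \<theta> $ a $ b * E b j v + D a b v * ?B \<theta> $ b $ j)) (at \<theta>)"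
      by (intro has_derivative_sum has_derivative_mult A E)
    moreover have "((\<lambda>\<xi>. \<Sum>b\<in>UNIV. A \<xi> $ a $ b * ?B \<xi> $ b $ j) has_derivative (\<lambda>v. 0)) (at \<theta>)"
      by (rule has_derivative_transform_eventually[OF has_derivative_const[where c = "if a = j then 1 else 0"]])
        (use eventually_det_nz[OF assms] nz in \<open>auto elim!: eventually_mono simp: sum_matrix_inv\<close>)
    ultimately have "(\<lambda>v. \<Sum>b\<in>UNIV. A \<theta> $ a $ b * E b j v + D a b v * ?B \<theta> $ b $ j) = (\<lambda>v. 0)"
      by (rule has_derivative_unique)
    from fun_cong[OF this, of v] show ?thesis by (simp add: sum.distrib)
  qed
  have "E i j v = - (\<Sum>a\<in>UNIV. \<Sum>b\<in>UNIV. ?B \<theta> $ i $ a * D a b v * ?B \<theta> $ b $ j)" for v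
  proof -
    have "E i j v = (\<Sum>b\<in>UNIV. (\<Sum>a\<in>UNIV. ?B \<theta> $ i $ a * A \<theta> $ a $ b) * E b j v)"
      by (simp add: sum_matrix_inv nz if_distrib[of "\<lambda>c. c * _"] cong: if_cong)
    also have "\<dots> = (\<Sum>a\<in>UNIV. ?B \<theta> $ i $ a * (\<Sum>b\<in>UNIV. A \<theta> $ a $ b * E b j v))"
      unfolding sum_distrib_left sum_distrib_right by (subst sum.swap) (simp add: mult.assoc)
    finally show ?thesis by (simp add: * sum_negf sum_distrib_left mult.assoc)
  qed
  then show ?thesis using E[of i j] by (metis (no_types, lifting) ext)
qed

section \<open>Calculus of coordinate functions\<close>

lemma pd_eq:
  assumes "(f has_derivative f') (at \<theta>)"
  shows "pd i f \<theta> = f' (axis i 1)"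
  using frechet_derivative_at[OF assms] by (simp add: pd_def)

section \<open>Functions of class C^1 on an open set\<close>

definition C1_on :: "(real^'n) set \<Rightarrow> (real^'n \<Rightarrow> 'b::real_normed_vector) \<Rightarrow> bool" where
  "C1_on U f \<longleftrightarrow> Ck_on 1 U f"

lemma C1_on_iff: "C1_on U f \<longleftrightarrow> f differentiable_on U \<and> (\<forall>i. continuous_on U (pd i f))"
  by (simp add: C1_on_def)

lemma Ck_on_2_iff: "Ck_on 2 U f \<longleftrightarrow> f differentiable_on U \<and> (\<forall>i. C1_on U (pd i f))"
  by (simp add: numeral_2_eq_2 C1_on_def)

text \<open>\<open>pd\<close> is read off the Frechet derivative, so it suffices to exhibit a
  derivative whose values on the axis vectors are continuous. The basic closure rules for C^1
  functions are obtained in this way.\<close>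

lemma C1I:
  assumes "\<And>\<theta>. \<theta> \<in> U \<Longrightarrow> (f has_derivative f' \<theta>) (at \<theta>)"
    and "\<And>i. continuous_on U (\<lambda>\<theta>. f' \<theta> (axis i 1))"
  shows "C1_on U f"
  unfolding C1_on_iff
proof (intro conjI allI)
  show "f differentiable_on U"
    using assms(1) by (auto simp: differentiable_on_def differentiable_def intro: has_derivative_at_withinI)
  show "continuous_on U (pd i f)" for i
    using assms(2)[of i] by (rule continuous_on_eq) (use assms(1) pd_eq in metis)
qed

lemma C1_has_derivative:
  assumes "C1_on U f" "open U" "\<theta> \<in> U"
  shows "(f has_derivative frechet_derivative f (at \<theta>)) (at \<theta>)"
  using assms by (auto simp: C1_on_iff differentiable_on_eq_differentiable_at frechet_derivative_works[symmetric])

lemma frechet_derivative_pd: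
  fixes f :: "real^'n \<Rightarrow> 'b::real_normed_vector"
  assumes "f differentiable (at \<theta>)"
  shows "frechet_derivative f (at \<theta>) v = (\<Sum>i\<in>UNIV. v $ i *\<^sub>R pd i f \<theta>)"
proof -
  have lin: "linear (frechet_derivative f (at \<theta>))" using assms by (rule linear_frechet_derivative)
  have "frechet_derivative f (at \<theta>) v = frechet_derivative f (at \<theta>) (\<Sum>i\<in>UNIV. v $ i *\<^sub>R axis i 1)"
    by (metis basis_expansion scalar_mult_eq_scaleR)
  then show ?thesis by (simp add: linear_sum[OF lin] linear_scale[OF lin] pd_def)
qed

lemma C1_continuous_pd: "C1_on U f \<Longrightarrow> continuous_on U (pd i f)"
  by (simp add: C1_on_iff)

lemma C1_continuous: "C1_on U f \<Longrightarrow> continuous_on U f"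
  by (simp add: C1_on_iff differentiable_imp_continuous_on)

lemma C1_continuous_frechet:
  assumes "C1_on U f" "open U"
  shows "continuous_on U (\<lambda>\<theta>. frechet_derivative f (at \<theta>) (axis i 1))"
  using C1_continuous_pd[OF assms(1), of i] by (simp add: pd_def[abs_def])

lemma C1_const: "C1_on U (\<lambda>\<theta>. c)"
  by (rule C1I[where f' = "\<lambda>\<theta> v. 0"]) auto

lemma C1_mult:
  fixes f g :: "real^'n \<Rightarrow> real"
  assumes "open U" "C1_on U f" "C1_on U g"
  shows "C1_on U (\<lambda>\<theta>. f \<theta> * g \<theta>)"
proof (rule C1I)
  show "((\<lambda>\<theta>. f \<theta> * g \<theta>) has_derivative
      (\<lambda>v. f \<theta> * frechet_derivative g (at \<theta>) v + frechet_derivative f (at \<theta>) v * g \<theta>)) (at \<theta>)"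
    if "\<theta> \<in> U" for \<theta>
    by (intro has_derivative_mult C1_has_derivative[OF _ assms(1) that] assms)
  show "continuous_on U (\<lambda>\<theta>. f \<theta> * frechet_derivative g (at \<theta>) (axis i 1)
      + frechet_derivative f (at \<theta>) (axis i 1) * g \<theta>)" for i
    by (intro continuous_intros C1_continuous C1_continuous_frechet assms)
qed

lemma C1_add:
  assumes "open U" "C1_on U f" "C1_on U g"
  shows "C1_on U (\<lambda>\<theta>. f \<theta> + g \<theta>)"
proof (rule C1I)
  show "((\<lambda>\<theta>. f \<theta> + g \<theta>) has_derivative
      (\<lambda>v. frechet_derivative f (at \<theta>) v + frechet_derivative g (at \<theta>) v)) (at \<theta>)"
    if "\<theta> \<in> U" for \<theta>
    by (intro has_derivative_add C1_has_derivative[OF _ assms(1) that] assms)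
  show "continuous_on U (\<lambda>\<theta>. frechet_derivative f (at \<theta>) (axis i 1)
      + frechet_derivative g (at \<theta>) (axis i 1))" for i
    by (intro continuous_intros C1_continuous_frechet assms)
qed

lemma C1_sum:
  assumes "open U" "\<And>i. i \<in> A \<Longrightarrow> C1_on U (f i)"
  shows "C1_on U (\<lambda>\<theta>. \<Sum>i\<in>A. f i \<theta>)"
  using assms(2) by (induction A rule: infinite_finite_induct) (auto intro!: C1_const C1_add assms(1))

lemma C1_prod:
  fixes f :: "'i \<Rightarrow> real^'n \<Rightarrow> real"
  assumes "open U" "\<And>i. i \<in> A \<Longrightarrow> C1_on U (f i)"
  shows "C1_on U (\<lambda>\<theta>. \<Prod>i\<in>A. f i \<theta>)"
  using assms(2) by (induction A rule: infinite_finite_induct) (auto intro!: C1_const C1_mult assms(1))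

lemma C1_bounded_linear:
  assumes "bounded_linear L" "open U" "C1_on U f"
  shows "C1_on U (\<lambda>\<theta>. L (f \<theta>))"
proof (rule C1I)
  show "((\<lambda>\<theta>. L (f \<theta>)) has_derivative (\<lambda>v. L (frechet_derivative f (at \<theta>) v))) (at \<theta>)"
    if "\<theta> \<in> U" for \<theta>
    by (intro bounded_linear.has_derivative[OF assms(1)] C1_has_derivative[OF _ assms(2) that] assms)
  show "continuous_on U (\<lambda>\<theta>. L (frechet_derivative f (at \<theta>) (axis i 1)))" for i
    by (intro bounded_linear.continuous_on[OF assms(1)] C1_continuous_frechet assms)
qed

lemma C1_minus:
  assumes "open U" "C1_on U f" "C1_on U g"
  shows "C1_on U (\<lambda>\<theta>. f \<theta> - g \<theta>)"
  using C1_add[OF assms(1,2) C1_bounded_linear[OF bounded_linear_minus[OF bounded_linear_ident] assms(1,3)]]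
  by simp

lemma C1_vec_nth: "open U \<Longrightarrow> C1_on U f \<Longrightarrow> C1_on U (\<lambda>\<theta>. f \<theta> $ k)"
  by (rule C1_bounded_linear[OF bounded_linear_vec_nth])

lemma C1_inner:
  fixes f g :: "real^'n \<Rightarrow> real^'m"
  assumes "open U" "C1_on U f" "C1_on U g"
  shows "C1_on U (\<lambda>\<theta>. f \<theta> \<bullet> g \<theta>)"
  unfolding inner_vec_def inner_real_def by (intro C1_sum C1_mult C1_vec_nth assms)

lemma C1_DERIV_compose:
  fixes f :: "real^'n \<Rightarrow> real"
  assumes "open U" "C1_on U f"
    and "\<And>\<theta>. \<theta> \<in> U \<Longrightarrow> (h has_field_derivative h' (f \<theta>)) (at (f \<theta>))"
    and "continuous_on (f ` U) h'"
  shows "C1_on U (\<lambda>\<theta>. h (f \<theta>))"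
proof (rule C1I)
  show "((\<lambda>\<theta>. h (f \<theta>)) has_derivative (\<lambda>v. h' (f \<theta>) * frechet_derivative f (at \<theta>) v)) (at \<theta>)" if "\<theta> \<in> U" for \<theta>
    using has_derivative_compose[OF C1_has_derivative[OF assms(2,1) that] assms(3)[OF that, unfolded has_field_derivative_def]] .
  show "continuous_on U (\<lambda>\<theta>. h' (f \<theta>) * frechet_derivative f (at \<theta>) (axis i 1))" for i
    by (intro continuous_intros C1_continuous_frechet assms continuous_on_compose2[OF assms(4)] C1_continuous) auto
qed

lemma C1_inverse:
  fixes f :: "real^'n \<Rightarrow> real"
  assumes "open U" "C1_on U f" "\<And>\<theta>. \<theta> \<in> U \<Longrightarrow> f \<theta> \<noteq> 0"
  shows "C1_on U (\<lambda>\<theta>. inverse (f \<theta>))"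
  by (rule C1_DERIV_compose[OF assms(1,2), where h' = "\<lambda>y. - (inverse y ^ Suc (Suc 0))"])
    (use assms in \<open>auto intro!: continuous_intros DERIV_inverse simp del: power_Suc\<close>)

lemma C1_divide:
  fixes f :: "real^'n \<Rightarrow> real"
  assumes "open U" "C1_on U f" "C1_on U g" "\<And>\<theta>. \<theta> \<in> U \<Longrightarrow> g \<theta> \<noteq> 0"
  shows "C1_on U (\<lambda>\<theta>. f \<theta> / g \<theta>)"
  unfolding divide_inverse by (intro C1_mult C1_inverse assms)

lemma C1_sqrt:
  fixes f :: "real^'n \<Rightarrow> real"
  assumes "open U" "C1_on U f" "\<And>\<theta>. \<theta> \<in> U \<Longrightarrow> 0 < f \<theta>"
  shows "C1_on U (\<lambda>\<theta>. sqrt (f \<theta>))"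
proof (rule C1_DERIV_compose[OF assms(1,2), where h' = "\<lambda>y. inverse (sqrt y) / 2"])
  show "continuous_on (f ` U) (\<lambda>y. inverse (sqrt y) / 2)"
    by (intro continuous_intros) (auto dest: assms(3))
qed (use assms in \<open>auto intro!: DERIV_real_sqrt\<close>)

lemma C1_det:
  fixes A :: "real^'n \<Rightarrow> real^'k^'k"
  assumes "open U" "\<And>i j. C1_on U (\<lambda>\<theta>. A \<theta> $ i $ j)"
  shows "C1_on U (\<lambda>\<theta>. det (A \<theta>))"
  unfolding det_def by (intro C1_sum C1_mult C1_prod C1_const assms)

lemma C1_cong:
  assumes "open U" "C1_on U f" "\<And>\<theta>. \<theta> \<in> U \<Longrightarrow> f \<theta> = g \<theta>"
  shows "C1_on U g"
  by (rule C1I[OF has_derivative_transform_within_open[OF C1_has_derivative[OF assms(2,1)] assms(1)]])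
    (use assms in \<open>auto intro!: C1_continuous_frechet\<close>)

lemma C1_matrix_inv:
  fixes A :: "real^'n \<Rightarrow> real^'k^'k"
  assumes U: "open U" and A: "\<And>i j. C1_on U (\<lambda>\<theta>. A \<theta> $ i $ j)"
    and nz: "\<And>\<theta>. \<theta> \<in> U \<Longrightarrow> det (A \<theta>) \<noteq> 0"
  shows "C1_on U (\<lambda>\<theta>. matrix_inv (A \<theta>) $ i $ j)"
proof (rule C1_cong[OF U])
  have "C1_on U (\<lambda>\<theta>. if b then c else A \<theta> $ k $ l)" for b c k l
    by (cases b) (simp_all add: A C1_const)
  then show "C1_on U (\<lambda>\<theta>. det (\<chi> a b. if b = i then mat 1 $ a $ j else A \<theta> $ a $ b) / det (A \<theta>))"
    by (intro C1_divide U C1_det A nz) (simp)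
qed (simp add: matrix_inv_entry nz)

text \<open>Serves the unit normal, for which an explicit C^1 formula is available only in a
  neighbourhood of each point.\<close>

lemma C1_local:
  assumes "\<And>\<theta>. \<theta> \<in> U \<Longrightarrow> \<exists>V. open V \<and> \<theta> \<in> V \<and> V \<subseteq> U \<and> C1_on V f"
  shows "C1_on U f"
  unfolding C1_on_iff
proof (intro conjI allI)
  have "\<exists>V. open V \<and> \<theta> \<in> V \<and> f differentiable (at \<theta>) \<and> (\<forall>i. continuous_on V (pd i f))" if "\<theta> \<in> U" for \<theta>
    using assms[OF that] unfolding C1_on_iff
    by (metis differentiable_on_eq_differentiable_at)
  then show "f differentiable_on U"
    by (meson differentiable_at_imp_differentiable_on)
  show "continuous_on U (pd i f)" for i
    using assms unfolding C1_on_iff continuous_on_eq_continuous_within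
    by (metis assms at_within_open continuous_at_imp_continuous_at_within C1_continuous_pd continuous_on_eq_continuous_at)
qed

section \<open>Second derivatives and their symmetry\<close>

lemma differentiable_vec_nth:
  "f differentiable (at \<theta>) \<Longrightarrow> (\<lambda>\<xi>. f \<xi> $ k) differentiable (at \<theta>)"
  unfolding differentiable_def using bounded_linear.has_derivative[OF bounded_linear_vec_nth] by blast

lemma pd_vec_nth:
  assumes "f differentiable (at \<theta>)"
  shows "pd i (\<lambda>\<xi>. f \<xi> $ k) \<theta> = pd i f \<theta> $ k"
  using pd_eq[OF bounded_linear.has_derivative[OF bounded_linear_vec_nth]] assms
  by (metis frechet_derivative_works pd_eq)

lemma C2_pd_vec_nth:
  fixes f :: "real^'n \<Rightarrow> real^'m"
  assumes U: "open U" and f: "Ck_on 2 U f"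
  shows "Ck_on 2 U (\<lambda>\<theta>. f \<theta> $ k)"
    and "\<theta> \<in> U \<Longrightarrow> pd i (pd j (\<lambda>\<theta>. f \<theta> $ k)) \<theta> = pd i (pd j f) \<theta> $ k"
proof -
  have d: "\<theta> \<in> U \<Longrightarrow> f differentiable (at \<theta>)" for \<theta>
    using f U by (auto simp: Ck_on_2_iff differentiable_on_eq_differentiable_at)
  have C: "C1_on U (\<lambda>\<theta>. pd j f \<theta> $ k)" for j
    by (rule C1_vec_nth[OF U]) (use f in \<open>simp add: Ck_on_2_iff\<close>)
  have C': "C1_on U (pd j (\<lambda>\<theta>. f \<theta> $ k))" for j
    by (rule C1_cong[OF U C[of j]]) (simp add: pd_vec_nth d)
  moreover have "(\<lambda>\<theta>. f \<theta> $ k) differentiable_on U"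
    using d by (intro differentiable_at_imp_differentiable_on differentiable_vec_nth)
  ultimately show "Ck_on 2 U (\<lambda>\<theta>. f \<theta> $ k)" by (simp add: Ck_on_2_iff)
  assume \<theta>: "\<theta> \<in> U"
  have "(pd j (\<lambda>\<theta>. f \<theta> $ k) has_derivative (\<lambda>v. frechet_derivative (pd j f) (at \<theta>) v $ k)) (at \<theta>)"
  proof (rule has_derivative_transform_within_open[OF _ U \<theta>])
    show "((\<lambda>\<theta>. pd j f \<theta> $ k) has_derivative (\<lambda>v. frechet_derivative (pd j f) (at \<theta>) v $ k)) (at \<theta>)"
      by (rule bounded_linear.has_derivative[OF bounded_linear_vec_nth])
        (use f in \<open>auto simp: Ck_on_2_iff intro: C1_has_derivative[OF _ U \<theta>]\<close>)
  qed (simp add: pd_vec_nth d)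
  from pd_eq[OF this] show "pd i (pd j (\<lambda>\<theta>. f \<theta> $ k)) \<theta> = pd i (pd j f) \<theta> $ k"
    by (simp add: pd_def)
qed

text \<open>The mean value theorem is applied twice: to the increment of \<open>f\<close> in
  direction \<open>b\<close> as a function of the shift in direction \<open>a\<close>, and then to
  \<open>pd a f\<close> along direction \<open>b\<close>.\<close>

lemma second_difference_mvt:
  fixes f :: "real^'n \<Rightarrow> real"
  assumes U: "open U" and f: "Ck_on 2 U f" and ball: "ball \<theta> (3 * r) \<subseteq> U" and r: "0 < r"
  shows "\<exists>\<xi>\<in>ball \<theta> (3 * r). f (\<theta> + r *\<^sub>R axis a 1 + r *\<^sub>R axis b 1) - f (\<theta> + r *\<^sub>R axis a 1)
    - f (\<theta> + r *\<^sub>R axis b 1) + f \<theta> = r\<^sup>2 * pd b (pd a f) \<xi>"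
proof -
  \<comment> \<open>All points in use lie at distance at most \<open>2 * r\<close> from \<theta>;
    the radius \<open>3 * r\<close> puts them inside the open ball.\<close>
  have in_ball: "\<theta> + s *\<^sub>R axis a 1 + t *\<^sub>R axis b 1 \<in> ball \<theta> (3 * r)"
    if "0 \<le> s" "s \<le> r" "0 \<le> t" "t \<le> r" for s t
  proof -
    have "norm (s *\<^sub>R axis a 1 + t *\<^sub>R axis b (1::real)) \<le> s + t"
      by (rule order_trans[OF norm_triangle_ineq]) (use that in \<open>simp add: norm_axis_1\<close>)
    then show ?thesis using that r by (simp add: dist_norm norm_minus_commute add.commute)
  qed
  have line: "((\<lambda>s. g (c + s *\<^sub>R axis i 1)) has_real_derivative pd i g (c + s *\<^sub>R axis i 1)) (at s)"
    if "C1_on U g" "c + s *\<^sub>R axis i 1 \<in> U" for g :: "real^'n \<Rightarrow> real" and c s i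
  proof -
    have D: "(g has_derivative frechet_derivative g (at (c + s *\<^sub>R axis i 1))) (at (c + s *\<^sub>R axis i 1))"
      by (rule C1_has_derivative[OF that(1) U that(2)])
    have "((\<lambda>s. g (c + s *\<^sub>R axis i 1)) has_derivative
        (\<lambda>h. frechet_derivative g (at (c + s *\<^sub>R axis i 1)) (h *\<^sub>R axis i 1))) (at s)"
    proof -
      have "((\<lambda>s. c + s *\<^sub>R axis i 1) has_derivative (\<lambda>h. h *\<^sub>R axis i 1)) (at s)"
        by (auto intro!: derivative_eq_intros)
      from has_derivative_compose[OF this D] show ?thesis .
    qed
    moreover have "frechet_derivative g (at (c + s *\<^sub>R axis i 1)) (h *\<^sub>R axis i 1) =
        pd i g (c + s *\<^sub>R axis i 1) * h" for h
      using linear_scale[OF has_derivative_linear[OF D]] by (simp add: pd_def)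
    ultimately show ?thesis by (simp add: has_field_derivative_def)
  qed
  have f1: "C1_on U f" "C1_on U (pd a f)"
    using f by (auto simp: Ck_on_2_iff C1_on_iff differentiable_imp_continuous_on)
  let ?a = "axis a (1::real)" and ?b = "axis b (1::real)"
  let ?\<phi> = "\<lambda>s. f ((\<theta> + r *\<^sub>R ?b) + s *\<^sub>R ?a) - f (\<theta> + s *\<^sub>R ?a)"
  have "\<exists>s>0. s < r \<and> ?\<phi> r - ?\<phi> 0 =
      (r - 0) * (pd a f ((\<theta> + r *\<^sub>R ?b) + s *\<^sub>R ?a) - pd a f (\<theta> + s *\<^sub>R ?a))"
  proof (rule MVT2[OF r])
    fix s assume s: "0 \<le> s" "s \<le> r"
    show "(?\<phi> has_real_derivative (pd a f ((\<theta> + r *\<^sub>R ?b) + s *\<^sub>R ?a) - pd a f (\<theta> + s *\<^sub>R ?a))) (at s)"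
      by (intro DERIV_diff line f1) (use s r in_ball[of s r] in_ball[of s 0] ball in \<open>auto simp: add_ac\<close>)
  qed
  then obtain s where s: "0 < s" "s < r" and es: "?\<phi> r - ?\<phi> 0 =
      r * (pd a f ((\<theta> + s *\<^sub>R ?a) + r *\<^sub>R ?b) - pd a f ((\<theta> + s *\<^sub>R ?a) + 0 *\<^sub>R ?b))"
    by (auto simp: add_ac)
  have "\<exists>t>0. t < r \<and> pd a f ((\<theta> + s *\<^sub>R ?a) + r *\<^sub>R ?b) - pd a f ((\<theta> + s *\<^sub>R ?a) + 0 *\<^sub>R ?b) =
      (r - 0) * pd b (pd a f) ((\<theta> + s *\<^sub>R ?a) + t *\<^sub>R ?b)"
  proof (rule MVT2[OF r])
    fix t assume t: "0 \<le> t" "t \<le> r"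
    show "((\<lambda>t. pd a f ((\<theta> + s *\<^sub>R ?a) + t *\<^sub>R ?b)) has_real_derivative
        pd b (pd a f) ((\<theta> + s *\<^sub>R ?a) + t *\<^sub>R ?b)) (at t)"
      by (intro line f1) (use s t in_ball[of s t] ball in auto)
  qed
  then obtain t where t: "0 < t" "t < r" and et:
      "pd a f ((\<theta> + s *\<^sub>R ?a) + r *\<^sub>R ?b) - pd a f ((\<theta> + s *\<^sub>R ?a) + 0 *\<^sub>R ?b) =
      r * pd b (pd a f) ((\<theta> + s *\<^sub>R ?a) + t *\<^sub>R ?b)" by auto
  show ?thesis
    using es[unfolded et] s t in_ball[of s t]
    by (intro bexI[of _ "(\<theta> + s *\<^sub>R ?a) + t *\<^sub>R ?b"]) (auto simp: power2_eq_square algebra_simps)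
qed

text \<open>The second difference is symmetric in \<open>a\<close> and \<open>b\<close>, so the two
  mixed derivatives take a common value at two points of an arbitrarily small ball; continuity
  carries the equality to the centre.\<close>

lemma pd_commute_real:
  fixes f :: "real^'n \<Rightarrow> real"
  assumes U: "open U" and f: "Ck_on 2 U f" and \<theta>: "\<theta> \<in> U"
  shows "pd a (pd b f) \<theta> = pd b (pd a f) \<theta>"
proof (rule ccontr)
  let ?A = "pd a (pd b f)" and ?B = "pd b (pd a f)"
  assume ne: "?A \<theta> \<noteq> ?B \<theta>"
  \<comment> \<open>Half of the gap, so that two errors below \<open>e\<close> cannot bridge
    it.\<close>
  define e where "e = \<bar>?A \<theta> - ?B \<theta>\<bar> / 2"
  have e: "0 < e" using ne by (simp add: e_def)
  have "continuous_on U ?A" "continuous_on U ?B"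
    using f by (auto simp: Ck_on_2_iff intro!: C1_continuous_pd)
  then have "isCont ?A \<theta>" "isCont ?B \<theta>" using U \<theta> continuous_on_eq_continuous_at by blast+
  then obtain d1 d2 where d: "0 < d1" "\<And>\<xi>. dist \<xi> \<theta> < d1 \<Longrightarrow> dist (?A \<xi>) (?A \<theta>) < e"
     "0 < d2" "\<And>\<xi>. dist \<xi> \<theta> < d2 \<Longrightarrow> dist (?B \<xi>) (?B \<theta>) < e"
    unfolding continuous_at by (metis LIM_def e dist_self)
  obtain d3 where d3: "0 < d3" "ball \<theta> d3 \<subseteq> U" using U \<theta> openE by blast
  define r where "r = min d1 (min d2 d3) / 3"
  have r: "0 < r" "3 * r \<le> d1" "3 * r \<le> d2" "3 * r \<le> d3" using d d3 by (auto simp: r_def)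
  have sub: "ball \<theta> (3 * r) \<subseteq> U" using d3 r by auto
  obtain \<xi> where x: "\<xi> \<in> ball \<theta> (3 * r)" "f (\<theta> + r *\<^sub>R axis a 1 + r *\<^sub>R axis b 1) - f (\<theta> + r *\<^sub>R axis a 1)
    - f (\<theta> + r *\<^sub>R axis b 1) + f \<theta> = r\<^sup>2 * ?B \<xi>"
    using second_difference_mvt[OF U f sub r(1)] by blast
  obtain \<zeta> where z: "\<zeta> \<in> ball \<theta> (3 * r)" "f (\<theta> + r *\<^sub>R axis b 1 + r *\<^sub>R axis a 1) - f (\<theta> + r *\<^sub>R axis b 1)
    - f (\<theta> + r *\<^sub>R axis a 1) + f \<theta> = r\<^sup>2 * ?A \<zeta>"
    using second_difference_mvt[OF U f sub r(1)] by blast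
  have "r\<^sup>2 * ?B \<xi> = r\<^sup>2 * ?A \<zeta>"
  proof -
    have "\<theta> + r *\<^sub>R axis b 1 + r *\<^sub>R axis a 1 = \<theta> + r *\<^sub>R axis a 1 + r *\<^sub>R axis b 1"
      by (simp add: add_ac)
    from x(2) z(2)[unfolded this] show ?thesis by linarith
  qed
  then have "?B \<xi> = ?A \<zeta>" using r by simp
  moreover have "dist \<zeta> \<theta> < d1" "dist \<xi> \<theta> < d2" using x(1) z(1) r by (auto simp: dist_commute)
  then have "dist (?A \<zeta>) (?A \<theta>) < e" "dist (?B \<xi>) (?B \<theta>) < e" by (auto intro: d(2,4))
  ultimately show False using dist_triangle3[of "?A \<theta>" "?B \<theta>" "?A \<zeta>"] by (simp add: e_def dist_real_def[of "?A \<theta>" "?B \<theta>"])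
qed

lemma pd_commute:
  fixes f :: "real^'n \<Rightarrow> real^'m"
  assumes "open U" "Ck_on 2 U f" "\<theta> \<in> U"
  shows "pd a (pd b f) \<theta> = pd b (pd a f) \<theta>"
  using pd_commute_real[OF assms(1) C2_pd_vec_nth(1)[OF assms(1,2)] assms(3), of a b]
  by (simp add: vec_eq_iff C2_pd_vec_nth(2)[OF assms])

section \<open>Partial derivatives of products, inverse matrices and densities\<close>

lemma C1_on_subset: "C1_on U f \<Longrightarrow> V \<subseteq> U \<Longrightarrow> C1_on V f"
  by (auto simp: C1_on_iff intro: differentiable_on_subset continuous_on_subset)

lemma pd_mult:
  fixes f g :: "real^'n \<Rightarrow> real"
  assumes "f differentiable (at \<theta>)" "g differentiable (at \<theta>)"
  shows "pd i (\<lambda>\<xi>. f \<xi> * g \<xi>) \<theta> = f \<theta> * pd i g \<theta> + g \<theta> * pd i f \<theta>"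
  using pd_eq[OF has_derivative_mult[OF assms[unfolded frechet_derivative_works]]]
  by (simp add: pd_def mult.commute)

lemma pd_sum:
  assumes "\<And>j. j \<in> A \<Longrightarrow> f j differentiable (at \<theta>)"
  shows "pd i (\<lambda>\<xi>. \<Sum>j\<in>A. f j \<xi>) \<theta> = (\<Sum>j\<in>A. pd i (f j) \<theta>)"
proof -
  have "((\<lambda>\<xi>. \<Sum>j\<in>A. f j \<xi>) has_derivative (\<lambda>v. \<Sum>j\<in>A. frechet_derivative (f j) (at \<theta>) v)) (at \<theta>)"
    using assms by (intro has_derivative_sum) (simp add: frechet_derivative_works[symmetric])
  from pd_eq[OF this] show ?thesis by (simp add: pd_def)
qed

lemma pd_inner:
  fixes f g :: "real^'n \<Rightarrow> real^'m"
  assumes "f differentiable (at \<theta>)" "g differentiable (at \<theta>)"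
  shows "pd i (\<lambda>\<xi>. f \<xi> \<bullet> g \<xi>) \<theta> = f \<theta> \<bullet> pd i g \<theta> + pd i f \<theta> \<bullet> g \<theta>"
  using pd_eq[OF has_derivative_inner[OF assms[unfolded frechet_derivative_works]]]
  by (simp add: pd_def)

lemma C1_differentiable: "C1_on U f \<Longrightarrow> open U \<Longrightarrow> \<theta> \<in> U \<Longrightarrow> f differentiable (at \<theta>)"
  by (auto simp: C1_on_iff differentiable_on_eq_differentiable_at)

lemma pd_matrix_inv:
  fixes A :: "real^'n \<Rightarrow> real^'k^'k"
  assumes "\<And>i j. (\<lambda>\<xi>. A \<xi> $ i $ j) differentiable (at \<theta>)" "det (A \<theta>) \<noteq> 0"
  shows "pd c (\<lambda>\<xi>. matrix_inv (A \<xi>) $ i $ j) \<theta> = - (\<Sum>a\<in>UNIV. \<Sum>b\<in>UNIV.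
    matrix_inv (A \<theta>) $ i $ a * pd c (\<lambda>\<xi>. A \<xi> $ a $ b) \<theta> * matrix_inv (A \<theta>) $ b $ j)"
  using pd_eq[OF has_derivative_matrix_inv[OF assms(1)[unfolded frechet_derivative_works] assms(2)]]
  by (simp add: pd_def)

lemma has_derivative_sqrt_det:
  fixes A :: "'a::real_normed_vector \<Rightarrow> real^'k^'k"
  assumes A: "\<And>i j. ((\<lambda>\<xi>. A \<xi> $ i $ j) has_derivative D i j) (at \<theta>)"
    and pos: "0 < det (A \<theta>)"
  shows "((\<lambda>\<xi>. sqrt (det (A \<xi>))) has_derivative (\<lambda>v. sqrt (det (A \<theta>)) / 2 *
    (\<Sum>i\<in>UNIV. \<Sum>j\<in>UNIV. matrix_inv (A \<theta>) $ i $ j * D j i v))) (at \<theta>)"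
proof -
  have nz: "det (A \<theta>) \<noteq> 0" using pos by simp
  have "(sqrt has_derivative (*) (inverse (sqrt (det (A \<theta>))) / 2)) (at (det (A \<theta>)))"
    using DERIV_real_sqrt[OF pos] by (simp add: has_field_derivative_def)
  from has_derivative_compose[OF has_derivative_det[OF A nz] this]
  have "((\<lambda>\<xi>. sqrt (det (A \<xi>))) has_derivative (\<lambda>v. inverse (sqrt (det (A \<theta>))) / 2 *
    (det (A \<theta>) * (\<Sum>i\<in>UNIV. \<Sum>j\<in>UNIV. matrix_inv (A \<theta>) $ i $ j * D j i v)))) (at \<theta>)" .
  moreover have "inverse (sqrt (det (A \<theta>))) / 2 * (det (A \<theta>) * x) = sqrt (det (A \<theta>)) / 2 * x" for x
  proof -
    have "inverse (sqrt (det (A \<theta>))) * det (A \<theta>) = sqrt (det (A \<theta>))"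
      using pos real_div_sqrt[of "det (A \<theta>)"] by (simp add: divide_inverse mult.commute)
    then show ?thesis by (metis mult.assoc times_divide_eq_left)
  qed
  ultimately show ?thesis by (simp only:)
qed

text \<open>Jacobi's formula in logarithmic form: the root of a determinant has half the trace of
  inverse times derivative as its logarithmic derivative, and a quotient subtracts the two. In use,
  \<open>A\<close> is the metric of the Laplacian and \<open>B\<close> the induced one.\<close>

lemma pd_sqrt_det_ratio:
  fixes A B :: "real^'n \<Rightarrow> real^'k^'k"
  assumes A: "\<And>i j. (\<lambda>\<xi>. A \<xi> $ i $ j) differentiable (at \<theta>)" "0 < det (A \<theta>)"
    and B: "\<And>i j. (\<lambda>\<xi>. B \<xi> $ i $ j) differentiable (at \<theta>)" "0 < det (B \<theta>)"
  shows "pd c (\<lambda>\<xi>. sqrt (det (A \<xi>)) / sqrt (det (B \<xi>))) \<theta> =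
    sqrt (det (A \<theta>)) / sqrt (det (B \<theta>)) *
    ((\<Sum>i\<in>UNIV. \<Sum>j\<in>UNIV. matrix_inv (A \<theta>) $ i $ j * pd c (\<lambda>\<xi>. A \<xi> $ j $ i) \<theta>) / 2 -
     (\<Sum>i\<in>UNIV. \<Sum>j\<in>UNIV. matrix_inv (B \<theta>) $ i $ j * pd c (\<lambda>\<xi>. B \<xi> $ j $ i) \<theta>) / 2)"
proof -
  have nz: "sqrt (det (B \<theta>)) \<noteq> 0" using B by simp
  have alg: "(a / 2 * s * b - a * (b / 2 * r)) / (b * b) = a / b * (s / 2 - r / 2)"
    if "b \<noteq> 0" for a b s r :: real
    using that by (simp add: field_simps)
  from pd_eq[OF has_derivative_divide'[OF
      has_derivative_sqrt_det[OF A(1)[unfolded frechet_derivative_works] A(2)]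
      has_derivative_sqrt_det[OF B(1)[unfolded frechet_derivative_works] B(2)] nz], of c]
  show ?thesis unfolding pd_def alg[OF nz] .
qed

lemma pd_cong:
  assumes "open U" "\<theta> \<in> U" "\<And>\<xi>. \<xi> \<in> U \<Longrightarrow> f \<xi> = g \<xi>"
  shows "pd i f \<theta> = pd i g \<theta>"
proof -
  have "(f has_derivative d) (at \<theta>) \<longleftrightarrow> (g has_derivative d) (at \<theta>)" for d
    using has_derivative_transform_within_open[OF _ assms(1,2), of f d UNIV g]
      has_derivative_transform_within_open[OF _ assms(1,2), of g d UNIV f] assms(3) by metis
  then show ?thesis by (simp add: pd_def frechet_derivative_def)
qed

section \<open>Tangential calculus on a surface\<close>

text \<open>Linear algebra at one point of a surface. Coordinate vectors are not orthonormal; the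
  positive Gram determinant expresses their independence, and with \<nu> they form a basis because
  the ambient type has exactly one more index.\<close>

locale normal_frame =
  fixes t :: "'n::finite \<Rightarrow> real^'m::finite" and \<nu> :: "real^'m"
  assumes card: "CARD('m) = CARD('n) + 1"
    and gram: "0 < det (\<chi> i j. t i \<bullet> t j)"
    and unit: "\<nu> \<bullet> \<nu> = 1"
    and orth: "\<nu> \<bullet> t i = 0"
begin

definition gram_inv :: "real^'n^'n" where "gram_inv = matrix_inv (\<chi> i j. t i \<bullet> t j)"

lemma orth': "t i \<bullet> \<nu> = 0"
  using orth by (simp add: inner_commute)

lemma gram_inv_sum: "(\<Sum>j\<in>UNIV. gram_inv $ i $ j * (t j \<bullet> t k)) = (if i = k then 1 else 0)"
  using sum_matrix_inv(2)[of "\<chi> i j. t i \<bullet> t j" i k] gram by (simp add: gram_inv_def)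

text \<open>Take \<nu> and the vectors \<open>t i\<close> as the rows of a square matrix B. Then B H
  B^T has a unit row and column at the index of \<nu>, so its determinant is that of the tangential
  block, and \<open>b\<close> is the square of det B. Invertibility of B gives the second claim. The
  existential hides the arbitrary numbering of the rows.\<close>

lemma det_conjugate_exists:
  "\<exists>b. b \<noteq> 0 \<and> (\<forall>H. H *v \<nu> = \<nu> \<longrightarrow> (\<forall>j. \<nu> \<bullet> (H *v t j) = 0) \<longrightarrow>
     b * det H = det (\<chi> i j. t i \<bullet> (H *v t j))) \<and>
   (\<forall>w. (\<forall>i. w \<bullet> t i = 0) \<longrightarrow> w \<bullet> \<nu> = 0 \<longrightarrow> w = 0)"
proof -
  obtain k :: 'm where True by simp
  have "card (UNIV - {k}) = CARD('n)" using card by simp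
  then obtain e :: "'n \<Rightarrow> 'm" where e: "bij_betw e UNIV (UNIV - {k})"
    by (metis finite finite_same_card_bij)
  then have inj: "inj e" and ran: "range e = UNIV - {k}" by (auto simp: bij_betw_def)
  define B :: "real^'m^'m" where "B = (\<chi> a. if a = k then \<nu> else t (inv e a))"
  have ek: "e i \<noteq> k" for i using ran by auto
  have Be: "B $ e i = t i" "B $ k = \<nu>" for i by (auto simp: B_def ek inv_f_f[OF inj])
  have entry: "(B ** H ** transpose B) $ a $ c = B $ a \<bullet> (H *v B $ c)" for H a c
  proof -
    have "(B ** H ** transpose B) $ a $ c = (B ** (H ** transpose B)) $ a $ c"
      by (simp add: matrix_mul_assoc)
    then show ?thesis
      by (simp add: matrix_matrix_mult_def inner_vec_def matrix_vector_mult_def transpose_def)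
  qed
  have exh: "a = k \<or> (\<exists>i. a = e i)" for a using ran by blast
  have conj: "(det B * det B) * det H = det (\<chi> i j. t i \<bullet> (H *v t j))"
    if H: "H *v \<nu> = \<nu>" "\<forall>j. \<nu> \<bullet> (H *v t j) = 0" for H
  proof -
    have "det (B ** H ** transpose B) =
        det (\<chi> i j. (B ** H ** transpose B) $ e i $ e j)"
    proof (rule det_unit_block[OF inj ran])
      show "(B ** H ** transpose B) $ k $ j = (if j = k then 1 else 0)" for j
        using exh[of j] H ek unit by (auto simp: entry Be)
      show "(B ** H ** transpose B) $ i $ k = (if i = k then 1 else 0)" for i
        using exh[of i] H ek unit by (auto simp: entry Be orth')
    qed
    then show ?thesis by (simp add: det_mul det_transpose entry Be mult_ac)
  qed
  \<comment> \<open>The identity in place of \<open>H\<close> identifies the square of det B with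
    the Gram determinant, so B is invertible.\<close>
  have "det B * det B = det (\<chi> i j. t i \<bullet> t j)" using conj[of "mat 1"] orth by simp
  then have nz: "det B * det B \<noteq> 0" using gram by simp
  moreover have "w = 0" if "\<forall>i. w \<bullet> t i = 0" "w \<bullet> \<nu> = 0" for w
  proof -
    have "B *v w = 0"
      unfolding vec_eq_iff
    proof
      show "(B *v w) $ a = 0 $ a" for a
        using exh[of a] that by (auto simp: matrix_vector_mul_component Be inner_commute)
    qed
    then have "(matrix_inv B ** B) *v w = 0" by (simp add: matrix_vector_mul_assoc[symmetric])
    then show ?thesis using nz by (simp add: matrix_inv_right_left)
  qed
  ultimately show ?thesis using conj by blast
qed

text \<open>The factor \<open>b\<close> is the same for all admissible \<open>H\<close>; the
  identity matrix determines its value.\<close>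

lemma det_conjugate:
  assumes "H *v \<nu> = \<nu>" "\<And>j. \<nu> \<bullet> (H *v t j) = 0"
  shows "det (\<chi> i j. t i \<bullet> t j) * det H = det (\<chi> i j. t i \<bullet> (H *v t j))"
proof -
  obtain b where b: "\<And>H. H *v \<nu> = \<nu> \<Longrightarrow> (\<And>j. \<nu> \<bullet> (H *v t j) = 0) \<Longrightarrow>
     b * det H = det (\<chi> i j. t i \<bullet> (H *v t j))"
    using det_conjugate_exists by blast
  show ?thesis using b[of H] b[of "mat 1"] assms orth by simp
qed

lemma frame_eqI:
  assumes "\<And>i. v \<bullet> t i = w \<bullet> t i" "v \<bullet> \<nu> = w \<bullet> \<nu>"
  shows "v = w"
proof -
  have "(v - w) \<bullet> t i = 0" "(v - w) \<bullet> \<nu> = 0" for i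
    using assms by (simp_all add: inner_diff_left)
  then have "v - w = 0" using det_conjugate_exists by blast
  then show ?thesis by simp
qed

text \<open>Raising of an index: a covector, given by its values on the tangent vectors, becomes the
  tangential vector having these values as inner products.\<close>

definition lift :: "('n \<Rightarrow> real) \<Rightarrow> real^'m" where
  "lift l = (\<Sum>i\<in>UNIV. \<Sum>j\<in>UNIV. (gram_inv $ i $ j * l i) *\<^sub>R t j)"

lemma lift_tangent: "lift l \<bullet> t k = l k"
proof -
  have "lift l \<bullet> t k = (\<Sum>i\<in>UNIV. l i * (\<Sum>j\<in>UNIV. gram_inv $ i $ j * (t j \<bullet> t k)))"
    by (simp add: lift_def inner_sum_left sum_distrib_left mult_ac)
  then show ?thesis by (simp add: gram_inv_sum if_distrib cong: if_cong)
qed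

lemma lift_normal: "lift l \<bullet> \<nu> = 0"
  by (simp add: lift_def inner_sum_left orth')

lemma frame_expand: "w = lift (\<lambda>i. w \<bullet> t i) + (w \<bullet> \<nu>) *\<^sub>R \<nu>"
  by (rule frame_eqI) (simp_all add: inner_add_left lift_tangent lift_normal orth unit)

lemma matrix_frame_eqI:
  fixes A B :: "real^'m^'k"
  assumes "\<And>i. A *v t i = B *v t i" "A *v \<nu> = B *v \<nu>"
  shows "A = B"
proof -
  have "A $ a = B $ a" for a
    using arg_cong[OF assms(1), of "\<lambda>v. v $ a"] arg_cong[OF assms(2), of "\<lambda>v. v $ a"]
    by (intro frame_eqI) (simp_all add: matrix_vector_mul_component)
  then show ?thesis by (simp add: vec_eq_iff)
qed

end

lemma outer_mult: "(a \<otimes>\<^sub>v b) *v c = (b \<bullet> c) *\<^sub>R a"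
  by (simp add: vec_eq_iff outer_def matrix_vector_mult_def inner_vec_def sum_distrib_left mult_ac)

lemma projection_mult: "projection \<nu> y *v c = c - (\<nu> y \<bullet> c) *\<^sub>R \<nu> y"
  by (simp add: projection_def matrix_vector_mult_diff_rdistrib outer_mult)

text \<open>The quadratic form of the metric is the squared norm of the image under the derivative
  of \<open>F\<close>, which injectivity makes positive.\<close>

lemma induced_metric_det_pos:
  fixes F :: "real^'n \<Rightarrow> real^'m"
  assumes "F differentiable (at \<theta>)" "inj (frechet_derivative F (at \<theta>))"
  shows "0 < det (induced_metric F \<theta>)"
proof (rule pos_def_det_pos)
  fix v :: "real^'n"
  assume "v \<noteq> 0"
  let ?D = "frechet_derivative F (at \<theta>)"
  have "?D v \<noteq> 0"
    using \<open>v \<noteq> 0\<close> assms linear_injective_0[OF linear_frechet_derivative[OF assms(1)]] by blast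
  then have "0 < ?D v \<bullet> ?D v" by simp
  also have "?D v \<bullet> ?D v = v \<bullet> (induced_metric F \<theta> *v v)"
  proof -
    have A: "?D v \<bullet> w = (\<Sum>i\<in>UNIV. v $ i * (pd i F \<theta> \<bullet> w))" for w
      by (simp add: frechet_derivative_pd[OF assms(1)] inner_sum_left)
    have B: "w \<bullet> ?D v = (\<Sum>j\<in>UNIV. (w \<bullet> pd j F \<theta>) * v $ j)" for w
      by (simp add: frechet_derivative_pd[OF assms(1)] inner_sum_right mult.commute)
    show ?thesis
      unfolding A unfolding B
      by (simp add: inner_vec_def[of v] matrix_vector_mult_def induced_metric_def)
  qed
  finally show "0 < v \<bullet> (induced_metric F \<theta> *v v)" .
qed

text \<open>The image of a chart is thin in the ambient space, so the inverse is differentiated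
  within the image and its derivative is just a left inverse of \<open>f'\<close>. The error of the
  inverse is, up to sign, \<open>g'\<close> applied to the remainder of \<open>f\<close>; continuity
  of \<open>C\<close> keeps the preimages close to \<open>a\<close>.\<close>

lemma has_derivative_inverse_within:
  fixes f :: "'a::real_normed_vector \<Rightarrow> 'b::real_normed_vector"
  assumes f: "(f has_derivative f') (at a)" and a: "a \<in> U"
    and C: "continuous_on (f ` U) C" "\<And>z. z \<in> U \<Longrightarrow> C (f z) = z"
    and g: "bounded_linear g'" "\<And>v. g' (f' v) = v"
  shows "(C has_derivative g') (at (f a) within f ` U)"
  unfolding has_derivative_within_alt
proof (intro conjI allI impI)
  fix e :: real
  assume e: "0 < e"
  obtain K where K: "0 < K" "\<And>v. norm (g' v) \<le> norm v * K"
    using bounded_linear.pos_bounded[OF g(1)] by blast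
  \<comment> \<open>The first bound lets the remainder be absorbed, so that
    \<open>norm (z - a)\<close> is at most \<open>2 * K * norm (y - f a)\<close>; the second then
    brings the total error below \<open>e * norm (y - f a)\<close>.\<close>
  define e1 where "e1 = min (1 / (2 * K)) (e / (2 * K\<^sup>2))"
  have e1: "0 < e1" "K * e1 \<le> 1 / 2" "2 * K\<^sup>2 * e1 \<le> e"
    using K e by (auto simp: e1_def min_def field_simps power2_eq_square)
  obtain d1 where d1: "0 < d1" "\<And>z. norm (z - a) < d1 \<Longrightarrow> norm (f z - f a - f' (z - a)) \<le> e1 * norm (z - a)"
    using f e1(1) unfolding has_derivative_at_alt by blast
  obtain d2 where d2: "0 < d2" "\<And>y. y \<in> f ` U \<Longrightarrow> dist y (f a) < d2 \<Longrightarrow> dist (C y) (C (f a)) < d1"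
    using C(1) a d1(1) unfolding continuous_on_iff by (metis imageI)
  have "norm (C y - C (f a) - g' (y - f a)) \<le> e * norm (y - f a)"
    if y: "y \<in> f ` U" "norm (y - f a) < d2" for y
  proof -
    obtain z where z: "y = f z" "z \<in> U" using y by blast
    have near: "norm (z - a) < d1" using d2(2)[of y] y z a C(2) by (simp add: dist_norm)
    define r where "r = f z - f a - f' (z - a)"
    have r: "norm r \<le> e1 * norm (z - a)" using d1(2)[OF near] by (simp add: r_def)
    have g'r: "g' r = g' (y - f a) - (z - a)"
      by (simp add: r_def z(1) g(2) linear_diff[OF bounded_linear.linear[OF g(1)]])
    have n: "norm (g' r) \<le> K * e1 * norm (z - a)"
      by (rule order_trans[OF K(2)]) (use mult_right_mono[OF r, of K] K(1) in \<open>simp add: mult_ac\<close>)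
    have "norm (z - a) = norm (g' (y - f a) - g' r)" by (simp add: g'r)
    also have "\<dots> \<le> norm (g' (y - f a)) + norm (g' r)" by (rule norm_triangle_ineq4)
    also have "\<dots> \<le> norm (y - f a) * K + 1 / 2 * norm (z - a)"
      using K(2)[of "y - f a"] n mult_right_mono[OF e1(2), of "norm (z - a)"] by simp
    finally have za: "norm (z - a) \<le> 2 * K * norm (y - f a)" by (simp add: field_simps)
    have "norm (C y - C (f a) - g' (y - f a)) = norm (g' r)"
      using C(2) z a by (simp add: g'r norm_minus_commute)
    also have "\<dots> \<le> K * e1 * (2 * K * norm (y - f a))"
      using n za K e1 by (meson mult_left_mono mult_nonneg_nonneg less_imp_le order_trans)
    also have "\<dots> = 2 * K\<^sup>2 * e1 * norm (y - f a)" by (simp add: power2_eq_square)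
    also have "\<dots> \<le> e * norm (y - f a)" using e1(3) by (rule mult_right_mono) simp
    finally show ?thesis .
  qed
  then show "\<exists>d>0. \<forall>y\<in>f ` U. norm (y - f a) < d \<longrightarrow>
      norm (C y - C (f a) - g' (y - f a)) \<le> e * norm (y - f a)"
    using d2(1) by blast
qed (rule g(1))

text \<open>Read \<open>q\<close> as the inverse metric, \<open>d l i j\<close> as the derivative of
  g_ij in direction l and \<open>f k\<close> as a first derivative. The divergence of sqrt(det g) q,
  divided by sqrt(det g), is then minus the metric trace of the Christoffel symbols. Two of the
  three Christoffel terms coincide by symmetry of \<open>q\<close> and match the derivative of the
  inverse metric; the third matches the half trace from Jacobi's formula.\<close>

lemma laplacian_algebra:
  fixes q :: "'n::finite \<Rightarrow> 'n \<Rightarrow> real" and d :: "'n \<Rightarrow> 'n \<Rightarrow> 'n \<Rightarrow> real"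
  assumes q: "\<And>i j. q i j = q j i"
  shows "(\<Sum>j\<in>UNIV. ((\<Sum>a\<in>UNIV. \<Sum>b\<in>UNIV. q a b * d j b a) / 2) * (\<Sum>i\<in>UNIV. q i j * f i)
      + (\<Sum>i\<in>UNIV. - (\<Sum>a\<in>UNIV. \<Sum>b\<in>UNIV. q i a * d j a b * q b j) * f i)) =
    - (\<Sum>i\<in>UNIV. \<Sum>j\<in>UNIV. q i j * (\<Sum>k\<in>UNIV. (1/2) * (\<Sum>l\<in>UNIV. q k l *
        (d i l j + d j l i - d l i j)) * f k))"
proof -
  define A where "A = (\<Sum>i\<in>UNIV. \<Sum>j\<in>UNIV. \<Sum>k\<in>UNIV. \<Sum>l\<in>UNIV. q i j * q k l * d i l j * f k)"
  define B where "B = (\<Sum>i\<in>UNIV. \<Sum>j\<in>UNIV. \<Sum>k\<in>UNIV. \<Sum>l\<in>UNIV. q i j * q k l * d l i j * f k)"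
  have A': "(\<Sum>i\<in>UNIV. \<Sum>j\<in>UNIV. \<Sum>k\<in>UNIV. \<Sum>l\<in>UNIV. q i j * q k l * d j l i * f k) = A"
    unfolding A_def by (subst sum.swap, intro sum.cong refl) (simp add: q)
  have "(\<Sum>i\<in>UNIV. \<Sum>j\<in>UNIV. q i j * (\<Sum>k\<in>UNIV. (1/2) * (\<Sum>l\<in>UNIV. q k l *
        (d i l j + d j l i - d l i j)) * f k)) =
      (\<Sum>i\<in>UNIV. \<Sum>j\<in>UNIV. \<Sum>k\<in>UNIV. \<Sum>l\<in>UNIV. (1/2) * (q i j * q k l * d i l j * f k)
        + (1/2) * (q i j * q k l * d j l i * f k) - (1/2) * (q i j * q k l * d l i j * f k))"
    unfolding sum_distrib_left sum_distrib_right
    by (intro sum.cong refl) (simp add: algebra_simps)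
  also have "\<dots> = 1/2 * A + 1/2 * A - 1/2 * B"
    unfolding sum_subtractf sum.distrib sum_distrib_left[symmetric] A' unfolding A_def B_def by simp
  finally have R: "(\<Sum>i\<in>UNIV. \<Sum>j\<in>UNIV. q i j * (\<Sum>k\<in>UNIV. (1/2) * (\<Sum>l\<in>UNIV. q k l *
        (d i l j + d j l i - d l i j)) * f k)) = 1/2 * A + 1/2 * A - 1/2 * B" .
  have L1: "(\<Sum>j\<in>UNIV. ((\<Sum>a\<in>UNIV. \<Sum>b\<in>UNIV. q a b * d j b a) / 2) * (\<Sum>i\<in>UNIV. q i j * f i)) = 1/2 * B"
  proof -
    have "(\<Sum>j\<in>UNIV. ((\<Sum>a\<in>UNIV. \<Sum>b\<in>UNIV. q a b * d j b a) / 2) * (\<Sum>i\<in>UNIV. q i j * f i)) =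
      (\<Sum>j\<in>UNIV. \<Sum>a\<in>UNIV. \<Sum>b\<in>UNIV. \<Sum>i\<in>UNIV. 1/2 * (q a b * q i j * d j b a * f i))"
      unfolding sum_divide_distrib sum_distrib_right unfolding sum_distrib_left
      by (intro sum.cong refl) (simp add: algebra_simps)
    also have "\<dots> = 1/2 * (\<Sum>j\<in>UNIV. \<Sum>a\<in>UNIV. \<Sum>b\<in>UNIV. \<Sum>i\<in>UNIV. q a b * q i j * d j b a * f i)"
      by (simp only: sum_distrib_left)
    also have "(\<Sum>j\<in>UNIV. \<Sum>a\<in>UNIV. \<Sum>b\<in>UNIV. \<Sum>i\<in>UNIV. q a b * q i j * d j b a * f i) =
      (\<Sum>a\<in>UNIV. \<Sum>b\<in>UNIV. \<Sum>i\<in>UNIV. \<Sum>j\<in>UNIV. q a b * q i j * d j b a * f i)"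
      by (subst sum.swap, rule sum.cong[OF refl], subst sum.swap, rule sum.cong[OF refl], rule sum.swap)
    also have "\<dots> = (\<Sum>b\<in>UNIV. \<Sum>a\<in>UNIV. \<Sum>i\<in>UNIV. \<Sum>j\<in>UNIV. q a b * q i j * d j b a * f i)"
      by (rule sum.swap)
    also have "\<dots> = B" unfolding B_def by (intro sum.cong refl) (simp add: q)
    finally show ?thesis .
  qed
  have L2: "(\<Sum>j\<in>UNIV. \<Sum>i\<in>UNIV. - (\<Sum>a\<in>UNIV. \<Sum>b\<in>UNIV. q i a * d j a b * q b j) * f i) = - A"
  proof -
    have "(\<Sum>j\<in>UNIV. \<Sum>i\<in>UNIV. - (\<Sum>a\<in>UNIV. \<Sum>b\<in>UNIV. q i a * d j a b * q b j) * f i) =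
      - (\<Sum>j\<in>UNIV. \<Sum>i\<in>UNIV. \<Sum>a\<in>UNIV. \<Sum>b\<in>UNIV. q b j * q i a * d j a b * f i)"
      unfolding sum_negf[symmetric] sum_distrib_right
      by (intro sum.cong refl) (simp add: algebra_simps)
    also have "(\<Sum>j\<in>UNIV. \<Sum>i\<in>UNIV. \<Sum>a\<in>UNIV. \<Sum>b\<in>UNIV. q b j * q i a * d j a b * f i) =
      (\<Sum>j\<in>UNIV. \<Sum>b\<in>UNIV. \<Sum>i\<in>UNIV. \<Sum>a\<in>UNIV. q b j * q i a * d j a b * f i)"
      by (rule sum.cong[OF refl], rule trans[OF sum.cong[OF refl sum.swap] sum.swap])
    also have "\<dots> = A" unfolding A_def by (intro sum.cong refl) (simp add: q)
    finally show ?thesis .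
  qed
  show ?thesis unfolding R sum.distrib L1 L2 by (simp add: field_simps)
qed

text \<open>\<open>atlas\<close> is a predicate on parametrizations, so that the compositions of an
  embedding with the parametrizations of the reference hypersurface can be used directly. The normal
  is taken to be continuous; its differentiability is derived from the C^2 charts.\<close>

locale surface =
  fixes S :: "(real^'m::finite) set" and \<nu> :: "real^'m \<Rightarrow> real^'m"
    and atlas :: "(real^'n::finite) set \<Rightarrow> (real^'n \<Rightarrow> real^'m) \<Rightarrow> bool"
  assumes card: "CARD('m) = CARD('n) + 1"
    and compact: "compact S"
    and cover: "p \<in> S \<Longrightarrow> \<exists>U F. atlas U F \<and> p \<in> F ` U"
    and chart_open: "atlas U F \<Longrightarrow> open U"
    and chart_C2: "atlas U F \<Longrightarrow> Ck_on 2 U F"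
    and chart_openin: "atlas U F \<Longrightarrow> openin (top_of_set S) (F ` U)"
    and chart_homeo: "atlas U F \<Longrightarrow> \<exists>C. homeomorphism U (F ` U) F C"
    and chart_inj: "atlas U F \<Longrightarrow> \<theta> \<in> U \<Longrightarrow> inj (frechet_derivative F (at \<theta>))"
    and normal_cont: "continuous_on S \<nu>"
    and normal_unit: "p \<in> S \<Longrightarrow> norm (\<nu> p) = 1"
    and normal_orth: "atlas U F \<Longrightarrow> \<theta> \<in> U \<Longrightarrow> \<nu> (F \<theta>) \<bullet> pd i F \<theta> = 0"
begin

section \<open>Tangential gradients in coordinates\<close>

lemma chart_sub: "atlas U F \<Longrightarrow> \<theta> \<in> U \<Longrightarrow> F \<theta> \<in> S"
  using chart_openin openin_imp_subset by blast

lemma chart_C1: "atlas U F \<Longrightarrow> C1_on U F"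
  using chart_C2 by (auto simp: Ck_on_2_iff C1_on_iff differentiable_imp_continuous_on)

lemma chart_pd_C1: "atlas U F \<Longrightarrow> C1_on U (pd i F)"
  using chart_C2 by (auto simp: Ck_on_2_iff)

lemma chart_derivative:
  "atlas U F \<Longrightarrow> \<theta> \<in> U \<Longrightarrow> (F has_derivative frechet_derivative F (at \<theta>)) (at \<theta>)"
  by (intro C1_has_derivative[OF chart_C1 chart_open])

lemma chart_det_pos: "atlas U F \<Longrightarrow> \<theta> \<in> U \<Longrightarrow> 0 < det (induced_metric F \<theta>)"
  by (intro induced_metric_det_pos chart_inj differentiableI[OF chart_derivative])

lemma chart_frame:
  assumes "atlas U F" "\<theta> \<in> U"
  shows "normal_frame (\<lambda>i. pd i F \<theta>) (\<nu> (F \<theta>))"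
proof
  show "0 < det (\<chi> i j. pd i F \<theta> \<bullet> pd j F \<theta>)"
    using chart_det_pos[OF assms] by (simp add: induced_metric_def)
  show "\<nu> (F \<theta>) \<bullet> \<nu> (F \<theta>) = 1"
    using normal_unit[OF chart_sub[OF assms]] by (simp add: norm_eq_1)
qed (use card normal_orth assms in auto)

definition grad_coord :: "(real^'n \<Rightarrow> real^'m) \<Rightarrow> (real^'m \<Rightarrow> real) \<Rightarrow> real^'n \<Rightarrow> real^'m" where
  "grad_coord F f \<theta> = (\<Sum>i\<in>UNIV. \<Sum>j\<in>UNIV.
     (matrix_inv (induced_metric F \<theta>) $ i $ j * pd i (f \<circ> F) \<theta>) *\<^sub>R pd j F \<theta>)"

lemma grad_coord_lift:
  assumes "atlas U F" "\<theta> \<in> U"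
  shows "grad_coord F f \<theta> = normal_frame.lift (\<lambda>i. pd i F \<theta>) (\<lambda>i. pd i (f \<circ> F) \<theta>)"
  by (simp add: grad_coord_def normal_frame.lift_def[OF chart_frame[OF assms]]
      normal_frame.gram_inv_def[OF chart_frame[OF assms]] induced_metric_def)

text \<open>The chain rule along a chart: tangential derivatives of an extension depend on
  \<open>f\<close> alone, which is what makes the tangential gradient independent of the
  extension.\<close>

lemma extension_tangential:
  assumes a: "atlas U F" "\<theta> \<in> U" and E: "\<forall>y\<in>S. E y = f y" "E differentiable (at (F \<theta>))"
  shows "(f \<circ> F) differentiable (at \<theta>)"
    and "gradient E (F \<theta>) \<bullet> pd i F \<theta> = pd i (f \<circ> F) \<theta>"
proof -
  let ?E = "frechet_derivative E (at (F \<theta>))"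
  have "(E has_derivative ?E) (at (F \<theta>))" using E(2) by (simp add: frechet_derivative_works[symmetric])
  from has_derivative_compose[OF chart_derivative[OF a] this]
  have D: "((f \<circ> F) has_derivative (\<lambda>v. ?E (frechet_derivative F (at \<theta>) v))) (at \<theta>)"
    by (rule has_derivative_transform_within_open[OF _ chart_open[OF a(1)] a(2)])
      (use E(1) chart_sub[OF a(1)] in auto)
  then show "(f \<circ> F) differentiable (at \<theta>)" by (rule differentiableI)
  show "gradient E (F \<theta>) \<bullet> pd i F \<theta> = pd i (f \<circ> F) \<theta>"
    unfolding pd_eq[OF D] pd_def[symmetric] frechet_derivative_pd[OF E(2)]
    by (simp add: gradient_def inner_vec_def mult.commute)
qed

lemma tan_grad_unique:
  assumes a: "atlas U F" "\<theta> \<in> U" and E: "\<forall>y\<in>S. E y = f y" "E differentiable (at (F \<theta>))"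
  shows "gradient E (F \<theta>) - (\<nu> (F \<theta>) \<bullet> gradient E (F \<theta>)) *\<^sub>R \<nu> (F \<theta>) = grad_coord F f \<theta>"
proof -
  interpret normal_frame "\<lambda>i. pd i F \<theta>" "\<nu> (F \<theta>)" by (rule chart_frame[OF a])
  show ?thesis
    by (rule frame_eqI)
      (simp_all add: grad_coord_lift[OF a] lift_tangent lift_normal inner_diff_left orth unit
        extension_tangential(2)[OF a E] inner_commute[of "\<nu> (F \<theta>)" "gradient E (F \<theta>)"])
qed

text \<open>The inverse of the chart is differentiable within the chart image, so \<open>f\<close>
  is too, being \<open>f \<circ> F\<close> composed with that inverse. Since the image is relatively
  open, this is differentiability within \<open>S\<close>, and only values off \<open>S\<close>
  remain to be chosen.\<close>

lemma extension_exists: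
  assumes a: "atlas U F" "\<theta> \<in> U" and f: "(f \<circ> F) differentiable (at \<theta>)"
  shows "\<exists>E. (\<forall>y\<in>S. E y = f y) \<and> E differentiable (at (F \<theta>))"
proof -
  let ?D = "frechet_derivative F (at \<theta>)" and ?p = "F \<theta>"
  obtain C where C: "homeomorphism U (F ` U) F C" using chart_homeo[OF a(1)] by blast
  have lin: "linear ?D" using chart_derivative[OF a] has_derivative_linear by blast
  obtain g' where g': "linear g'" "g' \<circ> ?D = id"
    using linear_injective_left_inverse[OF lin chart_inj[OF a]] by blast
  then have "bounded_linear g'" "\<And>v. g' (?D v) = v"
    by (auto simp: linear_conv_bounded_linear fun_eq_iff)
  then have "(C has_derivative g') (at ?p within F ` U)"
    using C by (intro has_derivative_inverse_within[OF chart_derivative[OF a] a(2)])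
      (auto simp: homeomorphism_def)
  moreover have Cp: "C ?p = \<theta>" using C a(2) by (auto simp: homeomorphism_def)
  moreover obtain l where "((f \<circ> F) has_derivative l) (at \<theta>)" using f by (auto simp: differentiable_def)
  ultimately have "((\<lambda>y. (f \<circ> F) (C y)) has_derivative (\<lambda>v. l (g' v))) (at ?p within F ` U)"
    using has_derivative_compose[of C g' ?p "F ` U" "f \<circ> F" l] by simp
  then have "(f has_derivative (\<lambda>v. l (g' v))) (at ?p within F ` U)"
    by (rule has_derivative_transform[rotated 2]) (use C a(2) in \<open>auto simp: homeomorphism_def\<close>)
  moreover obtain V where V: "open V" "F ` U = S \<inter> V"
    using chart_openin[OF a(1)] by (auto simp: openin_open)
  moreover have "at ?p within F ` U = at ?p within S"
    using V a(2) by (intro at_within_nhd[OF _ V(1)]) auto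
  ultimately have D: "(f has_derivative (\<lambda>v. l (g' v))) (at ?p within S)" by simp
  \<comment> \<open>Only differentiability at the single point \<open>?p\<close> is required, so the affine function serves off \<open>S\<close>.\<close>
  define E where "E y = (if y \<in> S then f y else f ?p + l (g' (y - ?p)))" for y
  have lg: "linear (\<lambda>v. l (g' v))" using D has_derivative_linear by blast
  have "(E has_derivative (\<lambda>v. l (g' v))) (at ?p)"
    unfolding has_derivative_at_alt
  proof (intro conjI allI impI)
    show "bounded_linear (\<lambda>v. l (g' v))" using D has_derivative_bounded_linear by blast
    fix e :: real
    assume e: "0 < e"
    obtain d where d: "0 < d"
      "\<And>y. y \<in> S \<Longrightarrow> norm (y - ?p) < d \<Longrightarrow> norm (f y - f ?p - l (g' (y - ?p))) \<le> e * norm (y - ?p)"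
      using D e unfolding has_derivative_within_alt by blast
    have "norm (E y - E ?p - l (g' (y - ?p))) \<le> e * norm (y - ?p)" if "norm (y - ?p) < d" for y
      using d(2)[OF _ that] e chart_sub[OF a] by (cases "y \<in> S") (auto simp: E_def)
    then show "\<exists>d>0. \<forall>y. norm (y - ?p) < d \<longrightarrow> norm (E y - E ?p - l (g' (y - ?p))) \<le> e * norm (y - ?p)"
      using d(1) by blast
  qed
  then have "E differentiable (at ?p)" by (rule differentiableI)
  moreover have "\<forall>y\<in>S. E y = f y" by (simp add: E_def)
  ultimately show ?thesis by blast
qed

lemma tan_grad_chart:
  assumes "atlas U F" "\<theta> \<in> U" "(f \<circ> F) differentiable (at \<theta>)"
  shows "tan_grad S \<nu> f (F \<theta>) = grad_coord F f \<theta>"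
  unfolding tan_grad_def
proof (rule the_equality)
  obtain E where E: "\<forall>y\<in>S. E y = f y" "E differentiable (at (F \<theta>))"
    using extension_exists[OF assms] by blast
  show "\<exists>E. (\<forall>y\<in>S. E y = f y) \<and> E differentiable (at (F \<theta>)) \<and>
      grad_coord F f \<theta> = gradient E (F \<theta>) - (\<nu> (F \<theta>) \<bullet> gradient E (F \<theta>)) *\<^sub>R \<nu> (F \<theta>)"
    using E tan_grad_unique[OF assms(1,2) E] by auto
next
  fix d
  assume "\<exists>E. (\<forall>y\<in>S. E y = f y) \<and> E differentiable (at (F \<theta>)) \<and>
      d = gradient E (F \<theta>) - (\<nu> (F \<theta>) \<bullet> gradient E (F \<theta>)) *\<^sub>R \<nu> (F \<theta>)"
  then show "d = grad_coord F f \<theta>"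
    using tan_grad_unique[OF assms(1,2)] by blast
qed

lemma grad_coord_tangent:
  assumes "atlas U F" "\<theta> \<in> U"
  shows "grad_coord F f \<theta> \<bullet> pd k F \<theta> = pd k (f \<circ> F) \<theta>" "grad_coord F f \<theta> \<bullet> \<nu> (F \<theta>) = 0"
proof -
  interpret normal_frame "\<lambda>i. pd i F \<theta>" "\<nu> (F \<theta>)" by (rule chart_frame[OF assms])
  show "grad_coord F f \<theta> \<bullet> pd k F \<theta> = pd k (f \<circ> F) \<theta>" "grad_coord F f \<theta> \<bullet> \<nu> (F \<theta>) = 0"
    by (simp_all add: grad_coord_lift[OF assms] lift_tangent lift_normal)
qed

section \<open>Functions of class C^1 on the surface\<close>

lemma metric_C1: "atlas U F \<Longrightarrow> C1_on U (\<lambda>\<theta>. induced_metric F \<theta> $ i $ j)"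
  unfolding induced_metric_def vec_lambda_beta by (intro C1_inner chart_pd_C1 chart_open)

lemma metric_inv_C1: 
  assumes "atlas U F"
  shows "C1_on U (\<lambda>\<theta>. matrix_inv (induced_metric F \<theta>) $ i $ j)"
  using chart_det_pos[OF assms]
  by (intro C1_matrix_inv[OF chart_open[OF assms] metric_C1[OF assms]]) force

lemma at_chart:
  assumes "atlas U F" "\<theta> \<in> U"
  shows "at (F \<theta>) within F ` U = at (F \<theta>) within S"
proof -
  obtain V where V: "open V" "F ` U = S \<inter> V"
    using chart_openin[OF assms(1)] by (auto simp: openin_open)
  then show ?thesis using assms(2) by (intro at_within_nhd[OF _ V(1)]) auto
qed

lemma continuous_on_chartsI:
  assumes "\<And>U F. atlas U F \<Longrightarrow> continuous_on U (\<lambda>\<theta>. g (F \<theta>))"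
  shows "continuous_on S g"
  unfolding continuous_on_eq_continuous_within
proof
  fix p
  assume "p \<in> S"
  then obtain U F \<theta> where a: "atlas U F" "\<theta> \<in> U" and p: "p = F \<theta>" using cover by blast
  obtain C where C: "homeomorphism U (F ` U) F C" using chart_homeo[OF a(1)] by blast
  have "continuous_on (F ` U) (\<lambda>y. g (F (C y)))"
    by (rule continuous_on_compose2[OF assms[OF a(1)]]) (use C in \<open>auto simp: homeomorphism_def\<close>)
  then have "continuous_on (F ` U) g"
    by (rule continuous_on_eq) (use C in \<open>auto simp: homeomorphism_def\<close>)
  then have "continuous (at p within F ` U) g"
    using a(2) by (auto simp: continuous_on_eq_continuous_within p)
  then show "continuous (at p within S) g"
    unfolding p at_chart[OF a] .
qed

lemma chart_continuous: "atlas U F \<Longrightarrow> continuous_on S g \<Longrightarrow> continuous_on U (\<lambda>\<theta>. g (F \<theta>))"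
  by (rule continuous_on_compose2[where t = S]) (use chart_sub C1_continuous chart_C1 in blast)+

text \<open>In one direction the partial derivatives of \<open>f \<circ> F\<close> are the inner
  products of the tangential gradient with the coordinate vectors; in the other the coordinate
  formula of the gradient is continuous. From here on regularity is checked chart by chart.\<close>

lemma C1_surface_iff:
  "C1_surface S \<nu> f \<longleftrightarrow> (\<forall>U F. atlas U F \<longrightarrow> C1_on U (f \<circ> F))"
proof
  assume L: "C1_surface S \<nu> f"
  show "\<forall>U F. atlas U F \<longrightarrow> C1_on U (f \<circ> F)"
  proof (intro allI impI)
    fix U F
    assume a: "atlas U F"
    have d: "(f \<circ> F) differentiable (at \<theta>)" if "\<theta> \<in> U" for \<theta>
      using L extension_tangential(1)[OF a that] chart_sub[OF a that] unfolding C1_surface_def by blast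
    have "continuous_on U (\<lambda>\<theta>. tan_grad S \<nu> f (F \<theta>) \<bullet> pd i F \<theta>)" for i
      using L by (intro continuous_on_inner chart_continuous[OF a, of "tan_grad S \<nu> f"]
          C1_continuous[OF chart_pd_C1[OF a]]) (simp add: C1_surface_def)
    then have "continuous_on U (pd i (f \<circ> F))" for i
      by (rule continuous_on_eq) (simp add: tan_grad_chart[OF a _ d] grad_coord_tangent[OF a])
    then show "C1_on U (f \<circ> F)"
      using d by (simp add: C1_on_iff differentiable_at_imp_differentiable_on)
  qed
next
  assume R: "\<forall>U F. atlas U F \<longrightarrow> C1_on U (f \<circ> F)"
  have d: "(f \<circ> F) differentiable (at \<theta>)" if "atlas U F" "\<theta> \<in> U" for U F \<theta>
    using R that chart_open C1_differentiable by blast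
  show "C1_surface S \<nu> f"
    unfolding C1_surface_def
  proof (intro conjI ballI)
    show "\<exists>E. (\<forall>y\<in>S. E y = f y) \<and> E differentiable (at p)" if "p \<in> S" for p
      using cover[OF that] extension_exists d by blast
    show "continuous_on S (tan_grad S \<nu> f)"
    proof (rule continuous_on_chartsI)
      fix U F
      assume a: "atlas U F"
      have "continuous_on U (grad_coord F f)"
        unfolding grad_coord_def
        by (intro continuous_intros C1_continuous[OF metric_inv_C1[OF a]]
            C1_continuous[OF chart_pd_C1[OF a]] C1_continuous_pd R[rule_format, OF a])
      then show "continuous_on U (\<lambda>\<theta>. tan_grad S \<nu> f (F \<theta>))"
        by (rule continuous_on_eq) (simp add: tan_grad_chart[OF a _ d[OF a]])
    qed
  qed
qed

lemma C1_surface_differentiable: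
  "C1_surface S \<nu> f \<Longrightarrow> atlas U F \<Longrightarrow> \<theta> \<in> U \<Longrightarrow> (f \<circ> F) differentiable (at \<theta>)"
  using C1_surface_iff chart_open C1_differentiable by blast

lemma tan_grad_C1:
  "C1_surface S \<nu> f \<Longrightarrow> atlas U F \<Longrightarrow> \<theta> \<in> U \<Longrightarrow> tan_grad S \<nu> f (F \<theta>) = grad_coord F f \<theta>"
  by (intro tan_grad_chart C1_surface_differentiable)

lemma tan_grad_continuous: "C1_surface S \<nu> f \<Longrightarrow> continuous_on S (tan_grad S \<nu> f)"
  by (simp add: C1_surface_def)

lemma C1_surface_continuous:
  assumes "C1_surface S \<nu> f"
  shows "continuous_on S f"
proof (rule continuous_on_chartsI)
  show "continuous_on U (\<lambda>\<theta>. f (F \<theta>))" if "atlas U F" for U F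
    using assms that C1_continuous[of U "f \<circ> F"] by (simp add: C1_surface_iff o_def)
qed

lemma C1_surface_mult:
  "C1_surface S \<nu> f \<Longrightarrow> C1_surface S \<nu> g \<Longrightarrow> C1_surface S \<nu> (\<lambda>y. f y * g y)"
  unfolding C1_surface_iff o_def using C1_mult chart_open by blast

lemma tan_grad_mult:
  assumes "C1_surface S \<nu> f" "C1_surface S \<nu> g" "p \<in> S"
  shows "tan_grad S \<nu> (\<lambda>y. f y * g y) p = f p *\<^sub>R tan_grad S \<nu> g p + g p *\<^sub>R tan_grad S \<nu> f p"
proof -
  obtain U F \<theta> where a: "atlas U F" "\<theta> \<in> U" and p: "p = F \<theta>" using cover[OF assms(3)] by blast
  interpret normal_frame "\<lambda>i. pd i F \<theta>" "\<nu> (F \<theta>)" by (rule chart_frame[OF a])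
  have "pd i ((\<lambda>y. f y * g y) \<circ> F) \<theta> = f (F \<theta>) * pd i (g \<circ> F) \<theta> + g (F \<theta>) * pd i (f \<circ> F) \<theta>" for i
    using pd_mult[OF C1_surface_differentiable[OF assms(1) a] C1_surface_differentiable[OF assms(2) a]]
    by (simp add: o_def)
  then show ?thesis
    unfolding p tan_grad_C1[OF assms(1) a] tan_grad_C1[OF assms(2) a]
      tan_grad_C1[OF C1_surface_mult[OF assms(1,2)] a]
    by (intro frame_eqI) (simp_all add: grad_coord_tangent[OF a] inner_add_left)
qed

text \<open>Row \<kappa> of the projection is the tangential part of the axis vector \<kappa>,
  expanded in the coordinate frame.\<close>

lemma projection_chart:
  assumes a: "atlas U F" "\<theta> \<in> U"
  shows "projection \<nu> (F \<theta>) $ \<kappa> $ \<beta> = (\<Sum>i\<in>UNIV. \<Sum>j\<in>UNIV.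
    matrix_inv (induced_metric F \<theta>) $ i $ j * pd i F \<theta> $ \<kappa> * pd j F \<theta> $ \<beta>)"
proof -
  interpret normal_frame "\<lambda>i. pd i F \<theta>" "\<nu> (F \<theta>)" by (rule chart_frame[OF a])
  have "axis \<kappa> 1 $ \<beta> = (lift (\<lambda>i. axis \<kappa> 1 \<bullet> pd i F \<theta>) + (axis \<kappa> 1 \<bullet> \<nu> (F \<theta>)) *\<^sub>R \<nu> (F \<theta>)) $ \<beta>"
    using frame_expand[of "axis \<kappa> 1"] by simp
  moreover have m: "mat 1 $ \<kappa> $ \<beta> = axis \<kappa> (1::real) $ \<beta>" by (simp add: mat_def axis_def)
  moreover have l: "lift (\<lambda>i. axis \<kappa> 1 \<bullet> pd i F \<theta>) $ \<beta> = (\<Sum>i\<in>UNIV. \<Sum>j\<in>UNIV.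
    matrix_inv (induced_metric F \<theta>) $ i $ j * pd i F \<theta> $ \<kappa> * pd j F \<theta> $ \<beta>)"
    by (simp add: lift_def gram_inv_def induced_metric_def inner_axis')
  ultimately show ?thesis
    by (simp add: projection_def outer_def inner_axis')
qed

lemma normal_C1:
  assumes a: "atlas U F"
  shows "C1_on U (\<lambda>\<theta>. \<nu> (F \<theta>) $ \<kappa>)"
proof (rule C1_local)
  fix \<theta>\<^sub>0
  assume \<theta>\<^sub>0: "\<theta>\<^sub>0 \<in> U"
  \<comment> \<open>\<open>N\<close> is the normal part of the constant vector \<open>n\<close>, of class $C^1$ since the tangential part is;
    near \<open>\<theta>\<^sub>0\<close> it is a positive multiple of \<open>\<nu>\<close>.\<close>
  define n where "n = \<nu> (F \<theta>\<^sub>0)"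
  define N where "N \<theta> = n - (\<Sum>i\<in>UNIV. \<Sum>j\<in>UNIV.
    (matrix_inv (induced_metric F \<theta>) $ i $ j * (n \<bullet> pd i F \<theta>)) *\<^sub>R pd j F \<theta>)" for \<theta>
  define V where "V = {\<theta> \<in> U. 0 < n \<bullet> \<nu> (F \<theta>)}"
  have U: "open U" by (rule chart_open[OF a])
  have "continuous_on U (\<lambda>\<theta>. n \<bullet> \<nu> (F \<theta>))"
    by (intro continuous_intros chart_continuous[OF a normal_cont])
  then have "open (U \<inter> (\<lambda>\<theta>. n \<bullet> \<nu> (F \<theta>)) -` {0<..})"
    using U by (intro continuous_open_preimage) auto
  moreover have "U \<inter> (\<lambda>\<theta>. n \<bullet> \<nu> (F \<theta>)) -` {0<..} = V" by (auto simp: V_def)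
  ultimately have V: "open V" by simp
  have VU: "V \<subseteq> U" by (auto simp: V_def)
  have "\<theta>\<^sub>0 \<in> V"
    using normal_unit[OF chart_sub[OF a \<theta>\<^sub>0]] \<theta>\<^sub>0 by (simp add: V_def n_def norm_eq_1)
  have N: "N \<theta> = (n \<bullet> \<nu> (F \<theta>)) *\<^sub>R \<nu> (F \<theta>)" if "\<theta> \<in> U" for \<theta>
  proof -
    interpret normal_frame "\<lambda>i. pd i F \<theta>" "\<nu> (F \<theta>)" by (rule chart_frame[OF a that])
    have "n - lift (\<lambda>i. n \<bullet> pd i F \<theta>) = (n \<bullet> \<nu> (F \<theta>)) *\<^sub>R \<nu> (F \<theta>)"
      using frame_expand[of n] by (metis add_diff_cancel_left')
    then show ?thesis by (simp add: N_def lift_def gram_inv_def induced_metric_def)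
  qed
  have Nn: "N \<theta> \<bullet> n = (n \<bullet> \<nu> (F \<theta>))\<^sup>2" if "\<theta> \<in> U" for \<theta>
    by (simp add: N[OF that] power2_eq_square inner_commute)
  have NC: "C1_on V (\<lambda>\<theta>. N \<theta> $ k)" for k
  proof (rule C1_on_subset[OF _ VU])
    have "C1_on U (\<lambda>\<theta>. n $ k - (\<Sum>i\<in>UNIV. \<Sum>j\<in>UNIV.
        matrix_inv (induced_metric F \<theta>) $ i $ j * (n \<bullet> pd i F \<theta>) * pd j F \<theta> $ k))"
      by (intro C1_minus C1_const C1_sum C1_mult C1_inner C1_vec_nth metric_inv_C1 chart_pd_C1 U a)
    then show "C1_on U (\<lambda>\<theta>. N \<theta> $ k)" by (simp add: N_def)
  qed
  have Ni: "C1_on V (\<lambda>\<theta>. N \<theta> \<bullet> n)"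
    unfolding inner_vec_def inner_real_def by (intro C1_sum C1_mult C1_const NC V)
  have pos: "0 < N \<theta> \<bullet> n" if "\<theta> \<in> V" for \<theta> using that by (simp add: V_def Nn)
  \<comment> \<open>The inner product of \<open>N \<theta>\<close> with \<open>n\<close> is the
    square of that of \<nu> with \<open>n\<close>. On \<open>V\<close> the latter is positive, so
    the root is exactly the factor between \<open>N\<close> and \<nu>.\<close>
  have "C1_on V (\<lambda>\<theta>. N \<theta> $ \<kappa> / sqrt (N \<theta> \<bullet> n))"
    by (intro C1_divide C1_sqrt NC V Ni) (use pos in force)+
  then have "C1_on V (\<lambda>\<theta>. \<nu> (F \<theta>) $ \<kappa>)"
    by (rule C1_cong[OF V]) (auto simp: V_def Nn, simp add: N)
  then show "\<exists>V. open V \<and> \<theta>\<^sub>0 \<in> V \<and> V \<subseteq> U \<and> C1_on V (\<lambda>\<theta>. \<nu> (F \<theta>) $ \<kappa>)"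
    using V VU \<open>\<theta>\<^sub>0 \<in> V\<close> by blast
qed

lemma normal_C1_surface: "C1_surface S \<nu> (\<lambda>y. \<nu> y $ \<kappa>)"
  by (simp add: C1_surface_iff o_def normal_C1)

section \<open>Divergence of weighted tangential matrix fields\<close>

definition surface_div :: "(real^'m \<Rightarrow> real^'m^'m) \<Rightarrow> real^'m \<Rightarrow> real^'m" where
  "surface_div \<Phi> p = (\<chi> \<kappa>. \<Sum>\<beta>\<in>UNIV. tan_grad S \<nu> (\<lambda>y. \<Phi> y $ \<kappa> $ \<beta>) p $ \<beta>)"

text \<open>Row \<kappa> of \<Phi> is a tangential field with components
  \<open>?w \<xi> * b j \<xi>\<close>. Its divergence consists of the derivatives of these
  components and of the components times \<open>T j\<close>, the logarithmic derivative of the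
  induced density. That density stands in the denominator of \<open>?w\<close>, so its derivative
  cancels \<open>T j\<close>; the derivatives of sqrt(det g), of the inverse metric and of the
  coordinate vectors remain and form the Laplacian.\<close>

lemma surface_div_chart:
  fixes g :: "real^'n \<Rightarrow> real^'n^'n"
  assumes a: "atlas U F" and \<theta>: "\<theta> \<in> U"
    and g_C1: "\<And>i j. C1_on U (\<lambda>\<theta>. g \<theta> $ i $ j)"
    and g_sym: "\<And>\<theta> i j. \<theta> \<in> U \<Longrightarrow> g \<theta> $ i $ j = g \<theta> $ j $ i"
    and g_pos: "\<And>\<theta>. \<theta> \<in> U \<Longrightarrow> 0 < det (g \<theta>)"
    and \<Phi>: "\<And>\<theta> \<kappa> \<beta>. \<theta> \<in> U \<Longrightarrow> \<Phi> (F \<theta>) $ \<kappa> $ \<beta> =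
      sqrt (det (g \<theta>)) / sqrt (det (induced_metric F \<theta>)) *
      (\<Sum>i\<in>UNIV. \<Sum>j\<in>UNIV. matrix_inv (g \<theta>) $ i $ j * pd i F \<theta> $ \<kappa> * pd j F \<theta> $ \<beta>)"
  shows "surface_div \<Phi> (F \<theta>) =
    (sqrt (det (g \<theta>)) / sqrt (det (induced_metric F \<theta>))) *\<^sub>R laplacian g F \<theta>"
proof -
  have U: "open U" by (rule chart_open[OF a])
  note diff = C1_differentiable[OF _ U \<theta>]
  let ?w = "\<lambda>\<xi>. sqrt (det (g \<xi>)) / sqrt (det (induced_metric F \<xi>))"
  let ?q = "\<lambda>i j. matrix_inv (g \<theta>) $ i $ j"
  let ?Q = "\<lambda>i j. matrix_inv (induced_metric F \<theta>) $ i $ j"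
  let ?d = "\<lambda>l i j. pd l (\<lambda>\<xi>. g \<xi> $ i $ j) \<theta>"
  let ?F2 = "\<lambda>i j. pd i (pd j F) \<theta>"
  have q_sym: "?q i j = ?q j i" for i j
    using g_pos[OF \<theta>] g_sym[OF \<theta>] by (intro matrix_inv_symmetric) auto
  have Q_sym: "?Q i j = ?Q j i" for i j
    using chart_det_pos[OF a \<theta>] by (intro matrix_inv_symmetric) (auto simp: induced_metric_def inner_commute)
  have w_C1: "C1_on U ?w"
    by (intro C1_divide C1_sqrt C1_det U g_C1 metric_C1[OF a])
      (use g_pos chart_det_pos[OF a] in force)+
  have q_C1: "C1_on U (\<lambda>\<xi>. matrix_inv (g \<xi>) $ i $ j)" for i j
    by (intro C1_matrix_inv[OF U g_C1]) (use g_pos in force)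
  \<comment> \<open>\<open>T j\<close> is the contracted Christoffel symbol of the induced metric.
    Its equality with the half trace from Jacobi's formula rests on the symmetry of the second
    derivatives of \<open>F\<close>.\<close>
  define T where "T j = (\<Sum>k\<in>UNIV. \<Sum>l\<in>UNIV. ?Q k l * (?F2 k j \<bullet> pd l F \<theta>))" for j
  have T: "(\<Sum>k\<in>UNIV. \<Sum>l\<in>UNIV. ?Q k l * pd j (\<lambda>\<xi>. induced_metric F \<xi> $ l $ k) \<theta>) / 2 = T j" for j
  proof -
    have "pd j (\<lambda>\<xi>. induced_metric F \<xi> $ l $ k) \<theta> =
        pd l F \<theta> \<bullet> ?F2 j k + ?F2 j l \<bullet> pd k F \<theta>" for l k
      unfolding induced_metric_def vec_lambda_beta by (intro pd_inner diff chart_pd_C1[OF a])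
    then have "pd j (\<lambda>\<xi>. induced_metric F \<xi> $ l $ k) \<theta> =
        ?F2 k j \<bullet> pd l F \<theta> + ?F2 l j \<bullet> pd k F \<theta>" for l k
      by (simp add: pd_commute[OF U chart_C2[OF a] \<theta>, of j] inner_commute)
    then have "(\<Sum>k\<in>UNIV. \<Sum>l\<in>UNIV. ?Q k l * pd j (\<lambda>\<xi>. induced_metric F \<xi> $ l $ k) \<theta>) =
      T j + (\<Sum>k\<in>UNIV. \<Sum>l\<in>UNIV. ?Q k l * (?F2 l j \<bullet> pd k F \<theta>))"
      by (simp add: T_def distrib_left sum.distrib)
    also have "(\<Sum>k\<in>UNIV. \<Sum>l\<in>UNIV. ?Q k l * (?F2 l j \<bullet> pd k F \<theta>)) = T j"
      unfolding T_def by (subst sum.swap, intro sum.cong refl) (simp add: Q_sym)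
    finally show ?thesis by simp
  qed
  have "surface_div \<Phi> (F \<theta>) $ \<kappa> = (?w \<theta> *\<^sub>R laplacian g F \<theta>) $ \<kappa>" for \<kappa>
  proof -
    define b where "b j \<xi> = (\<Sum>i\<in>UNIV. matrix_inv (g \<xi>) $ i $ j * pd i F \<xi> $ \<kappa>)" for j \<xi>
    have F_C1: "C1_on U (\<lambda>\<xi>. pd i F \<xi> $ k)" for i k
      by (intro C1_vec_nth U chart_pd_C1[OF a])
    have b_C1: "C1_on U (b j)" for j
      unfolding b_def by (intro C1_sum C1_mult U q_C1 F_C1)
    have pd_F: "pd k (\<lambda>\<xi>. pd i F \<xi> $ \<beta>) \<theta> = ?F2 k i $ \<beta>" for k i \<beta>
      by (intro pd_vec_nth diff chart_pd_C1[OF a])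
    define p where "p k j = pd k (\<lambda>\<xi>. ?w \<xi> * b j \<xi>) \<theta>" for k j
    have \<Phi>b: "\<Phi> (F \<xi>) $ \<kappa> $ \<beta> = (\<Sum>j\<in>UNIV. (?w \<xi> * b j \<xi>) * pd j F \<xi> $ \<beta>)" if "\<xi> \<in> U" for \<xi> \<beta>
      unfolding \<Phi>[OF that] b_def sum_distrib_left sum_distrib_right
      by (subst sum.swap) (simp add: mult_ac)
    have \<Phi>_C1: "C1_on U ((\<lambda>y. \<Phi> y $ \<kappa> $ \<beta>) \<circ> F)" for \<beta>
    proof (rule C1_cong[OF U])
      show "C1_on U (\<lambda>\<xi>. \<Sum>j\<in>UNIV. (?w \<xi> * b j \<xi>) * pd j F \<xi> $ \<beta>)"
        by (intro C1_sum C1_mult U b_C1 w_C1 F_C1)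
    qed (simp add: \<Phi>b)
    have pd_\<Phi>: "pd k ((\<lambda>y. \<Phi> y $ \<kappa> $ \<beta>) \<circ> F) \<theta> =
        (\<Sum>j\<in>UNIV. (?w \<theta> * b j \<theta>) * ?F2 k j $ \<beta> + pd j F \<theta> $ \<beta> * p k j)" for k \<beta>
    proof -
      have "pd k ((\<lambda>y. \<Phi> y $ \<kappa> $ \<beta>) \<circ> F) \<theta> = pd k (\<lambda>\<xi>. \<Sum>j\<in>UNIV. (?w \<xi> * b j \<xi>) * pd j F \<xi> $ \<beta>) \<theta>"
        by (rule pd_cong[OF U \<theta>]) (simp add: \<Phi>b)
      also have "\<dots> = (\<Sum>j\<in>UNIV. pd k (\<lambda>\<xi>. (?w \<xi> * b j \<xi>) * pd j F \<xi> $ \<beta>) \<theta>)"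
        by (intro pd_sum diff C1_mult U w_C1 b_C1 F_C1)
      also have "\<dots> = (\<Sum>j\<in>UNIV. (?w \<theta> * b j \<theta>) * ?F2 k j $ \<beta> + pd j F \<theta> $ \<beta> * p k j)"
      proof (rule sum.cong[OF refl])
        fix j
        show "pd k (\<lambda>\<xi>. (?w \<xi> * b j \<xi>) * pd j F \<xi> $ \<beta>) \<theta> =
            (?w \<theta> * b j \<theta>) * ?F2 k j $ \<beta> + pd j F \<theta> $ \<beta> * p k j"
          using pd_mult[OF diff[OF C1_mult[OF U w_C1 b_C1[of j]]] diff[OF F_C1[of j \<beta>]], of k]
          by (simp only: pd_F p_def)
      qed
      finally show ?thesis .
    qed
    have "surface_div \<Phi> (F \<theta>) $ \<kappa> = (\<Sum>\<beta>\<in>UNIV. \<Sum>k\<in>UNIV. \<Sum>l\<in>UNIV. \<Sum>j\<in>UNIV.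
        (?w \<theta> * b j \<theta>) * (?Q k l * (?F2 k j $ \<beta> * pd l F \<theta> $ \<beta>))
        + ?Q k l * (pd l F \<theta> $ \<beta> * pd j F \<theta> $ \<beta>) * p k j)"
      by (simp add: surface_div_def tan_grad_chart[OF a \<theta> diff[OF \<Phi>_C1]] grad_coord_def pd_\<Phi>
          sum_distrib_left sum_distrib_right) (simp add: algebra_simps)
    also have "\<dots> = (\<Sum>k\<in>UNIV. \<Sum>l\<in>UNIV. \<Sum>j\<in>UNIV. \<Sum>\<beta>\<in>UNIV.
        (?w \<theta> * b j \<theta>) * (?Q k l * (?F2 k j $ \<beta> * pd l F \<theta> $ \<beta>))
        + ?Q k l * (pd l F \<theta> $ \<beta> * pd j F \<theta> $ \<beta>) * p k j)"
      by (subst sum.swap, rule sum.cong[OF refl], subst sum.swap, rule sum.cong[OF refl], rule sum.swap)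
    also have "\<dots> = (\<Sum>k\<in>UNIV. \<Sum>l\<in>UNIV. \<Sum>j\<in>UNIV.
        (?w \<theta> * b j \<theta>) * (?Q k l * (?F2 k j \<bullet> pd l F \<theta>)) + ?Q k l * (pd l F \<theta> \<bullet> pd j F \<theta>) * p k j)"
      by (simp add: sum.distrib inner_vec_def sum_distrib_left sum_distrib_right)
    also have "\<dots> = (\<Sum>j\<in>UNIV. \<Sum>k\<in>UNIV. \<Sum>l\<in>UNIV.
        (?w \<theta> * b j \<theta>) * (?Q k l * (?F2 k j \<bullet> pd l F \<theta>)) + ?Q k l * (pd l F \<theta> \<bullet> pd j F \<theta>) * p k j)"
      by (rule trans[OF sum.cong[OF refl sum.swap] sum.swap])
    also have "\<dots> = (\<Sum>j\<in>UNIV. (?w \<theta> * b j \<theta>) * T j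
        + (\<Sum>k\<in>UNIV. (\<Sum>l\<in>UNIV. ?Q k l * (pd l F \<theta> \<bullet> pd j F \<theta>)) * p k j))"
      by (simp add: T_def sum.distrib sum_distrib_left sum_distrib_right)
    \<comment> \<open>The induced metric contracted with its inverse selects the diagonal terms
      \<open>p j j\<close>.\<close>
    also have "\<dots> = (\<Sum>j\<in>UNIV. (?w \<theta> * b j \<theta>) * T j + p j j)"
    proof (rule sum.cong[OF refl])
      fix j
      have "(\<Sum>l\<in>UNIV. ?Q k l * (pd l F \<theta> \<bullet> pd j F \<theta>)) = (if k = j then 1 else 0)" for k
        using sum_matrix_inv(2)[of "induced_metric F \<theta>" k j] chart_det_pos[OF a \<theta>]
        by (simp add: induced_metric_def)
      then show "(?w \<theta> * b j \<theta>) * T j + (\<Sum>k\<in>UNIV. (\<Sum>l\<in>UNIV. ?Q k l * (pd l F \<theta> \<bullet> pd j F \<theta>)) * p k j) =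
          (?w \<theta> * b j \<theta>) * T j + p j j"
        by (simp add: if_distrib[of "\<lambda>c. c * _"] cong: if_cong)
    qed
    also have "\<dots> = (\<Sum>j\<in>UNIV. ?w \<theta> * (((\<Sum>a\<in>UNIV. \<Sum>b\<in>UNIV. ?q a b * ?d j b a) / 2) *
          (\<Sum>i\<in>UNIV. ?q i j * pd i F \<theta> $ \<kappa>)
        + (\<Sum>i\<in>UNIV. - (\<Sum>a\<in>UNIV. \<Sum>b\<in>UNIV. ?q i a * ?d j a b * ?q b j) * pd i F \<theta> $ \<kappa>)
        + (\<Sum>i\<in>UNIV. ?q i j * ?F2 j i $ \<kappa>)))"
    proof (rule sum.cong[OF refl])
      fix j
      \<comment> \<open>The minus sign in front of \<open>T j\<close> comes from the denominator of
        the weight; this is the term that cancels the one already present in the divergence.\<close>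
      have pw: "pd j ?w \<theta> = ?w \<theta> * ((\<Sum>a\<in>UNIV. \<Sum>b\<in>UNIV. ?q a b * ?d j b a) / 2 - T j)"
        unfolding T[symmetric]
        by (intro pd_sqrt_det_ratio diff g_C1 metric_C1[OF a] g_pos[OF \<theta>] chart_det_pos[OF a \<theta>])
      have pq: "pd j (\<lambda>\<xi>. matrix_inv (g \<xi>) $ i $ j) \<theta> =
          - (\<Sum>a\<in>UNIV. \<Sum>b\<in>UNIV. ?q i a * ?d j a b * ?q b j)" for i
        by (intro pd_matrix_inv diff g_C1) (use g_pos[OF \<theta>] in simp)
      have "pd j (b j) \<theta> = (\<Sum>i\<in>UNIV. pd j (\<lambda>\<xi>. matrix_inv (g \<xi>) $ i $ j * pd i F \<xi> $ \<kappa>) \<theta>)"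
        unfolding b_def by (intro pd_sum diff C1_mult U q_C1 F_C1)
      also have "\<dots> = (\<Sum>i\<in>UNIV. ?q i j * ?F2 j i $ \<kappa>
          + pd i F \<theta> $ \<kappa> * (- (\<Sum>a\<in>UNIV. \<Sum>b\<in>UNIV. ?q i a * ?d j a b * ?q b j)))"
        by (intro sum.cong refl) (simp only: pd_mult[OF diff[OF q_C1] diff[OF F_C1]] pd_F pq)
      finally have pb: "pd j (b j) \<theta> = (\<Sum>i\<in>UNIV. ?q i j * ?F2 j i $ \<kappa>)
        + (\<Sum>i\<in>UNIV. - (\<Sum>a\<in>UNIV. \<Sum>b\<in>UNIV. ?q i a * ?d j a b * ?q b j) * pd i F \<theta> $ \<kappa>)"
        by (simp only: sum.distrib mult.commute)
      have "p j j = ?w \<theta> * pd j (b j) \<theta> + b j \<theta> * pd j ?w \<theta>"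
        unfolding p_def by (intro pd_mult diff w_C1 b_C1)
      then show "(?w \<theta> * b j \<theta>) * T j + p j j = ?w \<theta> * (((\<Sum>a\<in>UNIV. \<Sum>b\<in>UNIV. ?q a b * ?d j b a) / 2) *
          (\<Sum>i\<in>UNIV. ?q i j * pd i F \<theta> $ \<kappa>)
        + (\<Sum>i\<in>UNIV. - (\<Sum>a\<in>UNIV. \<Sum>b\<in>UNIV. ?q i a * ?d j a b * ?q b j) * pd i F \<theta> $ \<kappa>)
        + (\<Sum>i\<in>UNIV. ?q i j * ?F2 j i $ \<kappa>))"
        unfolding pb pw b_def[of j \<theta>, symmetric] by (simp only: ring_distribs mult_ac)
    qed
    also have "\<dots> = ?w \<theta> * (- (\<Sum>i\<in>UNIV. \<Sum>j\<in>UNIV. ?q i j * (\<Sum>k\<in>UNIV. (1/2) * (\<Sum>l\<in>UNIV. ?q k l *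
        (?d i l j + ?d j l i - ?d l i j)) * pd k F \<theta> $ \<kappa>))
        + (\<Sum>j\<in>UNIV. \<Sum>i\<in>UNIV. ?q i j * ?F2 j i $ \<kappa>))"
      unfolding sum_distrib_left[symmetric] sum.distrib[of _ "\<lambda>j. \<Sum>i\<in>UNIV. ?q i j * ?F2 j i $ \<kappa>"]
      by (subst laplacian_algebra[OF q_sym]) (rule refl)
    also have "(\<Sum>j\<in>UNIV. \<Sum>i\<in>UNIV. ?q i j * ?F2 j i $ \<kappa>) = (\<Sum>j\<in>UNIV. \<Sum>i\<in>UNIV. ?q j i * ?F2 j i $ \<kappa>)"
      by (simp only: q_sym)
    also have "?w \<theta> * (- (\<Sum>i\<in>UNIV. \<Sum>j\<in>UNIV. ?q i j * (\<Sum>k\<in>UNIV. (1/2) * (\<Sum>l\<in>UNIV. ?q k l *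
        (?d i l j + ?d j l i - ?d l i j)) * pd k F \<theta> $ \<kappa>))
        + (\<Sum>j\<in>UNIV. \<Sum>i\<in>UNIV. ?q j i * ?F2 j i $ \<kappa>)) = (?w \<theta> *\<^sub>R laplacian g F \<theta>) $ \<kappa>"
      unfolding laplacian_def christoffel_def
      by (simp add: sum_subtractf right_diff_distrib)
    finally show ?thesis .
  qed
  then show ?thesis by (simp add: vec_eq_iff)
qed

end

section \<open>Weak tangential gradients\<close>

text \<open>The sigma-algebra of \<open>measure_of\<close> is determined by the generating sets,
  whatever the set function, so measurability for the Hausdorff measure is Borel
  measurability.\<close>

lemma sets_hausdorff [measurable_cong]: "sets (hausdorff d :: 'a::metric_space measure) = sets borel"
  unfolding hausdorff_def
  by (subst sets_measure_of) (auto simp: sets.sigma_sets_eq[of borel, simplified])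

section \<open>Integrability of components and of products with continuous functions\<close>

lemma bounded_linear_axis: "bounded_linear (axis i :: 'a::real_normed_vector \<Rightarrow> 'a^'n)"
proof
  show "axis i (b + b') = axis i b + axis i b'" for b b' :: 'a
    by (simp add: axis_def vec_eq_iff)
  show "axis i (r *\<^sub>R b) = r *\<^sub>R axis i b" for r and b :: 'a
    by (simp add: axis_def vec_eq_iff)
  have "norm (axis i b :: 'a^'n) \<le> norm b * 1" for b :: 'a
  proof -
    have "norm (axis i b :: 'a^'n) \<le> (\<Sum>j\<in>UNIV. norm (axis i b $ j))"
      unfolding norm_vec_def by (rule L2_set_le_sum) simp
    then show ?thesis by (simp add: axis_def if_distrib cong: if_cong)
  qed
  then show "\<exists>K. \<forall>b. norm (axis i b :: 'a^'n) \<le> norm b * K" by blast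
qed

lemma set_integrable_vec_iff:
  fixes f :: "'a \<Rightarrow> 'b::euclidean_space^'n"
  shows "set_integrable M S f \<longleftrightarrow> (\<forall>i. set_integrable M S (\<lambda>y. f y $ i))"
proof
  assume "set_integrable M S f"
  then show "\<forall>i. set_integrable M S (\<lambda>y. f y $ i)"
    unfolding set_integrable_def
    using integrable_bounded_linear[OF bounded_linear_vec_nth] by fastforce
next
  assume *: "\<forall>i. set_integrable M S (\<lambda>y. f y $ i)"
  have sum_axis: "(\<Sum>i\<in>UNIV. axis i (v $ i)) = v" for v :: "'b^'n"
    by (simp add: vec_eq_iff axis_def if_distrib cong: if_cong)
  have "(\<lambda>y. indicator S y *\<^sub>R f y) = (\<lambda>y. \<Sum>i\<in>UNIV. axis i (indicator S y *\<^sub>R f y $ i))"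
    by (simp only: vector_scaleR_component[symmetric] sum_axis)
  moreover have "integrable M (\<lambda>y. \<Sum>i\<in>UNIV. axis i (indicator S y *\<^sub>R f y $ i) :: 'b^'n)"
    using * unfolding set_integrable_def
    by (intro Bochner_Integration.integrable_sum integrable_bounded_linear[OF bounded_linear_axis]) auto
  ultimately show "set_integrable M S f" by (simp only: set_integrable_def)
qed

lemma set_integral_sum:
  fixes f :: "'i \<Rightarrow> 'a \<Rightarrow> real"
  assumes "\<And>i. i \<in> A \<Longrightarrow> set_integrable M S (f i)"
  shows "set_integrable M S (\<lambda>y. \<Sum>i\<in>A. f i y)"
    and "(LINT y:S|M. \<Sum>i\<in>A. f i y) = (\<Sum>i\<in>A. LINT y:S|M. f i y)"
  unfolding set_integrable_def set_lebesgue_integral_def scaleR_sum_right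
  by (intro Bochner_Integration.integrable_sum Bochner_Integration.integral_sum
      assms[unfolded set_integrable_def], assumption)+

lemma set_integrable_continuous_mult:
  fixes c f :: "'a::metric_space \<Rightarrow> real"
  assumes S: "compact S" and c: "continuous_on S c" and f: "set_integrable (hausdorff d) S f"
  shows "set_integrable (hausdorff d) S (\<lambda>y. c y * f y)"
proof -
  have bS: "S \<in> sets borel" by (intro borel_closed compact_imp_closed S)
  obtain B where B: "\<And>y. y \<in> S \<Longrightarrow> \<bar>c y\<bar> \<le> B"
    using compact_imp_bounded[OF compact_continuous_image[OF c S]] by (auto simp: bounded_iff)
  have cm: "(\<lambda>y. indicator S y *\<^sub>R c y) \<in> borel_measurable borel"
    by (rule borel_measurable_continuous_on_indicator[OF bS c])
  have fm: "(\<lambda>y. indicator S y *\<^sub>R f y) \<in> borel_measurable (hausdorff d)"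
    using f unfolding set_integrable_def by auto
  \<comment> \<open>Both factors are cut off, since \<open>c\<close> is controlled on
    \<open>S\<close> only; the product of the two indicators is the indicator again.\<close>
  have "(\<lambda>y. (indicator S y *\<^sub>R c y) * (indicator S y *\<^sub>R f y)) \<in> borel_measurable (hausdorff d)"
    using cm fm by (intro borel_measurable_times) (simp_all add: measurable_cong_sets[OF sets_hausdorff refl])
  moreover have "(\<lambda>y. (indicator S y *\<^sub>R c y) * (indicator S y *\<^sub>R f y)) = (\<lambda>y. indicator S y *\<^sub>R (c y * f y))"
    by (auto simp: indicator_def)
  ultimately have m: "(\<lambda>y. indicator S y *\<^sub>R (c y * f y)) \<in> borel_measurable (hausdorff d)" by simp
  show ?thesis
    unfolding set_integrable_def
  proof (rule Bochner_Integration.integrable_bound[OF _ m])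
    show "integrable (hausdorff d) (\<lambda>y. B * (indicator S y *\<^sub>R f y))"
      using f unfolding set_integrable_def by (rule integrable_mult_right)
    have "norm (indicator S y *\<^sub>R (c y * f y)) \<le> norm (B * (indicator S y *\<^sub>R f y))" for y
      using B[of y] order_trans[OF B[of y] abs_ge_self]
      by (auto simp: indicator_def abs_mult intro: mult_right_mono)
    then show "AE y in hausdorff d. norm (indicator S y *\<^sub>R (c y * f y)) \<le> norm (B * (indicator S y *\<^sub>R f y))"
      by simp
  qed
qed

lemma set_integrable_cong':
  "(\<And>y. y \<in> S \<Longrightarrow> f y = g y) \<Longrightarrow> set_integrable M S f \<longleftrightarrow> set_integrable M S g"
  by (intro set_integrable_cong refl)

lemma set_integral_cong':
  "(\<And>y. y \<in> S \<Longrightarrow> f y = g y) \<Longrightarrow> (LINT y:S|M. f y) = (LINT y:S|M. g y)"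
  unfolding set_lebesgue_integral_def by (intro Bochner_Integration.integral_cong refl) (auto simp: indicator_def)

text \<open>Two conditions, because the weak gradient asks for integrability and the Sobolev space
  for square integrability; on a set whose measure may be infinite neither implies the
  other.\<close>

definition L2_on :: "'a measure \<Rightarrow> 'a set \<Rightarrow> ('a \<Rightarrow> real) \<Rightarrow> bool" where
  "L2_on M S f \<longleftrightarrow> set_integrable M S f \<and> set_integrable M S (\<lambda>y. (f y)\<^sup>2)"

lemma set_integrable_measurable:
  fixes f :: "'a \<Rightarrow> real"
  shows "set_integrable M S f \<Longrightarrow> (\<lambda>y. indicator S y * f y) \<in> borel_measurable M"
  by (auto simp: set_integrable_def dest: borel_measurable_integrable)

lemma set_integrable_bound_real:
  fixes f g h :: "'a \<Rightarrow> real"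
  assumes "set_integrable M S g" "(\<lambda>y. indicator S y * f y) \<in> borel_measurable M"
    and "\<And>y. y \<in> S \<Longrightarrow> \<bar>f y\<bar> \<le> g y"
  shows "set_integrable M S f"
  unfolding set_integrable_def
  by (rule Bochner_Integration.integrable_bound[OF assms(1)[unfolded set_integrable_def]])
    (use assms(2,3) in \<open>force simp: indicator_def\<close>)+

lemma measurable_power2_indicator:
  fixes f :: "'a \<Rightarrow> real"
  assumes "(\<lambda>y. indicator S y * f y) \<in> borel_measurable M"
  shows "(\<lambda>y. indicator S y * (f y)\<^sup>2) \<in> borel_measurable M"
proof -
  have "(\<lambda>y. (indicator S y * f y)\<^sup>2) \<in> borel_measurable M" using assms by (rule borel_measurable_power)
  moreover have "(\<lambda>y. (indicator S y * f y)\<^sup>2) = (\<lambda>y. indicator S y * (f y)\<^sup>2)"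
    by (auto simp: indicator_def)
  ultimately show ?thesis by simp
qed

lemma L2_on_add:
  assumes "L2_on M S f" "L2_on M S g"
  shows "L2_on M S (\<lambda>y. f y + g y)"
proof -
  have i: "set_integrable M S (\<lambda>y. f y + g y)"
    using assms by (auto simp: L2_on_def)
  have "set_integrable M S (\<lambda>y. 2 * (f y)\<^sup>2 + 2 * (g y)\<^sup>2)"
    using assms by (auto simp: L2_on_def)
  then have "set_integrable M S (\<lambda>y. (f y + g y)\<^sup>2)"
  proof (rule set_integrable_bound_real)
    show "(\<lambda>y. indicator S y * (f y + g y)\<^sup>2) \<in> borel_measurable M"
      by (rule measurable_power2_indicator[OF set_integrable_measurable[OF i]])
    show "\<bar>(f y + g y)\<^sup>2\<bar> \<le> 2 * (f y)\<^sup>2 + 2 * (g y)\<^sup>2" for y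
    proof -
      have "(f y + g y)\<^sup>2 + (f y - g y)\<^sup>2 = 2 * (f y)\<^sup>2 + 2 * (g y)\<^sup>2"
        by (simp add: power2_eq_square algebra_simps)
      then have "(f y + g y)\<^sup>2 \<le> 2 * (f y)\<^sup>2 + 2 * (g y)\<^sup>2"
        using zero_le_power2[of "f y - g y"] by linarith
      then show ?thesis by simp
    qed
  qed
  with i show ?thesis by (simp add: L2_on_def)
qed

lemma L2_on_sum: "finite A \<Longrightarrow> A \<noteq> {} \<Longrightarrow> (\<And>i. i \<in> A \<Longrightarrow> L2_on M S (f i)) \<Longrightarrow> L2_on M S (\<lambda>y. \<Sum>i\<in>A. f i y)"
  by (induction A rule: finite_ne_induct) (auto intro: L2_on_add)

lemma L2_on_continuous_mult:
  fixes c f :: "'a::metric_space \<Rightarrow> real"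
  assumes "compact S" "continuous_on S c" "L2_on (hausdorff d) S f"
  shows "L2_on (hausdorff d) S (\<lambda>y. c y * f y)"
  using assms unfolding L2_on_def power_mult_distrib
  by (auto intro!: set_integrable_continuous_mult continuous_intros)

text \<open>The component type is left general so that the statement can be used twice for matrices,
  which are vectors of rows.\<close>

lemma set_integrable_norm_square_iff:
  fixes f :: "'a \<Rightarrow> 'b::euclidean_space^'n"
  assumes "set_integrable M S f"
  shows "set_integrable M S (\<lambda>y. (norm (f y))\<^sup>2) \<longleftrightarrow> (\<forall>i. set_integrable M S (\<lambda>y. (norm (f y $ i))\<^sup>2))"
proof
  have eq: "(norm v)\<^sup>2 = (\<Sum>i\<in>UNIV. (norm (v $ i))\<^sup>2)" for v :: "'b^'n"
    by (simp add: norm_vec_def L2_set_def sum_nonneg)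
  {
    assume sq: "set_integrable M S (\<lambda>y. (norm (f y))\<^sup>2)"
    show "\<forall>i. set_integrable M S (\<lambda>y. (norm (f y $ i))\<^sup>2)"
    proof
      fix i
      show "set_integrable M S (\<lambda>y. (norm (f y $ i))\<^sup>2)"
      proof (rule set_integrable_bound_real[OF sq measurable_power2_indicator])
        have "(\<lambda>y. indicator S y *\<^sub>R f y $ i) \<in> borel_measurable M"
          using assms[unfolded set_integrable_vec_iff] unfolding set_integrable_def
          by (blast dest: borel_measurable_integrable)
        then have "(\<lambda>y. norm (indicator S y *\<^sub>R f y $ i)) \<in> borel_measurable M"
          by (rule measurable_compose[OF _ borel_measurable_norm])
        moreover have "(\<lambda>y. norm (indicator S y *\<^sub>R f y $ i)) = (\<lambda>y. indicator S y * norm (f y $ i))"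
          by (simp add: fun_eq_iff indicator_def)
        ultimately show "(\<lambda>y. indicator S y * norm (f y $ i)) \<in> borel_measurable M"
          by (simp only:)
        show "\<bar>(norm (f y $ i))\<^sup>2\<bar> \<le> (norm (f y))\<^sup>2" for y
          by (simp add: Finite_Cartesian_Product.norm_nth_le power_mono)
      qed
    qed
  next
    assume "\<forall>i. set_integrable M S (\<lambda>y. (norm (f y $ i))\<^sup>2)"
    then show "set_integrable M S (\<lambda>y. (norm (f y))\<^sup>2)"
      unfolding eq by (intro set_integral_sum) auto
  }
qed

lemma L2_components:
  fixes f :: "'a \<Rightarrow> real^'n"
  shows "set_integrable M S f \<and> set_integrable M S (\<lambda>y. (norm (f y))\<^sup>2) \<longleftrightarrow> (\<forall>i. L2_on M S (\<lambda>y. f y $ i))"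
  using set_integrable_norm_square_iff[of M S f] set_integrable_vec_iff[of M S f]
  by (auto simp: L2_on_def)

lemma L2_entries:
  fixes f :: "'a \<Rightarrow> real^'n^'k"
  shows "set_integrable M S f \<and> set_integrable M S (\<lambda>y. (norm (f y))\<^sup>2) \<longleftrightarrow>
    (\<forall>i j. L2_on M S (\<lambda>y. f y $ i $ j))"
  using set_integrable_norm_square_iff[of M S f] set_integrable_vec_iff[of M S f]
    L2_components[of M S "\<lambda>y. f y $ i" for i]
  by blast

section \<open>Integration by parts and multiplication of Sobolev functions\<close>

context surface
begin

lemma mean_curvature_continuous: "continuous_on S (mean_curvature S \<nu>)"
  unfolding mean_curvature_def[abs_def]
  by (intro continuous_intros tan_grad_continuous normal_C1_surface)

lemma surface_div_continuous:
  assumes "\<And>\<kappa> \<beta>. C1_surface S \<nu> (\<lambda>y. \<Phi> y $ \<kappa> $ \<beta>)"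
  shows "continuous_on S (\<lambda>y. surface_div \<Phi> y $ \<kappa>)"
  unfolding surface_div_def vec_lambda_beta
  by (intro continuous_intros tan_grad_continuous assms)

lemma normal_continuous: "continuous_on S (\<lambda>y. \<nu> y $ \<beta>)"
  by (intro continuous_intros normal_cont)

text \<open>Every integrand is a finite sum of products of a continuous function with an integrable
  component of \<open>f\<close> or \<open>G\<close>, which justifies exchanging sums and integrals.
  The mean curvature is among the continuous factors because \<nu> is C^1.\<close>

lemma weak_div_theorem:
  assumes G: "has_weak_tan_grad d S \<nu> f G"
    and \<Phi>: "\<And>\<kappa> \<beta>. C1_surface S \<nu> (\<lambda>y. \<Phi> y $ \<kappa> $ \<beta>)"
    and tangential: "\<And>y. y \<in> S \<Longrightarrow> \<Phi> y *v \<nu> y = 0"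
  shows "set_integrable (hausdorff d) S (\<lambda>y. frob (\<Phi> y) (G y))"
    and "set_integrable (hausdorff d) S (\<lambda>y. f y \<bullet> surface_div \<Phi> y)"
    and "(LINT y:S|hausdorff d. frob (\<Phi> y) (G y)) = - (LINT y:S|hausdorff d. f y \<bullet> surface_div \<Phi> y)"
proof -
  let ?M = "hausdorff d"
  note cm = set_integrable_continuous_mult[OF compact]
  have fk: "set_integrable ?M S (\<lambda>y. f y $ \<kappa>)" for \<kappa>
    using G by (simp add: has_weak_tan_grad_def set_integrable_vec_iff[of _ _ f])
  have Gk: "set_integrable ?M S (\<lambda>y. G y $ \<kappa> $ \<beta>)" for \<kappa> \<beta>
    using G by (simp add: has_weak_tan_grad_def set_integrable_vec_iff)
  have i1: "set_integrable ?M S (\<lambda>y. tan_grad S \<nu> (\<lambda>y. \<Phi> y $ \<kappa> $ \<beta>) y $ \<beta> * f y $ \<kappa>)" for \<kappa> \<beta>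
    by (intro cm fk continuous_intros tan_grad_continuous \<Phi>)
  have i2: "set_integrable ?M S (\<lambda>y. \<Phi> y $ \<kappa> $ \<beta> * G y $ \<kappa> $ \<beta>)" for \<kappa> \<beta>
    by (intro cm Gk C1_surface_continuous \<Phi>)
  have i3: "set_integrable ?M S (\<lambda>y. (\<Phi> y $ \<kappa> $ \<beta> * mean_curvature S \<nu> y * \<nu> y $ \<beta>) * f y $ \<kappa>)" for \<kappa> \<beta>
    by (intro cm fk continuous_intros C1_surface_continuous \<Phi> mean_curvature_continuous normal_cont)
  have id: "(LINT y:S|?M. tan_grad S \<nu> (\<lambda>y. \<Phi> y $ \<kappa> $ \<beta>) y $ \<beta> * f y $ \<kappa>) =
      - (LINT y:S|?M. \<Phi> y $ \<kappa> $ \<beta> * G y $ \<kappa> $ \<beta>)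
      + (LINT y:S|?M. (\<Phi> y $ \<kappa> $ \<beta> * mean_curvature S \<nu> y * \<nu> y $ \<beta>) * f y $ \<kappa>)" for \<kappa> \<beta>
    using G \<Phi>[of \<kappa> \<beta>] unfolding has_weak_tan_grad_def by (simp add: mult_ac)
  have frob: "frob (\<Phi> y) (G y) = (\<Sum>\<kappa>\<in>UNIV. \<Sum>\<beta>\<in>UNIV. \<Phi> y $ \<kappa> $ \<beta> * G y $ \<kappa> $ \<beta>)" for y
    by (simp add: frob_def)
  have div: "f y \<bullet> surface_div \<Phi> y =
      (\<Sum>\<kappa>\<in>UNIV. \<Sum>\<beta>\<in>UNIV. tan_grad S \<nu> (\<lambda>y. \<Phi> y $ \<kappa> $ \<beta>) y $ \<beta> * f y $ \<kappa>)" for y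
    by (simp add: inner_vec_def surface_div_def sum_distrib_left mult.commute)
  show "set_integrable ?M S (\<lambda>y. frob (\<Phi> y) (G y))"
    unfolding frob by (intro set_integral_sum(1) i2)
  show "set_integrable ?M S (\<lambda>y. f y \<bullet> surface_div \<Phi> y)"
    unfolding div by (intro set_integral_sum(1) i1)
  have "(\<Sum>\<kappa>\<in>UNIV. \<Sum>\<beta>\<in>UNIV. (\<Phi> y $ \<kappa> $ \<beta> * mean_curvature S \<nu> y * \<nu> y $ \<beta>) * f y $ \<kappa>) = 0"
    if "y \<in> S" for y
  proof -
    have "(\<Sum>\<beta>\<in>UNIV. (\<Phi> y $ \<kappa> $ \<beta> * mean_curvature S \<nu> y * \<nu> y $ \<beta>) * f y $ \<kappa>) =
        mean_curvature S \<nu> y * f y $ \<kappa> * (\<Phi> y *v \<nu> y) $ \<kappa>" for \<kappa>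
      by (simp add: matrix_vector_mult_def sum_distrib_left mult_ac)
    then show ?thesis by (simp add: tangential[OF that])
  qed
  then have "(LINT y:S|?M. 0) = (LINT y:S|?M. \<Sum>\<kappa>\<in>UNIV. \<Sum>\<beta>\<in>UNIV.
      (\<Phi> y $ \<kappa> $ \<beta> * mean_curvature S \<nu> y * \<nu> y $ \<beta>) * f y $ \<kappa>)"
    by (intro set_integral_cong') (rule sym)
  then have "0 = (LINT y:S|?M. \<Sum>\<kappa>\<in>UNIV. \<Sum>\<beta>\<in>UNIV.
      (\<Phi> y $ \<kappa> $ \<beta> * mean_curvature S \<nu> y * \<nu> y $ \<beta>) * f y $ \<kappa>)"
    by (simp add: set_lebesgue_integral_def)
  also have "\<dots> = (\<Sum>\<kappa>\<in>UNIV. \<Sum>\<beta>\<in>UNIV. LINT y:S|?M.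
      (\<Phi> y $ \<kappa> $ \<beta> * mean_curvature S \<nu> y * \<nu> y $ \<beta>) * f y $ \<kappa>)"
    by (subst set_integral_sum(2), intro set_integral_sum(1) i3,
        intro sum.cong refl set_integral_sum(2) i3)
  also have "\<dots> = (\<Sum>\<kappa>\<in>UNIV. \<Sum>\<beta>\<in>UNIV. (LINT y:S|?M. tan_grad S \<nu> (\<lambda>y. \<Phi> y $ \<kappa> $ \<beta>) y $ \<beta> * f y $ \<kappa>)
      + (LINT y:S|?M. \<Phi> y $ \<kappa> $ \<beta> * G y $ \<kappa> $ \<beta>))"
    by (simp add: id)
  also have "\<dots> = (LINT y:S|?M. f y \<bullet> surface_div \<Phi> y) + (LINT y:S|?M. frob (\<Phi> y) (G y))"
  proof -
    have "(LINT y:S|?M. f y \<bullet> surface_div \<Phi> y) = (\<Sum>\<kappa>\<in>UNIV. \<Sum>\<beta>\<in>UNIV.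
        LINT y:S|?M. tan_grad S \<nu> (\<lambda>y. \<Phi> y $ \<kappa> $ \<beta>) y $ \<beta> * f y $ \<kappa>)"
      unfolding div by (subst set_integral_sum(2), intro set_integral_sum(1) i1,
        intro sum.cong refl set_integral_sum(2) i1)
    moreover have "(LINT y:S|?M. frob (\<Phi> y) (G y)) = (\<Sum>\<kappa>\<in>UNIV. \<Sum>\<beta>\<in>UNIV.
        LINT y:S|?M. \<Phi> y $ \<kappa> $ \<beta> * G y $ \<kappa> $ \<beta>)"
      unfolding frob by (subst set_integral_sum(2), intro set_integral_sum(1) i2,
        intro sum.cong refl set_integral_sum(2) i2)
    ultimately show ?thesis by (simp add: sum.distrib)
  qed
  finally show "(LINT y:S|?M. frob (\<Phi> y) (G y)) = - (LINT y:S|?M. f y \<bullet> surface_div \<Phi> y)"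
    by linarith
qed

text \<open>The factor moves to the test function: \<open>Q y $ \<kappa> $ l * \<phi> y\<close> is
  again of class C^1, so the identity for \<open>f\<close> applies to it. The surplus term, \<phi>
  times the gradient of \<open>Q\<close>, becomes the second part of the new weak gradient.\<close>

lemma has_weak_tan_grad_matrix_mult:
  assumes G: "has_weak_tan_grad d S \<nu> f G"
    and Q: "\<And>\<kappa> \<beta>. C1_surface S \<nu> (\<lambda>y. Q y $ \<kappa> $ \<beta>)"
  shows "has_weak_tan_grad d S \<nu> (\<lambda>y. Q y *v f y) (\<lambda>y. \<chi> \<kappa> \<beta>. \<Sum>l\<in>UNIV.
    Q y $ \<kappa> $ l * G y $ l $ \<beta> + tan_grad S \<nu> (\<lambda>y. Q y $ \<kappa> $ l) y $ \<beta> * f y $ l)"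
    (is "has_weak_tan_grad d S \<nu> ?f ?G")
proof -
  let ?M = "hausdorff d"
  note cm = set_integrable_continuous_mult[OF compact]
  have fk: "set_integrable ?M S (\<lambda>y. f y $ \<kappa>)" for \<kappa>
    using G by (simp add: has_weak_tan_grad_def set_integrable_vec_iff[of _ _ f])
  have Gk: "set_integrable ?M S (\<lambda>y. G y $ \<kappa> $ \<beta>)" for \<kappa> \<beta>
    using G by (simp add: has_weak_tan_grad_def set_integrable_vec_iff)
  have fi: "set_integrable ?M S ?f"
    unfolding set_integrable_vec_iff matrix_vector_mult_def vec_lambda_beta
    by (intro allI set_integral_sum(1) cm fk C1_surface_continuous Q)
  have i1: "set_integrable ?M S (\<lambda>y. Q y $ \<kappa> $ l * G y $ l $ \<beta>)" for \<kappa> l \<beta>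
    by (intro cm Gk C1_surface_continuous Q)
  have i2: "set_integrable ?M S (\<lambda>y. tan_grad S \<nu> (\<lambda>y. Q y $ \<kappa> $ l) y $ \<beta> * f y $ l)" for \<kappa> l \<beta>
    by (intro cm fk continuous_intros tan_grad_continuous Q)
  have gram_inv: "set_integrable ?M S ?G"
    unfolding set_integrable_vec_iff vec_lambda_beta
    by (intro allI set_integral_sum(1) set_integral_add(1) i1 i2)
  have "(LINT y:S|?M. ?f y $ \<kappa> * tan_grad S \<nu> \<phi> y $ \<beta>) =
        - (LINT y:S|?M. \<phi> y * ?G y $ \<kappa> $ \<beta>)
        + (LINT y:S|?M. ?f y $ \<kappa> * \<phi> y * mean_curvature S \<nu> y * \<nu> y $ \<beta>)"
    if \<phi>: "C1_surface S \<nu> \<phi>" for \<phi> \<kappa> \<beta>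
  proof -
    have Q\<phi>: "C1_surface S \<nu> (\<lambda>y. Q y $ \<kappa> $ l * \<phi> y)" for l by (intro C1_surface_mult Q \<phi>)
    note cont = continuous_intros tan_grad_continuous C1_surface_continuous Q \<phi> Q\<phi>
      mean_curvature_continuous normal_cont
    have j1: "set_integrable ?M S (\<lambda>y. tan_grad S \<nu> (\<lambda>y. Q y $ \<kappa> $ l * \<phi> y) y $ \<beta> * f y $ l)" for l
      by (intro cm fk cont)
    have j2: "set_integrable ?M S (\<lambda>y. (\<phi> y * tan_grad S \<nu> (\<lambda>y. Q y $ \<kappa> $ l) y $ \<beta>) * f y $ l)" for l
      by (intro cm fk cont)
    have j3: "set_integrable ?M S (\<lambda>y. (Q y $ \<kappa> $ l * \<phi> y) * G y $ l $ \<beta>)" for l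
      by (intro cm Gk cont)
    have j4: "set_integrable ?M S (\<lambda>y. (Q y $ \<kappa> $ l * \<phi> y * mean_curvature S \<nu> y * \<nu> y $ \<beta>) * f y $ l)" for l
      by (intro cm fk cont)
    have id: "(LINT y:S|?M. tan_grad S \<nu> (\<lambda>y. Q y $ \<kappa> $ l * \<phi> y) y $ \<beta> * f y $ l) =
        - (LINT y:S|?M. (Q y $ \<kappa> $ l * \<phi> y) * G y $ l $ \<beta>)
        + (LINT y:S|?M. (Q y $ \<kappa> $ l * \<phi> y * mean_curvature S \<nu> y * \<nu> y $ \<beta>) * f y $ l)" for l
      using G Q\<phi>[of l] unfolding has_weak_tan_grad_def by (simp add: mult_ac)
    \<comment> \<open>The product rule read backwards: \<open>Q\<close> times the gradient of \<phi>
      is the gradient of the product minus \<phi> times the gradient of \<open>Q\<close>.\<close>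
    have "(LINT y:S|?M. ?f y $ \<kappa> * tan_grad S \<nu> \<phi> y $ \<beta>) =
        (LINT y:S|?M. \<Sum>l\<in>UNIV. tan_grad S \<nu> (\<lambda>y. Q y $ \<kappa> $ l * \<phi> y) y $ \<beta> * f y $ l
          - (\<phi> y * tan_grad S \<nu> (\<lambda>y. Q y $ \<kappa> $ l) y $ \<beta>) * f y $ l)"
    proof (rule set_integral_cong')
      fix y assume y: "y \<in> S"
      show "?f y $ \<kappa> * tan_grad S \<nu> \<phi> y $ \<beta> =
        (\<Sum>l\<in>UNIV. tan_grad S \<nu> (\<lambda>y. Q y $ \<kappa> $ l * \<phi> y) y $ \<beta> * f y $ l
          - (\<phi> y * tan_grad S \<nu> (\<lambda>y. Q y $ \<kappa> $ l) y $ \<beta>) * f y $ l)"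
        unfolding tan_grad_mult[OF Q \<phi> y] matrix_vector_mult_def vec_lambda_beta sum_distrib_right
        by (intro sum.cong refl) (simp add: algebra_simps)
    qed
    also have "\<dots> = (\<Sum>l\<in>UNIV. (LINT y:S|?M. tan_grad S \<nu> (\<lambda>y. Q y $ \<kappa> $ l * \<phi> y) y $ \<beta> * f y $ l)
        - (LINT y:S|?M. (\<phi> y * tan_grad S \<nu> (\<lambda>y. Q y $ \<kappa> $ l) y $ \<beta>) * f y $ l))"
      by (subst set_integral_sum(2), intro set_integral_diff(1) j1 j2,
          intro sum.cong refl set_integral_diff(2) j1 j2)
    also have "\<dots> = (\<Sum>l\<in>UNIV. - ((LINT y:S|?M. (Q y $ \<kappa> $ l * \<phi> y) * G y $ l $ \<beta>)
          + (LINT y:S|?M. (\<phi> y * tan_grad S \<nu> (\<lambda>y. Q y $ \<kappa> $ l) y $ \<beta>) * f y $ l))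
        + (LINT y:S|?M. (Q y $ \<kappa> $ l * \<phi> y * mean_curvature S \<nu> y * \<nu> y $ \<beta>) * f y $ l))"
      unfolding id by (intro sum.cong refl) simp
    also have "\<dots> = - (\<Sum>l\<in>UNIV. (LINT y:S|?M. (Q y $ \<kappa> $ l * \<phi> y) * G y $ l $ \<beta>)
          + (LINT y:S|?M. (\<phi> y * tan_grad S \<nu> (\<lambda>y. Q y $ \<kappa> $ l) y $ \<beta>) * f y $ l))
        + (\<Sum>l\<in>UNIV. (LINT y:S|?M. (Q y $ \<kappa> $ l * \<phi> y * mean_curvature S \<nu> y * \<nu> y $ \<beta>) * f y $ l))"
      by (simp only: sum.distrib sum_negf)
    also have "(\<Sum>l\<in>UNIV. (LINT y:S|?M. (Q y $ \<kappa> $ l * \<phi> y) * G y $ l $ \<beta>)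
          + (LINT y:S|?M. (\<phi> y * tan_grad S \<nu> (\<lambda>y. Q y $ \<kappa> $ l) y $ \<beta>) * f y $ l)) =
        (LINT y:S|?M. \<Sum>l\<in>UNIV. (Q y $ \<kappa> $ l * \<phi> y) * G y $ l $ \<beta>
          + (\<phi> y * tan_grad S \<nu> (\<lambda>y. Q y $ \<kappa> $ l) y $ \<beta>) * f y $ l)"
      by (subst set_integral_sum(2), intro set_integral_add(1) j3 j2,
          intro sum.cong refl set_integral_add(2)[symmetric] j3 j2)
    also have "\<dots> = (LINT y:S|?M. \<phi> y * ?G y $ \<kappa> $ \<beta>)"
      by (intro set_integral_cong') (simp add: sum_distrib_left algebra_simps)
    also have "(\<Sum>l\<in>UNIV. (LINT y:S|?M. (Q y $ \<kappa> $ l * \<phi> y * mean_curvature S \<nu> y * \<nu> y $ \<beta>) * f y $ l)) =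
        (LINT y:S|?M. \<Sum>l\<in>UNIV. (Q y $ \<kappa> $ l * \<phi> y * mean_curvature S \<nu> y * \<nu> y $ \<beta>) * f y $ l)"
      by (intro set_integral_sum(2)[symmetric] j4)
    also have "\<dots> = (LINT y:S|?M. ?f y $ \<kappa> * \<phi> y * mean_curvature S \<nu> y * \<nu> y $ \<beta>)"
      unfolding matrix_vector_mult_def vec_lambda_beta sum_distrib_right
      by (intro set_integral_cong' sum.cong refl) (simp add: mult_ac)
    finally show ?thesis .
  qed
  then show ?thesis using fi gram_inv unfolding has_weak_tan_grad_def by blast
qed

text \<open>The coefficients in the product rule are continuous on a compact set, hence bounded, so
  square integrability passes from \<open>f\<close> and its gradient to the product. Needed with the
  projection as \<open>Q\<close>.\<close>

lemma sobolev_H12_matrix_mult: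
  assumes f: "f \<in> sobolev_H12 d S \<nu>" and Q: "\<And>\<kappa> \<beta>. C1_surface S \<nu> (\<lambda>y. Q y $ \<kappa> $ \<beta>)"
  shows "(\<lambda>y. Q y *v f y) \<in> sobolev_H12 d S \<nu>"
proof -
  let ?M = "hausdorff d"
  obtain G where G: "has_weak_tan_grad d S \<nu> f G" "set_integrable ?M S (\<lambda>y. (norm (G y))\<^sup>2)"
    and f2: "set_integrable ?M S (\<lambda>y. (norm (f y))\<^sup>2)"
    using f by (auto simp: sobolev_H12_def)
  have fL: "L2_on ?M S (\<lambda>y. f y $ \<kappa>)" for \<kappa>
    using G f2 L2_components[of ?M S f] by (auto simp: has_weak_tan_grad_def)
  have GL: "L2_on ?M S (\<lambda>y. G y $ \<kappa> $ \<beta>)" for \<kappa> \<beta>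
    using G L2_entries[of ?M S G] by (auto simp: has_weak_tan_grad_def)
  note cm = L2_on_continuous_mult[OF compact]
  have "L2_on ?M S (\<lambda>y. (Q y *v f y) $ \<kappa>)" for \<kappa>
    unfolding matrix_vector_mult_def vec_lambda_beta
    by (intro L2_on_sum cm fL C1_surface_continuous Q) auto
  moreover have "L2_on ?M S (\<lambda>y. \<Sum>l\<in>UNIV. Q y $ \<kappa> $ l * G y $ l $ \<beta> + tan_grad S \<nu> (\<lambda>y. Q y $ \<kappa> $ l) y $ \<beta> * f y $ l)"
    for \<kappa> \<beta>
    by (intro L2_on_sum L2_on_add cm fL GL C1_surface_continuous continuous_intros tan_grad_continuous Q) auto
  ultimately show ?thesis
    using has_weak_tan_grad_matrix_mult[OF G(1) Q] L2_components[of ?M S "\<lambda>y. Q y *v f y"]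
      L2_entries[of ?M S "\<lambda>y. \<chi> \<kappa> \<beta>. \<Sum>l\<in>UNIV. Q y $ \<kappa> $ l * G y $ l $ \<beta> + tan_grad S \<nu> (\<lambda>y. Q y $ \<kappa> $ l) y $ \<beta> * f y $ l"]
    unfolding sobolev_H12_def by auto
qed

end

section \<open>Embeddings of a hypersurface\<close>

locale embedded_surface =
  fixes dim :: "'n::finite itself" and M :: "(real^'m::finite) set"
    and x :: "real^'m \<Rightarrow> real^'m" and \<nu> :: "real^'m \<Rightarrow> real^'m"
  assumes hypersurface: "smooth_hypersurface TYPE('n) M" and compact_M: "compact M"
    and embedding: "C2_embedding TYPE('n) M x"
    and normal: "unit_normal_field TYPE('n) M x \<nu>"

text \<open>The image is charted by the compositions of \<open>x\<close> with the parametrizations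
  of \<open>M\<close>; they have the C^2 regularity of \<open>x\<close>. Relative openness and
  continuity of the inverses hold because \<open>x\<close> is a homeomorphism onto its
  image.\<close>

sublocale embedded_surface \<subseteq> surface "x ` M" \<nu> "\<lambda>U (F :: real^'n \<Rightarrow> real^'m). \<exists>X. local_param M U X \<and> F = x \<circ> X"
proof
  obtain y where hom: "homeomorphism M (x ` M) x y" using embedding by (auto simp: C2_embedding_def)
  show "CARD('m) = CARD('n) + 1" using hypersurface by (simp add: smooth_hypersurface_def)
  show "compact (x ` M)"
    using hom compact_M by (intro compact_continuous_image) (auto simp: homeomorphism_def)
  show "continuous_on (x ` M) \<nu>" using normal by (simp add: unit_normal_field_def)
  show "norm (\<nu> p) = 1" if "p \<in> x ` M" for p
    using normal that unfolding unit_normal_field_def by blast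
  show "\<exists>U F. (\<exists>X. local_param M U X \<and> F = x \<circ> X) \<and> p \<in> (F :: real^'n \<Rightarrow> real^'m) ` U" if "p \<in> x ` M" for p
  proof -
    obtain q where q: "q \<in> M" "p = x q" using \<open>p \<in> x ` M\<close> by blast
    obtain U and X :: "real^'n \<Rightarrow> real^'m" where X: "local_param M U X" "q \<in> X ` U"
      using hypersurface q(1) unfolding smooth_hypersurface_def by blast
    have "p \<in> (x \<circ> X) ` U" using X(2) q(2) by auto
    with X(1) show ?thesis by blast
  qed
  fix U and F :: "real^'n \<Rightarrow> real^'m"
  assume "\<exists>X. local_param M U X \<and> F = x \<circ> X"
  then obtain X where X: "local_param M U X" and F: "F = x \<circ> X" by blast
  show "open U" using X by (simp add: local_param_def)
  show "Ck_on 2 U F" using embedding X F by (auto simp: C2_embedding_def)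
  have oX: "openin (top_of_set M) (X ` U)" using X by (simp add: local_param_def)
  have FU: "F ` U = x ` (X ` U)" by (simp add: F image_comp)
  show "openin (top_of_set (x ` M)) (F ` U)"
    unfolding FU by (rule homeomorphism_imp_open_map[OF hom oX])
  obtain C where C: "homeomorphism U (X ` U) X C" using X by (auto simp: local_param_def)
  have "homeomorphism (X ` U) (x ` (X ` U)) x y"
    using homeomorphism_of_subsets[OF hom openin_imp_subset[OF oX] _ refl] openin_imp_subset[OF oX] by blast
  from homeomorphism_compose[OF C this] show "\<exists>C. homeomorphism U (F ` U) F C"
    unfolding FU unfolding F by blast
  fix \<theta>
  assume \<theta>: "\<theta> \<in> U"
  show "inj (frechet_derivative F (at \<theta>))"
    using embedding X F \<theta> by (auto simp: C2_embedding_def)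
  show "\<nu> (F \<theta>) \<bullet> pd i F \<theta> = 0" for i
    using normal X F \<theta> by (auto simp: unit_normal_field_def)
qed

context embedded_surface
begin

abbreviation S where "S \<equiv> x ` M"

text \<open>Brings \<open>x \<circ> X\<close> into the syntactic shape of the atlas predicate, as a
  premise for the chart lemmas.\<close>

lemma param_atlas: "local_param M U X \<Longrightarrow> \<exists>X'. local_param M U X' \<and> x \<circ> X = x \<circ> X'"
  for X :: "real^'n \<Rightarrow> real^'m"
  by blast

lemma inj_x: "inj_on x M"
proof -
  obtain y where "homeomorphism M (x ` M) x y" using embedding by (auto simp: C2_embedding_def)
  then show ?thesis by (metis homeomorphism_apply1 inj_on_inverseI)
qed

section \<open>The tensor \<open>H_hat\<close> and its inverse in a parametrization\<close>

context
  fixes U and X :: "real^'n \<Rightarrow> real^'m"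
  assumes X: "local_param M U X"
begin

lemma param_open: "open U" using X by (simp add: local_param_def)

lemma param_mem: "\<theta> \<in> U \<Longrightarrow> X \<theta> \<in> M"
  using X openin_imp_subset by (fastforce simp: local_param_def)

lemma param_inv: "\<theta> \<in> U \<Longrightarrow> inv_into M x (x (X \<theta>)) = X \<theta>"
  by (intro inv_into_f_f inj_x param_mem)

lemma param_C2: "Ck_on 2 U X" using X by (simp add: local_param_def smooth_on_def)

lemma param_C1: "C1_on U X"
  using param_C2 by (auto simp: Ck_on_2_iff C1_on_iff differentiable_imp_continuous_on)

lemma param_pd_C1: "C1_on U (pd i X)" using param_C2 by (simp add: Ck_on_2_iff)

lemma param_metric_C1: "C1_on U (\<lambda>\<theta>. induced_metric X \<theta> $ i $ j)"
  unfolding induced_metric_def vec_lambda_beta by (intro C1_inner param_pd_C1 param_open)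

lemma param_det_pos: "\<theta> \<in> U \<Longrightarrow> 0 < det (induced_metric X \<theta>)"
  using X by (intro induced_metric_det_pos C1_differentiable[OF param_C1 param_open])
    (auto simp: local_param_def)

text \<open>The inverse embedding composed with \<open>x \<circ> X\<close> is \<open>X\<close>, so
  its tangential derivative takes the coordinate vectors of the image to those of \<open>M\<close>.
  Its rows are tangential, which is why \<nu> is annihilated.\<close>

lemma tan_grad_inv:
  assumes \<theta>: "\<theta> \<in> U"
  shows "tan_grad_matrix S \<nu> (inv_into M x) (x (X \<theta>)) *v pd i (x \<circ> X) \<theta> = pd i X \<theta>"
    and "tan_grad_matrix S \<nu> (inv_into M x) (x (X \<theta>)) *v \<nu> (x (X \<theta>)) = 0"
proof -
  let ?F = "x \<circ> X"
  note a = param_atlas[OF X]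
  let ?f = "\<lambda>\<kappa> y. inv_into M x y $ \<kappa>"
  have X_C1: "C1_on U (\<lambda>\<xi>. X \<xi> $ \<kappa>)" for \<kappa> by (intro C1_vec_nth param_open param_C1)
  have "C1_on U (?f \<kappa> \<circ> ?F)" for \<kappa>
    by (rule C1_cong[OF param_open X_C1]) (simp add: param_inv)
  then have d: "(?f \<kappa> \<circ> ?F) differentiable (at \<theta>)" for \<kappa>
    using C1_differentiable param_open \<theta> by blast
  have p: "pd i (?f \<kappa> \<circ> ?F) \<theta> = pd i X \<theta> $ \<kappa>" for i \<kappa>
  proof -
    have "pd i (?f \<kappa> \<circ> ?F) \<theta> = pd i (\<lambda>\<xi>. X \<xi> $ \<kappa>) \<theta>"
      by (rule pd_cong[OF param_open \<theta>]) (simp add: param_inv)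
    then show ?thesis
      using pd_vec_nth[OF C1_differentiable[OF param_C1 param_open \<theta>]] by simp
  qed
  have D: "tan_grad_matrix S \<nu> (inv_into M x) (x (X \<theta>)) $ \<kappa> = grad_coord ?F (?f \<kappa>) \<theta>" for \<kappa>
    using tan_grad_chart[OF a \<theta> d[of \<kappa>]] by (simp add: tan_grad_matrix_def)
  show "tan_grad_matrix S \<nu> (inv_into M x) (x (X \<theta>)) *v pd i ?F \<theta> = pd i X \<theta>"
    by (simp add: vec_eq_iff matrix_vector_mul_component D grad_coord_tangent(1)[OF a \<theta>] p)
  show "tan_grad_matrix S \<nu> (inv_into M x) (x (X \<theta>)) *v \<nu> (x (X \<theta>)) = 0"
    using grad_coord_tangent(2)[OF a \<theta>]
    by (simp add: vec_eq_iff matrix_vector_mul_component D)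
qed

context
  fixes \<theta>
  assumes \<theta>: "\<theta> \<in> U"
begin

abbreviation (input) "base_pt \<equiv> x (X \<theta>)"
abbreviation (input) "inverse_grad \<equiv> tan_grad_matrix S \<nu> (inv_into M x) base_pt"
abbreviation (input) "tangent i \<equiv> pd i (x \<circ> X) \<theta>"

interpretation frame: normal_frame "\<lambda>i. tangent i" "\<nu> base_pt"
  using chart_frame[OF param_atlas[OF X] \<theta>] by simp

lemma H_hat_mult: "H_hat M x \<nu> base_pt *v v = (inverse_grad *v v) v* inverse_grad + (\<nu> base_pt \<bullet> v) *\<^sub>R \<nu> base_pt"
  by (simp add: H_hat_def Let_def matrix_vector_mult_add_rdistrib matrix_vector_mul_assoc[symmetric] outer_mult)

lemma inner_vector_matrix: "v \<bullet> (w v* inverse_grad) = (inverse_grad *v v) \<bullet> w"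
  by (metis dot_lmul_matrix inner_commute)

lemma H_hat_normal: "H_hat M x \<nu> base_pt *v \<nu> base_pt = \<nu> base_pt"
  using frame.unit by (simp add: H_hat_mult tan_grad_inv(2)[OF \<theta>])

lemma H_hat_tangent: "H_hat M x \<nu> base_pt *v tangent i = pd i X \<theta> v* inverse_grad"
  by (simp add: H_hat_mult tan_grad_inv(1)[OF \<theta>] frame.orth[simplified])

lemma det_H_hat: "det (induced_metric (x \<circ> X) \<theta>) * det (H_hat M x \<nu> base_pt) = det (induced_metric X \<theta>)"
  using frame.det_conjugate[of "H_hat M x \<nu> base_pt"]
  by (simp add: H_hat_normal H_hat_tangent inner_vector_matrix tan_grad_inv[OF \<theta>] induced_metric_def)

lemma det_H_hat_pos: "0 < det (H_hat M x \<nu> base_pt)"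
  using det_H_hat param_det_pos[OF \<theta>] chart_det_pos[OF param_atlas[OF X] \<theta>]
  by (metis zero_less_mult_pos)

lemma area_quotient:
  "sqrt (det (induced_metric X \<theta>)) / sqrt (det (induced_metric (x \<circ> X) \<theta>)) = sqrt (det (H_hat M x \<nu> base_pt))"
  using chart_det_pos[OF param_atlas[OF X] \<theta>]
  by (simp add: det_H_hat[symmetric] real_sqrt_mult)

text \<open>The inverse metric of \<open>M\<close>, carried to the image surface as a tensor on the
  ambient space. The inverse of the induced metric in its place would give the projection.\<close>

definition "cometric = (\<chi> \<kappa> \<beta>. \<Sum>i\<in>UNIV. \<Sum>j\<in>UNIV.
    matrix_inv (induced_metric X \<theta>) $ i $ j * tangent i $ \<kappa> * tangent j $ \<beta>)"

lemma cometric_mult: "cometric *v v = (\<Sum>i\<in>UNIV. (\<Sum>j\<in>UNIV. matrix_inv (induced_metric X \<theta>) $ i $ j * (tangent j \<bullet> v)) *\<^sub>R tangent i)"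
proof -
  have "(cometric *v v) $ \<kappa> = (\<Sum>\<beta>\<in>UNIV. \<Sum>i\<in>UNIV. \<Sum>j\<in>UNIV.
      matrix_inv (induced_metric X \<theta>) $ i $ j * (tangent j $ \<beta> * v $ \<beta>) * tangent i $ \<kappa>)" for \<kappa>
    unfolding cometric_def matrix_vector_mult_def vec_lambda_beta sum_distrib_right
    by (intro sum.cong refl) (simp add: mult_ac)
  also have "\<dots> \<kappa> = (\<Sum>i\<in>UNIV. \<Sum>j\<in>UNIV. \<Sum>\<beta>\<in>UNIV.
      matrix_inv (induced_metric X \<theta>) $ i $ j * (tangent j $ \<beta> * v $ \<beta>) * tangent i $ \<kappa>)" for \<kappa>
    by (subst sum.swap, rule sum.cong[OF refl], rule sum.swap)
  finally show ?thesis
    by (simp add: vec_eq_iff inner_vec_def sum_distrib_left sum_distrib_right)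
qed

text \<open>Checked on the frame: \<open>H_hat\<close> sends tangent vector a to a tangential vector
  whose inner product with tangent vector j is the entry (j, a) of the metric of \<open>M\<close>,
  and the cometric undoes this; \<nu> is fixed by both matrices.\<close>

lemma matrix_inv_H_hat: "matrix_inv (H_hat M x \<nu> base_pt) = cometric + \<nu> base_pt \<otimes>\<^sub>v \<nu> base_pt"
proof (rule matrix_inv_unique, rule frame.matrix_frame_eqI)
  have Kt: "cometric *v (pd a X \<theta> v* inverse_grad) = tangent a" for a
  proof -
    have "(\<Sum>j\<in>UNIV. matrix_inv (induced_metric X \<theta>) $ i $ j * (tangent j \<bullet> (pd a X \<theta> v* inverse_grad))) =
        (if i = a then 1 else 0)" for i
      using sum_matrix_inv(2)[of "induced_metric X \<theta>" i a] param_det_pos[OF \<theta>]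
      by (simp add: inner_vector_matrix tan_grad_inv[OF \<theta>] induced_metric_def)
    then show ?thesis by (simp add: cometric_mult if_distrib[of "\<lambda>c. c *\<^sub>R _"] cong: if_cong)
  qed
  show "((cometric + \<nu> base_pt \<otimes>\<^sub>v \<nu> base_pt) ** H_hat M x \<nu> base_pt) *v tangent i = mat 1 *v tangent i" for i
    by (simp add: matrix_vector_mul_assoc[symmetric] H_hat_tangent matrix_vector_mult_add_rdistrib Kt
        outer_mult inner_vector_matrix tan_grad_inv[OF \<theta>])
  show "((cometric + \<nu> base_pt \<otimes>\<^sub>v \<nu> base_pt) ** H_hat M x \<nu> base_pt) *v \<nu> base_pt = mat 1 *v \<nu> base_pt"
    using frame.unit
    by (simp add: matrix_vector_mul_assoc[symmetric] H_hat_normal matrix_vector_mult_add_rdistrib cometric_mult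
        outer_mult frame.orth'[simplified])
qed

lemma projection_inv_H_hat: "projection \<nu> base_pt ** matrix_inv (H_hat M x \<nu> base_pt) = cometric"
proof -
  have "\<nu> base_pt \<bullet> (cometric *v v) = 0" for v
    by (simp add: cometric_mult inner_sum_right frame.orth[simplified])
  then have "(projection \<nu> base_pt ** matrix_inv (H_hat M x \<nu> base_pt)) *v v = cometric *v v" for v
    using frame.unit
    by (simp add: matrix_vector_mul_assoc[symmetric] matrix_inv_H_hat projection_mult
        matrix_vector_mult_add_rdistrib outer_mult inner_add_right)
  then show ?thesis by (simp add: matrix_eq)
qed

end

end

text \<open>\<open>H_hat\<close> is defined without coordinates, so the quotient of densities agrees
  in all parametrizations around \<open>p\<close>; this resolves the definite description and gives
  the formula for \<rho> at once.\<close>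

lemma area_ratio_eq:
  assumes "p \<in> M"
  shows "area_ratio TYPE('n) M x p = sqrt (det (H_hat M x \<nu> (x p)))"
  unfolding area_ratio_def
proof (rule the_equality)
  obtain U and X :: "real^'n \<Rightarrow> real^'m" where X: "local_param M U X" "p \<in> X ` U"
    using hypersurface assms unfolding smooth_hypersurface_def by blast
  then obtain \<theta> where \<theta>: "\<theta> \<in> U" "X \<theta> = p" by blast
  show "\<exists>U (X :: real^'n \<Rightarrow> real^'m) \<theta>. local_param M U X \<and> \<theta> \<in> U \<and> X \<theta> = p \<and>
      sqrt (det (H_hat M x \<nu> (x p))) =
      sqrt (det (induced_metric X \<theta>)) / sqrt (det (induced_metric (x \<circ> X) \<theta>))"
    using X(1) \<theta> area_quotient[OF X(1) \<theta>(1)] by metis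
next
  fix r
  assume "\<exists>U (X :: real^'n \<Rightarrow> real^'m) \<theta>. local_param M U X \<and> \<theta> \<in> U \<and> X \<theta> = p \<and>
      r = sqrt (det (induced_metric X \<theta>)) / sqrt (det (induced_metric (x \<circ> X) \<theta>))"
  then show "r = sqrt (det (H_hat M x \<nu> (x p)))" using area_quotient by blast
qed

section \<open>Area weight and flux as fields on the image surface\<close>

lemma surface_param:
  assumes "y \<in> S"
  obtains U and X :: "real^'n \<Rightarrow> real^'m" and \<theta> where "local_param M U X" "\<theta> \<in> U" "y = x (X \<theta>)"
  using cover[OF assms] by auto

lemma det_H_hat_positive: "y \<in> S \<Longrightarrow> 0 < det (H_hat M x \<nu> y)"
  by (metis surface_param det_H_hat_pos)

definition area_weight :: "real^'m \<Rightarrow> real" where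
  "area_weight y = area_ratio TYPE('n) M x (inv_into M x y)"

lemma area_weight_eq: "y \<in> S \<Longrightarrow> area_weight y = sqrt (det (H_hat M x \<nu> y))"
  unfolding area_weight_def by (simp add: area_ratio_eq inv_into_into f_inv_into_f)

lemma area_weight_chart:
  assumes "local_param M U (X :: real^'n \<Rightarrow> real^'m)" "\<theta> \<in> U"
  shows "area_weight (x (X \<theta>)) =
    sqrt (det (induced_metric X \<theta>)) / sqrt (det (induced_metric (x \<circ> X) \<theta>))"
  using area_weight_eq[of "x (X \<theta>)"] param_mem[OF assms] area_quotient[OF assms] by simp

text \<open>The coefficient of the \<rho>-weighted gradient term in invariant form. It is thereby
  defined on the whole surface, as a field of test functions must be, while its chart form fits the
  divergence formula with the metric of \<open>M\<close> as \<open>g\<close>.\<close>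

definition flux :: "real^'m \<Rightarrow> real^'m^'m" where
  "flux y = area_weight y *\<^sub>R (projection \<nu> y ** matrix_inv (H_hat M x \<nu> y))"

lemma flux_chart:
  assumes "local_param M U (X :: real^'n \<Rightarrow> real^'m)" "\<theta> \<in> U"
  shows "flux (x (X \<theta>)) $ \<kappa> $ \<beta> =
    sqrt (det (induced_metric X \<theta>)) / sqrt (det (induced_metric (x \<circ> X) \<theta>)) *
    (\<Sum>i\<in>UNIV. \<Sum>j\<in>UNIV. matrix_inv (induced_metric X \<theta>) $ i $ j *
      pd i (x \<circ> X) \<theta> $ \<kappa> * pd j (x \<circ> X) \<theta> $ \<beta>)"
  by (simp add: flux_def area_weight_chart[OF assms] projection_inv_H_hat[OF assms] cometric_def[OF assms])

lemma ratio_C1: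
  assumes X: "local_param M U (X :: real^'n \<Rightarrow> real^'m)"
  shows "C1_on U (\<lambda>\<theta>. sqrt (det (induced_metric X \<theta>)) / sqrt (det (induced_metric (x \<circ> X) \<theta>)))"
  by (intro C1_divide C1_sqrt C1_det param_open[OF X] param_metric_C1[OF X] metric_C1[OF param_atlas[OF X]])
    (use param_det_pos[OF X] chart_det_pos[OF param_atlas[OF X]] in force)+

lemma area_weight_continuous: "continuous_on S area_weight"
proof (rule continuous_on_chartsI)
  fix U and F :: "real^'n \<Rightarrow> real^'m"
  assume "\<exists>X. local_param M U X \<and> F = x \<circ> X"
  then obtain X where X: "local_param M U X" and F: "F = x \<circ> X" by blast
  show "continuous_on U (\<lambda>\<theta>. area_weight (F \<theta>))"
    by (rule continuous_on_eq[OF C1_continuous[OF ratio_C1[OF X]]]) (simp add: F area_weight_chart[OF X])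
qed

lemma flux_C1_surface: "C1_surface S \<nu> (\<lambda>y. flux y $ \<kappa> $ \<beta>)"
  unfolding C1_surface_iff
proof (intro allI impI)
  fix U and F :: "real^'n \<Rightarrow> real^'m"
  assume "\<exists>X. local_param M U X \<and> F = x \<circ> X"
  then obtain X where X: "local_param M U X" and F: "F = x \<circ> X" by blast
  note U = param_open[OF X]
  have q: "C1_on U (\<lambda>\<theta>. matrix_inv (induced_metric X \<theta>) $ i $ j)" for i j
    by (intro C1_matrix_inv[OF U param_metric_C1[OF X]]) (use param_det_pos[OF X] in force)
  have "C1_on U (\<lambda>\<theta>. sqrt (det (induced_metric X \<theta>)) / sqrt (det (induced_metric (x \<circ> X) \<theta>)) *
      (\<Sum>i\<in>UNIV. \<Sum>j\<in>UNIV. matrix_inv (induced_metric X \<theta>) $ i $ j *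
      pd i (x \<circ> X) \<theta> $ \<kappa> * pd j (x \<circ> X) \<theta> $ \<beta>))"
    by (intro C1_mult C1_sum U ratio_C1[OF X] q C1_vec_nth[OF U chart_pd_C1[OF param_atlas[OF X]]])
  then show "C1_on U ((\<lambda>y. flux y $ \<kappa> $ \<beta>) \<circ> F)"
    by (rule C1_cong[OF U]) (simp add: F flux_chart[OF X])
qed

lemma projection_C1_surface: "C1_surface S \<nu> (\<lambda>y. projection \<nu> y $ \<kappa> $ \<beta>)"
  unfolding C1_surface_iff
proof (intro allI impI)
  fix U and F :: "real^'n \<Rightarrow> real^'m"
  assume a: "\<exists>X. local_param M U X \<and> F = x \<circ> X"
  note U = chart_open[OF a]
  have "C1_on U (\<lambda>\<theta>. mat 1 $ \<kappa> $ \<beta> - \<nu> (F \<theta>) $ \<kappa> * \<nu> (F \<theta>) $ \<beta>)"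
    by (intro C1_minus C1_mult C1_const U normal_C1[OF a])
  then show "C1_on U ((\<lambda>y. projection \<nu> y $ \<kappa> $ \<beta>) \<circ> F)"
    by (simp add: projection_def outer_def o_def)
qed

lemma projection_normal: "y \<in> S \<Longrightarrow> projection \<nu> y *v \<nu> y = 0"
  using normal_unit[of y] by (simp add: projection_mult norm_eq_1)

text \<open>\<nu> is fixed by \<open>H_hat\<close>, hence by its inverse, and then annihilated by
  the projection.\<close>

lemma flux_normal:
  assumes "y \<in> S"
  shows "flux y *v \<nu> y = 0"
proof -
  obtain U and X :: "real^'n \<Rightarrow> real^'m" and \<theta> where X: "local_param M U X" "\<theta> \<in> U" "y = x (X \<theta>)"
    using surface_param[OF assms] .
  have nz: "det (H_hat M x \<nu> y) \<noteq> 0" using det_H_hat_positive[OF assms] by simp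
  have "matrix_inv (H_hat M x \<nu> y) *v \<nu> y = matrix_inv (H_hat M x \<nu> y) *v (H_hat M x \<nu> y *v \<nu> y)"
    using H_hat_normal[OF X(1,2)] X(3) by simp
  also have "\<dots> = \<nu> y" by (simp add: matrix_vector_mul_assoc matrix_inv_right_left[OF nz])
  finally show ?thesis
    by (simp add: flux_def scaleR_matrix_vector_assoc[symmetric] matrix_vector_mul_assoc[symmetric]
        projection_normal[OF assms])
qed

lemma surface_div_flux:
  assumes X: "local_param M U (X :: real^'n \<Rightarrow> real^'m)" and \<theta>: "\<theta> \<in> U"
  shows "surface_div flux (x (X \<theta>)) =
    area_weight (x (X \<theta>)) *\<^sub>R laplacian (induced_metric X) (x \<circ> X) \<theta>"
proof -
  have "surface_div flux ((x \<circ> X) \<theta>) =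
    (sqrt (det (induced_metric X \<theta>)) / sqrt (det (induced_metric (x \<circ> X) \<theta>))) *\<^sub>R
      laplacian (induced_metric X) (x \<circ> X) \<theta>"
    by (rule surface_div_chart[OF param_atlas[OF X] \<theta> param_metric_C1[OF X]])
      (simp_all add: param_det_pos[OF X] flux_chart[OF X], simp add: induced_metric_def inner_commute)
  then show ?thesis by (simp add: area_weight_chart[OF X \<theta>])
qed

lemma surface_div_projection:
  assumes X: "local_param M U (X :: real^'n \<Rightarrow> real^'m)" and \<theta>: "\<theta> \<in> U"
  shows "surface_div (projection \<nu>) (x (X \<theta>)) = laplacian (induced_metric (x \<circ> X)) (x \<circ> X) \<theta>"
proof -
  note a = param_atlas[OF X]
  have one: "sqrt (det (induced_metric (x \<circ> X) \<xi>)) / sqrt (det (induced_metric (x \<circ> X) \<xi>)) = 1"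
    if "\<xi> \<in> U" for \<xi>
    using chart_det_pos[OF a that] by simp
  have "surface_div (projection \<nu>) ((x \<circ> X) \<theta>) =
    (sqrt (det (induced_metric (x \<circ> X) \<theta>)) / sqrt (det (induced_metric (x \<circ> X) \<theta>))) *\<^sub>R
      laplacian (induced_metric (x \<circ> X)) (x \<circ> X) \<theta>"
    by (rule surface_div_chart[OF a \<theta> metric_C1[OF a]])
      (simp_all only: chart_det_pos[OF a] projection_chart[OF a] one mult_1,
        simp add: induced_metric_def inner_commute)
  then show ?thesis unfolding one[OF \<theta>] by simp
qed

text \<open>In a chart the identity is represented by the chart itself, so the coordinate gradient
  of a component is a row of the projection.\<close>

lemma tan_grad_matrix_id:
  assumes "y \<in> S"
  shows "tan_grad_matrix S \<nu> (\<lambda>y. y) y = projection \<nu> y"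
proof -
  obtain U and X :: "real^'n \<Rightarrow> real^'m" and \<theta> where X: "local_param M U X" "\<theta> \<in> U" "y = x (X \<theta>)"
    using surface_param[OF assms] .
  note a = param_atlas[OF X(1)]
  have d: "(x \<circ> X) differentiable (at \<theta>)"
    by (rule C1_differentiable[OF chart_C1[OF a] chart_open[OF a] X(2)])
  have o: "(\<lambda>y. y $ \<kappa>) \<circ> (x \<circ> X) = (\<lambda>\<xi>. (x \<circ> X) \<xi> $ \<kappa>)" for \<kappa> by (simp add: fun_eq_iff)
  have "tan_grad S \<nu> (\<lambda>y. y $ \<kappa>) ((x \<circ> X) \<theta>) = grad_coord (x \<circ> X) (\<lambda>y. y $ \<kappa>) \<theta>" for \<kappa>
    by (rule tan_grad_chart[OF a X(2)]) (simp only: o differentiable_vec_nth[OF d])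
  moreover have "grad_coord (x \<circ> X) (\<lambda>y. y $ \<kappa>) \<theta> $ \<beta> = projection \<nu> ((x \<circ> X) \<theta>) $ \<kappa> $ \<beta>" for \<kappa> \<beta>
    unfolding projection_chart[OF a X(2)] grad_coord_def o pd_vec_nth[OF d] by simp
  ultimately show ?thesis
    by (simp add: vec_eq_iff tan_grad_matrix_def X(3))
qed

text \<open>Gradient matrices carry the derivative index second, so the contraction over \<gamma> is
  the matrix product of the projection with the inverse of \<open>H_hat\<close>.\<close>

lemma weighted_frob_flux:
  "weighted_frob (matrix_inv (H_hat M x \<nu> y)) (projection \<nu> y) B * area_weight y = frob (flux y) B"
proof -
  let ?L = "matrix_inv (H_hat M x \<nu> y)" and ?P = "projection \<nu> y"
  have "weighted_frob ?L ?P B = (\<Sum>\<gamma>\<in>UNIV. \<Sum>\<kappa>\<in>UNIV. \<Sum>\<beta>\<in>UNIV. ?P $ \<beta> $ \<gamma> * ?L $ \<gamma> $ \<kappa> * B $ \<beta> $ \<kappa>)"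
    by (simp add: weighted_frob_def mult_ac)
  also have "\<dots> = (\<Sum>\<kappa>\<in>UNIV. \<Sum>\<beta>\<in>UNIV. \<Sum>\<gamma>\<in>UNIV. ?P $ \<beta> $ \<gamma> * ?L $ \<gamma> $ \<kappa> * B $ \<beta> $ \<kappa>)"
    by (subst sum.swap, rule sum.cong[OF refl], rule sum.swap)
  also have "\<dots> = (\<Sum>\<beta>\<in>UNIV. \<Sum>\<kappa>\<in>UNIV. \<Sum>\<gamma>\<in>UNIV. ?P $ \<beta> $ \<gamma> * ?L $ \<gamma> $ \<kappa> * B $ \<beta> $ \<kappa>)"
    by (rule sum.swap)
  also have "\<dots> = frob (?P ** ?L) B"
    by (simp add: frob_def matrix_matrix_mult_def sum_distrib_right)
  finally show ?thesis
    by (simp add: flux_def frob_def sum_distrib_left sum_distrib_right mult_ac)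
qed

lemma projection_symmetric: "v \<bullet> (projection \<nu> y *v w) = (projection \<nu> y *v v) \<bullet> w"
  by (simp add: projection_mult inner_diff_left inner_diff_right inner_commute)

text \<open>Time is frozen: \<open>du\<close> is any function satisfying the evolution equation
  pointwise, with the right-hand side already in divergence form. Integrability of \<open>f1\<close>
  and \<open>f2\<close> is part of the claim and is extracted from that equation.\<close>

lemma weak_formulation:
  fixes d :: nat and \<alpha> :: real
  assumes \<eta>: "\<eta> \<in> sobolev_H12 d S \<nu>"
    and du: "\<And>y. y \<in> S \<Longrightarrow> (\<alpha> * area_weight y) *\<^sub>R du y + ((1 - \<alpha> * area_weight y) * (\<nu> y \<bullet> du y)) *\<^sub>R \<nu> y =
      surface_div (projection \<nu>) y + projection \<nu> y *v surface_div flux y"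
  defines "P\<eta> \<equiv> \<lambda>y. projection \<nu> y *v \<eta> y"
    and "f1 \<equiv> \<lambda>y. (\<alpha> * area_weight y) * (du y \<bullet> \<eta> y)"
    and "f2 \<equiv> \<lambda>y. (1 - \<alpha> * area_weight y) * (du y \<bullet> \<nu> y) * (\<nu> y \<bullet> \<eta> y)"
    and "f3 \<equiv> \<lambda>y. frob (tan_grad_matrix S \<nu> (\<lambda>y. y) y) (weak_tan_grad d S \<nu> \<eta> y)"
    and "f4 \<equiv> \<lambda>y. weighted_frob (matrix_inv (H_hat M x \<nu> y)) (tan_grad_matrix S \<nu> (\<lambda>y. y) y)
      (weak_tan_grad d S \<nu> (\<lambda>y. projection \<nu> y *v \<eta> y) y) * area_weight y"
  shows "P\<eta> \<in> sobolev_H12 d S \<nu>"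
    and "set_integrable (hausdorff d) S f1" "set_integrable (hausdorff d) S f2"
    and "set_integrable (hausdorff d) S f3" "set_integrable (hausdorff d) S f4"
    and "0 = (LINT y:S|hausdorff d. f1 y) + (LINT y:S|hausdorff d. f2 y)
      + (LINT y:S|hausdorff d. f3 y) + (LINT y:S|hausdorff d. f4 y)"
proof -
  let ?M = "hausdorff d"
  \<comment> \<open>Membership in the space supplies a witness, so the choice in
    \<open>weak_tan_grad\<close> satisfies the integral identity.\<close>
  have weak: "has_weak_tan_grad d S \<nu> f (weak_tan_grad d S \<nu> f)" if "f \<in> sobolev_H12 d S \<nu>" for f
    using that unfolding sobolev_H12_def weak_tan_grad_def by (auto intro: someI[of "has_weak_tan_grad d S \<nu> f"])
  show P\<eta>: "P\<eta> \<in> sobolev_H12 d S \<nu>"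
    unfolding P\<eta>_def by (rule sobolev_H12_matrix_mult[OF \<eta> projection_C1_surface])
  note W3 = weak_div_theorem[OF weak[OF \<eta>] projection_C1_surface projection_normal]
  note W4 = weak_div_theorem[OF weak[OF P\<eta>] flux_C1_surface flux_normal]
  have f3: "f3 y = frob (projection \<nu> y) (weak_tan_grad d S \<nu> \<eta> y)" if "y \<in> S" for y
    unfolding f3_def tan_grad_matrix_id[OF that] ..
  have f4: "f4 y = frob (flux y) (weak_tan_grad d S \<nu> P\<eta> y)" if "y \<in> S" for y
    unfolding f4_def tan_grad_matrix_id[OF that] weighted_frob_flux P\<eta>_def ..
  show "set_integrable ?M S f3" by (rule iffD2[OF set_integrable_cong'[OF f3] W3(1)])
  show "set_integrable ?M S f4" by (rule iffD2[OF set_integrable_cong'[OF f4] W4(1)])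
  \<comment> \<open>In the normal direction the coefficients \<alpha> \<rho> and 1 - \<alpha> \<rho>
    add up to 1 and the projected term vanishes, so the normal velocity is a continuous
    function.\<close>
  have du_normal: "du y \<bullet> \<nu> y = \<nu> y \<bullet> surface_div (projection \<nu>) y" if y: "y \<in> S" for y
  proof -
    have u: "\<nu> y \<bullet> \<nu> y = 1" using normal_unit[OF y] by (simp add: norm_eq_1)
    have "\<nu> y \<bullet> ((\<alpha> * area_weight y) *\<^sub>R du y + ((1 - \<alpha> * area_weight y) * (\<nu> y \<bullet> du y)) *\<^sub>R \<nu> y) =
        \<nu> y \<bullet> du y"
      by (simp add: inner_add_right u algebra_simps)
    moreover have "\<nu> y \<bullet> (projection \<nu> y *v w) = 0" for w
      by (simp add: projection_symmetric projection_normal[OF y])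
    ultimately show ?thesis using du[OF y] by (simp add: inner_add_right inner_commute)
  qed
  have "set_integrable ?M S (\<lambda>y. \<eta> y $ \<beta>)" for \<beta>
    using weak[OF \<eta>] by (simp add: has_weak_tan_grad_def set_integrable_vec_iff[of _ _ \<eta>])
  then have i2': "set_integrable ?M S (\<lambda>y. \<Sum>\<beta>\<in>UNIV. ((1 - \<alpha> * area_weight y) *
      (\<Sum>\<kappa>\<in>UNIV. \<nu> y $ \<kappa> * surface_div (projection \<nu>) y $ \<kappa>) * \<nu> y $ \<beta>) * \<eta> y $ \<beta>)"
    by (intro set_integral_sum(1) set_integrable_continuous_mult[OF compact] continuous_intros
        area_weight_continuous normal_continuous surface_div_continuous projection_C1_surface)
  have f2: "f2 y = (\<Sum>\<beta>\<in>UNIV. ((1 - \<alpha> * area_weight y) *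
      (\<Sum>\<kappa>\<in>UNIV. \<nu> y $ \<kappa> * surface_div (projection \<nu>) y $ \<kappa>) * \<nu> y $ \<beta>) * \<eta> y $ \<beta>)" if "y \<in> S" for y
  proof -
    define c where "c = (1 - \<alpha> * area_weight y) *
      (\<Sum>\<kappa>\<in>UNIV. \<nu> y $ \<kappa> * surface_div (projection \<nu>) y $ \<kappa>)"
    have "f2 y = c * (\<nu> y \<bullet> \<eta> y)"
      unfolding f2_def du_normal[OF that] c_def by (simp add: inner_vec_def)
    then show ?thesis
      unfolding c_def[symmetric] by (simp add: inner_vec_def sum_distrib_left mult_ac)
  qed
  show i2: "set_integrable ?M S f2" by (rule iffD2[OF set_integrable_cong'[OF f2] i2'])
  \<comment> \<open>Together \<open>f1\<close> and \<open>f2\<close> are the left-hand side of the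
    equation tested with \<eta>; on the right the projection is symmetric and moves onto \<eta>.
    Thus \<open>f1\<close> is a difference of integrable functions.\<close>
  have f12: "f1 y = (\<eta> y \<bullet> surface_div (projection \<nu>) y + P\<eta> y \<bullet> surface_div flux y) - f2 y"
    if y: "y \<in> S" for y
  proof -
    have "f1 y + f2 y = \<eta> y \<bullet> ((\<alpha> * area_weight y) *\<^sub>R du y
        + ((1 - \<alpha> * area_weight y) * (\<nu> y \<bullet> du y)) *\<^sub>R \<nu> y)"
      by (simp add: f1_def f2_def inner_add_right inner_commute)
    then show ?thesis unfolding du[OF y] by (simp add: inner_add_right projection_symmetric P\<eta>_def)
  qed
  have i12: "set_integrable ?M S (\<lambda>y. \<eta> y \<bullet> surface_div (projection \<nu>) y + P\<eta> y \<bullet> surface_div flux y)"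
    by (intro set_integral_add(1) W3(2) W4(2))
  then have i1': "set_integrable ?M S
      (\<lambda>y. (\<eta> y \<bullet> surface_div (projection \<nu>) y + P\<eta> y \<bullet> surface_div flux y) - f2 y)"
    by (intro set_integral_diff(1) i2)
  show i1: "set_integrable ?M S f1" by (rule iffD2[OF set_integrable_cong'[OF f12] i1'])
  have "(LINT y:S|?M. f1 y) = (LINT y:S|?M. (\<eta> y \<bullet> surface_div (projection \<nu>) y + P\<eta> y \<bullet> surface_div flux y) - f2 y)"
    by (rule set_integral_cong') (rule f12)
  also have "\<dots> = (LINT y:S|?M. \<eta> y \<bullet> surface_div (projection \<nu>) y)
      + (LINT y:S|?M. P\<eta> y \<bullet> surface_div flux y) - (LINT y:S|?M. f2 y)"
    by (simp only: set_integral_diff(2)[OF i12 i2] set_integral_add(2)[OF W3(2) W4(2)])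
  moreover have "(LINT y:S|?M. f3 y) = (LINT y:S|?M. frob (projection \<nu> y) (weak_tan_grad d S \<nu> \<eta> y))"
    by (rule set_integral_cong'[OF f3])
  moreover have "(LINT y:S|?M. f4 y) = (LINT y:S|?M. frob (flux y) (weak_tan_grad d S \<nu> P\<eta> y))"
    by (rule set_integral_cong'[OF f4])
  ultimately show "0 = (LINT y:S|?M. f1 y) + (LINT y:S|?M. f2 y) + (LINT y:S|?M. f3 y) + (LINT y:S|?M. f4 y)"
    using W3(3) W4(3) by linarith
qed

end

theorem theorem5:
  fixes \<alpha> :: real and T :: ereal
    and M :: "(real^'m) set"
    and x :: "real \<Rightarrow> real^'m \<Rightarrow> real^'m"
    and \<nu> :: "real \<Rightarrow> real^'m \<Rightarrow> real^'m"
  defines "I \<equiv> {t::real. 0 \<le> t \<and> ereal t < T}"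
    and "n \<equiv> CARD('n::finite)"
    and "\<Gamma> \<equiv> \<lambda>t. x t ` M"
    and "\<rho>hat \<equiv> \<lambda>t. area_ratio TYPE('n) M (x t)"
    and "\<rho> \<equiv> \<lambda>t y. area_ratio TYPE('n) M (x t) (inv_into M (x t) y)"
    and "P \<equiv> \<lambda>t. projection (\<nu> t)"
    and "H \<equiv> \<lambda>t. H_hat M (x t) (\<nu> t)"
    and "u \<equiv> \<lambda>(t::real) (y::real^'m). y"
  assumes \<alpha>: "0 < \<alpha>" and T: "0 < T"
    and M: "smooth_hypersurface TYPE('n) M" "compact M" "connected M"
    and space_regularity: "\<forall>t\<in>I. C2_embedding TYPE('n) M (x t)"
    and time_regularity: "C1_in_time I M x"
    and normal: "\<forall>t\<in>I. unit_normal_field TYPE('n) M (x t) (\<nu> t)"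
    and evolution:
      "\<forall>t\<in>I. \<forall>U (X :: real^'n \<Rightarrow> real^'m). local_param M U X \<longrightarrow> (\<forall>\<theta>\<in>U.
         ((\<alpha> * \<rho>hat t (X \<theta>)) *\<^sub>R mat 1
            + (1 - \<alpha> * \<rho>hat t (X \<theta>)) *\<^sub>R (\<nu> t (x t (X \<theta>)) \<otimes>\<^sub>v \<nu> t (x t (X \<theta>))))
           *v vector_derivative (\<lambda>s. x s (X \<theta>)) (at t within I)
         = laplacian (induced_metric (x t \<circ> X)) (x t \<circ> X) \<theta>
           + \<rho>hat t (X \<theta>) *\<^sub>R
               (P t (x t (X \<theta>)) *v laplacian (induced_metric X) (x t \<circ> X) \<theta>))"
  shows
    "(\<forall>t\<in>I. \<forall>\<eta>\<in>sobolev_H12 n (\<Gamma> t) (\<nu> t).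
        let S = \<Gamma> t;
            du = material_derivative I M x u t;
            Du = tan_grad_matrix S (\<nu> t) (u t);
            P\<eta> = (\<lambda>y. P t y *v \<eta> y);
            f1 = (\<lambda>y. (\<alpha> * \<rho> t y) * (du y \<bullet> \<eta> y));
            f2 = (\<lambda>y. (1 - \<alpha> * \<rho> t y) * (du y \<bullet> \<nu> t y) * (\<nu> t y \<bullet> \<eta> y));
            f3 = (\<lambda>y. frob (Du y) (weak_tan_grad n S (\<nu> t) \<eta> y));
            f4 = (\<lambda>y. weighted_frob (matrix_inv (H t y)) (Du y)
                        (weak_tan_grad n S (\<nu> t) P\<eta> y) * \<rho> t y)
        in P\<eta> \<in> sobolev_H12 n S (\<nu> t) \<and>
           set_integrable (hausdorff n) S f1 \<and> set_integrable (hausdorff n) S f2 \<and>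
           set_integrable (hausdorff n) S f3 \<and> set_integrable (hausdorff n) S f4 \<and>
           0 = (LINT y:S|hausdorff n. f1 y) + (LINT y:S|hausdorff n. f2 y)
             + (LINT y:S|hausdorff n. f3 y) + (LINT y:S|hausdorff n. f4 y))
     \<and> (\<forall>t\<in>I. \<forall>y\<in>\<Gamma> t. invertible (H t y) \<and> \<rho> t y = sqrt (det (H t y)))"
proof (intro conjI ballI)
  fix t
  assume t: "t \<in> I"
  interpret embedded_surface "TYPE('n)" M "x t" "\<nu> t"
    using M space_regularity normal t by unfold_locales auto
  have weight: "area_weight = \<rho> t"
    by (simp add: fun_eq_iff area_weight_def \<rho>_def)
  have du: "(\<alpha> * area_weight y) *\<^sub>R material_derivative I M x u t y
      + ((1 - \<alpha> * area_weight y) * (\<nu> t y \<bullet> material_derivative I M x u t y)) *\<^sub>R \<nu> t y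
      = surface_div (projection (\<nu> t)) y + projection (\<nu> t) y *v surface_div flux y"
    if y: "y \<in> x t ` M" for y
  proof -
    obtain U and X :: "real^'n \<Rightarrow> real^'m" and \<theta> where X: "local_param M U X" "\<theta> \<in> U" and y': "y = x t (X \<theta>)"
      using surface_param[OF y] .
    \<comment> \<open>The identity composed with the flow is the trajectory of the material point
      \<open>X \<theta>\<close>, which the inverse embedding recovers from \<open>y\<close>.\<close>
    have du: "material_derivative I M x u t y = vector_derivative (\<lambda>s. x s (X \<theta>)) (at t within I)"
      by (simp add: material_derivative_def u_def y' param_inv[OF X])
    have r: "\<rho>hat t (X \<theta>) = area_weight y"
      by (simp add: \<rho>hat_def area_weight_def y' param_inv[OF X])
    \<comment> \<open>The two Laplacians of the evolution equation become the divergences of the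
      projection and of the flux, the factor \<rho> in front of the second one being part of the
      flux.\<close>
    show ?thesis
      using evolution[rule_format, OF t X] unfolding r P_def du[symmetric] y'[symmetric]
      by (simp add: matrix_vector_mult_add_rdistrib scaleR_matrix_vector_assoc[symmetric] outer_mult
          surface_div_flux[OF X] surface_div_projection[OF X] y' matrix_vector_mult_scaleR)
  qed
  {
    fix \<eta>
    assume "\<eta> \<in> sobolev_H12 n (\<Gamma> t) (\<nu> t)"
    then have "\<eta> \<in> sobolev_H12 n (x t ` M) (\<nu> t)" by (simp add: \<Gamma>_def)
    note W = weak_formulation[OF this du]
    show "let S = \<Gamma> t;
            du = material_derivative I M x u t;
            Du = tan_grad_matrix S (\<nu> t) (u t);
            P\<eta> = (\<lambda>y. P t y *v \<eta> y);
            f1 = (\<lambda>y. (\<alpha> * \<rho> t y) * (du y \<bullet> \<eta> y));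
            f2 = (\<lambda>y. (1 - \<alpha> * \<rho> t y) * (du y \<bullet> \<nu> t y) * (\<nu> t y \<bullet> \<eta> y));
            f3 = (\<lambda>y. frob (Du y) (weak_tan_grad n S (\<nu> t) \<eta> y));
            f4 = (\<lambda>y. weighted_frob (matrix_inv (H t y)) (Du y)
                        (weak_tan_grad n S (\<nu> t) P\<eta> y) * \<rho> t y)
        in P\<eta> \<in> sobolev_H12 n S (\<nu> t) \<and>
           set_integrable (hausdorff n) S f1 \<and> set_integrable (hausdorff n) S f2 \<and>
           set_integrable (hausdorff n) S f3 \<and> set_integrable (hausdorff n) S f4 \<and>
           0 = (LINT y:S|hausdorff n. f1 y) + (LINT y:S|hausdorff n. f2 y)
             + (LINT y:S|hausdorff n. f3 y) + (LINT y:S|hausdorff n. f4 y)"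
      using W unfolding Let_def \<Gamma>_def P_def H_def weight[symmetric] u_def by blast
  next
    fix y
    assume "y \<in> \<Gamma> t"
    then have y: "y \<in> x t ` M" by (simp add: \<Gamma>_def)
    show "invertible (H t y)"
      using det_H_hat_positive[OF y] by (simp add: invertible_det_nz H_def)
    show "\<rho> t y = sqrt (det (H t y))"
      using area_weight_eq[OF y] by (simp add: weight H_def)
  }
qed

end
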